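(* Let $\mathcal{S}$ be a free semigroup algebra on $n$ generators acting on a Hilbert space $\mathcal{H}$. Then either $\mathcal{S}$ is a von Neumann algebra, or $\mathcal{S}$ has a wandering vector.
   Context: Let $n\in\{1,2,3,\dots\}\cup\{\infty\}$. A free semigroup algebra $\mathcal{S}$ on $n$ generators is the weak-operator-closed (in general non-self-adjoint) subalgebra of $\mathcal{B}(\mathcal{H})$ generated by the identity and isometries $S_1,\dots,S_n$ on a complex Hilbert space $\mathcal{H}$ satisfying $S_i^*S_i=I$ and $S_i^*S_j=0$ for $i\neq j$. $\mathbb{F}_n^+$ denotes the free semigroup (with the empty word $\varnothing$) on the letters $\{1,\dots,n\}$. For $w=i_1\cdots i_k\in\mathbb{F}_n^+$ put $S_w=S_{i_1}\cdots S_{i_k}$ and $S_\varnothing=I$. A unit vector $x\in\mathcal{H}$ is wandering for $\mathcal{S}$ if the set $\{S_wx:w\in\mathbb{F}_n^+\}$ is orthonormal (i.e. $(S_ux,S_vx)=0$ for distinct words $u,v$). *)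

theory Defs
  imports "HOL-Analysis.Analysis"
begin

(* A complex Hilbert space is rendered as a complete real inner product space with a compatible
   complex structure; the real inner product is the real part of the complex one, so that the
   norm is the Hilbert space norm.  The inner product is linear in the first argument. *)

class complex_inner = real_inner +
  fixes scaleC :: "complex \<Rightarrow> 'a \<Rightarrow> 'a" (infixr \<open>*\<^sub>C\<close> 75)
    and cinner :: "'a \<Rightarrow> 'a \<Rightarrow> complex"
  assumes scaleC_add_right: "c *\<^sub>C (x + y) = c *\<^sub>C x + c *\<^sub>C y"
    and scaleC_add_left: "(c + d) *\<^sub>C x = c *\<^sub>C x + d *\<^sub>C x"
    and scaleC_scaleC: "c *\<^sub>C d *\<^sub>C x = (c * d) *\<^sub>C x"
    and scaleC_one: "1 *\<^sub>C x = x"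
    and scaleR_scaleC: "r *\<^sub>R x = complex_of_real r *\<^sub>C x"
    and cinner_commute: "cinner x y = cnj (cinner y x)"
    and cinner_add_left: "cinner (x + y) z = cinner x z + cinner y z"
    and cinner_scaleC_left: "cinner (c *\<^sub>C x) y = c * cinner x y"
    and inner_eq_Re_cinner: "inner x y = Re (cinner x y)"

class chilbert_space = complex_inner + complete_space

subclass (in chilbert_space) banach ..

lemma norm_eq_sqrt_cinner: "norm x = sqrt (Re (cinner x x))"
  by (simp add: norm_eq_sqrt_inner inner_eq_Re_cinner)

lemma norm_scaleC: "norm (c *\<^sub>C x) = cmod c * norm x"
proof -
  have "cinner (c *\<^sub>C x) (c *\<^sub>C x) = c * cnj c * cinner x x"
    by (metis cinner_commute cinner_scaleC_left complex_cnj_mult mult.assoc)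
  then have "cinner (c *\<^sub>C x) (c *\<^sub>C x) = complex_of_real ((cmod c)\<^sup>2) * cinner x x"
    by (simp only: complex_norm_square)
  then show ?thesis by (simp add: norm_eq_sqrt_cinner real_sqrt_mult)
qed

lemma cinner_self: "cinner x x = complex_of_real ((norm x)\<^sup>2)"
proof (rule complex_eqI)
  show "Re (cinner x x) = Re (complex_of_real ((norm x)\<^sup>2))"
    by (simp add: power2_norm_eq_inner inner_eq_Re_cinner)
  have "Im (cinner x x) = - Im (cinner x x)"
    by (metis cinner_commute cnj.sel(2))
  then show "Im (cinner x x) = Im (complex_of_real ((norm x)\<^sup>2))"
    by simp
qed

instantiation complex :: chilbert_space
begin
definition scaleC_complex :: "complex \<Rightarrow> complex \<Rightarrow> complex"
  where "scaleC_complex c x = c * x"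
definition cinner_complex :: "complex \<Rightarrow> complex \<Rightarrow> complex"
  where "cinner_complex x y = x * cnj y"
instance
  by standard
    (auto simp: scaleC_complex_def cinner_complex_def algebra_simps scaleR_conv_of_real
      inner_complex_def)
end

definition bounded_operators :: "('a::complex_inner \<Rightarrow> 'a) set" where
  "bounded_operators = {T. bounded_linear T \<and> (\<forall>c x. T (c *\<^sub>C x) = c *\<^sub>C T x)}"

(* Meaningful on Hilbert spaces: see cinner_cadjoint below. *)
definition cadjoint :: "('a::complex_inner \<Rightarrow> 'a) \<Rightarrow> 'a \<Rightarrow> 'a" where
  "cadjoint T = (THE T'. \<forall>x y. cinner (T x) y = cinner x (T' y))"

lemma riesz_real:
  fixes f :: "'a::{real_inner, complete_space} \<Rightarrow> real"
  assumes "bounded_linear f"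
  shows "\<exists>z. \<forall>x. f x = inner x z"
proof (cases "\<exists>u. f u \<noteq> 0")
  case False
  then show ?thesis by (intro exI[of _ 0]) simp
next
  case True
  interpret f: bounded_linear f by fact
  define K where "K = {x. f x = 1}"
  from True obtain u where "f u \<noteq> 0" by blast
  then have "(1 / f u) *\<^sub>R u \<in> K" by (simp add: K_def f.scaleR)
  then have Kne: "K \<noteq> {}" by blast
  have Kcl: "closed K"
    unfolding K_def by (intro closed_Collect_eq continuous_intros f.continuous_on)
  define d where "d = Inf (norm ` K)"
  have bdd: "bdd_below (norm ` K)" by (rule bdd_belowI[of _ 0]) auto
  have dle: "d \<le> norm x" if "x \<in> K" for x
    unfolding d_def by (rule cInf_lower) (use that bdd in auto)
  have d0: "0 \<le> d" unfolding d_def by (rule cInf_greatest) (use Kne in auto)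
  have "\<exists>x\<in>K. norm x < d + 1 / Suc k" for k :: nat
  proof -
    have "Inf (norm ` K) < d + 1 / Suc k" by (simp add: d_def)
    then show ?thesis using cInf_lessD[of "norm ` K"] Kne by fastforce
  qed
  then obtain X where XK: "\<And>k. X k \<in> K" and Xd: "\<And>k. norm (X k) < d + 1 / Suc k"
    by metis
  have par: "(norm (x - y))\<^sup>2 \<le> 2 * (norm x)\<^sup>2 + 2 * (norm y)\<^sup>2 - 4 * d\<^sup>2"
    if "x \<in> K" "y \<in> K" for x y
  proof -
    have "(1/2) *\<^sub>R (x + y) \<in> K" using that by (simp add: K_def f.scaleR f.add)
    then have "d \<le> norm ((1/2) *\<^sub>R (x + y))" by (rule dle)
    then have "2 * d \<le> norm (x + y)" by simp
    then have "(2 * d)\<^sup>2 \<le> (norm (x + y))\<^sup>2" by (rule power_mono) (use d0 in auto)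
    moreover have "(norm (x - y))\<^sup>2 + (norm (x + y))\<^sup>2 = 2 * (norm x)\<^sup>2 + 2 * (norm y)\<^sup>2"
      by (simp add: power2_norm_eq_inner inner_simps inner_commute)
    ultimately show ?thesis by (simp add: power_mult_distrib)
  qed
  have lim1: "(\<lambda>k. d + 1 / real (Suc k)) \<longlonglongrightarrow> d"
    using tendsto_add[OF tendsto_const LIMSEQ_Suc[OF lim_1_over_n], of d] by simp
  have Xn: "(\<lambda>k. norm (X k)) \<longlonglongrightarrow> d"
    by (rule tendsto_sandwich[OF _ _ tendsto_const lim1])
      (use dle XK Xd less_imp_le in \<open>auto intro!: always_eventually less_imp_le\<close>)
  have Xn2: "(\<lambda>k. 2 * (norm (X k))\<^sup>2) \<longlonglongrightarrow> 2 * d\<^sup>2"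
    by (intro tendsto_intros Xn)
  have "Cauchy X"
  proof (rule metric_CauchyI)
    fix e :: real assume "0 < e"
    then have "0 < e\<^sup>2 / 2" by simp
    from LIMSEQ_D[OF Xn2 this] obtain M
      where M: "\<And>k. k \<ge> M \<Longrightarrow> norm (2 * (norm (X k))\<^sup>2 - 2 * d\<^sup>2) < e\<^sup>2 / 2" by blast
    have "dist (X m) (X n) < e" if "m \<ge> M" "n \<ge> M" for m n
    proof -
      have "(norm (X m - X n))\<^sup>2 < e\<^sup>2"
        using par[OF XK[of m] XK[of n]] M[OF that(1)] M[OF that(2)] unfolding real_norm_def by linarith
      then show ?thesis using \<open>0 < e\<close> by (simp add: dist_norm power2_less_imp_less)
    qed
    then show "\<exists>M. \<forall>m\<ge>M. \<forall>n\<ge>M. dist (X m) (X n) < e" by blast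
  qed
  then obtain p where p: "X \<longlonglongrightarrow> p" using Cauchy_convergent convergent_def by blast
  have pK: "p \<in> K" using closed_sequentially[OF Kcl _ p] XK by blast
  have pd: "norm p = d" using LIMSEQ_unique[OF tendsto_norm[OF p] Xn] .
  have orth: "inner v p = 0" if "f v = 0" for v
  proof (cases "v = 0")
    case False
    define t where "t = inner v p / inner v v"
    have vv: "inner v v > 0" using False by simp
    have "p - t *\<^sub>R v \<in> K" using pK that by (simp add: K_def f.diff f.scaleR)
    from dle[OF this] have "norm p \<le> norm (p - t *\<^sub>R v)" using pd by simp
    then have "inner p p \<le> inner (p - t *\<^sub>R v) (p - t *\<^sub>R v)" by (simp add: norm_le)
    also have "\<dots> = inner p p - (inner v p)\<^sup>2 / inner v v"
      using vv by (simp add: t_def inner_simps inner_commute power2_eq_square field_simps)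
    finally have "(inner v p)\<^sup>2 / inner v v \<le> 0" by simp
    then show ?thesis using vv by (simp add: divide_le_0_iff)
  qed simp
  have pp: "inner p p \<noteq> 0" using pK by (auto simp: K_def f.zero)
  have "f x = inner x ((1 / inner p p) *\<^sub>R p)" for x
  proof -
    have "f (x - f x *\<^sub>R p) = 0" using pK by (simp add: K_def f.diff f.scaleR)
    from orth[OF this] have "inner x p = f x * inner p p" by (simp add: inner_simps)
    then show ?thesis using pp by simp
  qed
  then show ?thesis by blast
qed

lemma cinner_cadjoint:
  fixes T :: "'a::chilbert_space \<Rightarrow> 'a"
  assumes T: "T \<in> bounded_operators"
  shows "cinner (T x) y = cinner x (cadjoint T y)"
proof -
  have bl: "bounded_linear T" and sc: "\<And>c x. T (c *\<^sub>C x) = c *\<^sub>C T x"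
    using T by (auto simp: bounded_operators_def)
  have ex: "\<exists>z. \<forall>x. cinner (T x) y = cinner x z" for y
  proof -
    have "bounded_linear (\<lambda>x. inner (T x) y)"
      by (rule bounded_linear_compose[OF bounded_linear_inner_left bl])
    from riesz_real[OF this] obtain z where z: "\<And>x. inner (T x) y = inner x z" by blast
    have "cinner (T x) y = cinner x z" for x
      using z[of x] z[of "\<i> *\<^sub>C x"]
      by (simp add: complex_eq_iff inner_eq_Re_cinner sc cinner_scaleC_left)
    then show ?thesis by blast
  qed
  have uniq: "z = z'" if "\<And>x. cinner x z = cinner x z'" for z z' :: 'a
    using that vector_eq_ldot[of z z'] by (simp add: inner_eq_Re_cinner)
  from ex obtain T' where T': "\<And>x y. cinner (T x) y = cinner x (T' y)"
    using choice[of "\<lambda>y z. \<forall>x. cinner (T x) y = cinner x z"] by blast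
  have "\<exists>!T'. \<forall>x y. cinner (T x) y = cinner x (T' y)"
  proof (rule ex1I[of _ T'])
    fix R assume "\<forall>x y. cinner (T x) y = cinner x (R y)"
    then show "R = T'" by (intro ext uniq) (simp add: T'[symmetric])
  qed (simp add: T')
  from theI'[OF this] show ?thesis unfolding cadjoint_def by blast
qed

definition weak_operator_topology :: "('a::complex_inner \<Rightarrow> 'a) topology" where
  "weak_operator_topology = topology_generated_by
     {{T \<in> bounded_operators. cinner (T x) y \<in> U} | x y U. open U}"

lemma topspace_weak_operator_topology: "topspace weak_operator_topology = bounded_operators"
  unfolding weak_operator_topology_def topology_generated_by_topspace
proof (intro equalityI subsetI)
  fix T :: "'a \<Rightarrow> 'a" assume "T \<in> bounded_operators"
  then show "T \<in> \<Union> {{T \<in> bounded_operators. cinner (T x) y \<in> U} | x y U. open U}"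
    by (intro UnionI[of "{T \<in> bounded_operators. cinner (T 0) 0 \<in> UNIV}"] CollectI)
      (auto intro: open_UNIV)
qed blast

definition wot_closed_unital_algebra :: "('a::complex_inner \<Rightarrow> 'a) set \<Rightarrow> bool" where
  "wot_closed_unital_algebra A \<longleftrightarrow>
     A \<subseteq> bounded_operators \<and> id \<in> A \<and>
     (\<forall>T\<in>A. \<forall>R\<in>A. (\<lambda>x. T x + R x) \<in> A \<and> T \<circ> R \<in> A) \<and>
     (\<forall>c. \<forall>T\<in>A. (\<lambda>x. c *\<^sub>C T x) \<in> A) \<and>
     closedin weak_operator_topology A"

lemma wot_closed_unital_algebra_bounded_operators:
  "wot_closed_unital_algebra bounded_operators"
proof -
  have "bounded_linear (\<lambda>x::'a. c *\<^sub>C x)" for c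
  proof (rule bounded_linear_intro)
    show "c *\<^sub>C (x + y) = c *\<^sub>C x + c *\<^sub>C y" for x y :: 'a
      by (rule scaleC_add_right)
    show "c *\<^sub>C (r *\<^sub>R x) = r *\<^sub>R (c *\<^sub>C x)" for r and x :: 'a
      by (simp add: scaleR_scaleC scaleC_scaleC mult.commute)
    show "norm (c *\<^sub>C x) \<le> norm x * cmod c" for x :: 'a
      by (simp add: norm_scaleC mult.commute)
  qed
  note scale = bounded_linear_compose[OF this]
  have "closedin weak_operator_topology (bounded_operators :: ('a \<Rightarrow> 'a) set)"
    by (metis closedin_topspace topspace_weak_operator_topology)
  then show ?thesis
    unfolding wot_closed_unital_algebra_def
    by (auto simp: bounded_operators_def id_def o_def scaleC_add_right scaleC_scaleC mult.commute
        intro: bounded_linear_add bounded_linear_compose scale bounded_linear_ident)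
qed

definition von_neumann_algebra :: "('a::complex_inner \<Rightarrow> 'a) set \<Rightarrow> bool" where
  "von_neumann_algebra A \<longleftrightarrow> wot_closed_unital_algebra A \<and> (\<forall>T\<in>A. cadjoint T \<in> A)"

definition letters :: "enat \<Rightarrow> nat set" where
  "letters n = {i. 1 \<le> i \<and> enat i \<le> n}"

definition free_semigroup :: "enat \<Rightarrow> nat list set" where
  "free_semigroup n = lists (letters n)"

primrec word_operator :: "(nat \<Rightarrow> 'a \<Rightarrow> 'a) \<Rightarrow> nat list \<Rightarrow> 'a \<Rightarrow> 'a" where
  "word_operator S [] = id"
| "word_operator S (i # w) = S i \<circ> word_operator S w"

definition free_semigroup_algebra ::
    "enat \<Rightarrow> (nat \<Rightarrow> 'a::complex_inner \<Rightarrow> 'a) \<Rightarrow> ('a \<Rightarrow> 'a) set" where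
  "free_semigroup_algebra n S = wot_closed_unital_algebra hull (S ` letters n)"

(* The hull is over a nonempty family, so it really is an algebra of bounded operators. *)
lemma wot_closed_unital_algebra_free_semigroup_algebra:
  assumes "\<And>i. i \<in> letters n \<Longrightarrow> S i \<in> bounded_operators"
  shows "wot_closed_unital_algebra (free_semigroup_algebra n S)"
proof -
  let ?F = "{A. wot_closed_unital_algebra A \<and> S ` letters n \<subseteq> A}"
  have B: "bounded_operators \<in> ?F"
    using assms wot_closed_unital_algebra_bounded_operators by blast
  have F: "free_semigroup_algebra n S = \<Inter> ?F"
    by (simp add: free_semigroup_algebra_def hull_def)
  have "closedin weak_operator_topology (\<Inter> ?F)"
    by (rule closedin_Inter) (use B in \<open>auto simp: wot_closed_unital_algebra_def\<close>)
  moreover have "\<Inter> ?F \<subseteq> bounded_operators"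
    using B by blast
  ultimately show ?thesis
    unfolding F by (subst wot_closed_unital_algebra_def) (simp add: wot_closed_unital_algebra_def)
qed

definition wandering_vector ::
    "enat \<Rightarrow> (nat \<Rightarrow> 'a::complex_inner \<Rightarrow> 'a) \<Rightarrow> 'a \<Rightarrow> bool" where
  "wandering_vector n S x \<longleftrightarrow> norm x = 1 \<and>
     (\<forall>u\<in>free_semigroup n. \<forall>v\<in>free_semigroup n.
        cinner (word_operator S u x) (word_operator S v x) = (if u = v then 1 else 0))"

end

theory Submission
  imports Defs "HOL-Complex_Analysis.Conformal_Mappings"
begin

text \<open>
  A vector \<open>x\<close> outside the closed span of the \<open>S\<^sub>w x\<close>, \<open>w \<noteq> []\<close>, yields a wandering vector by projecting it
  off that span (Wold).  If every tuple of vectors lies in the closed span of its images under the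
  words \<open>w \<noteq> []\<close>, then applying \<open>S\<^sub>i\<^sup>*\<close> to approximating polynomials shows that \<open>S\<^sub>i\<^sup>*\<close> is a strong limit of
  polynomials in the generators, and the algebra is self-adjoint.  So outside the von Neumann case some
  finite direct sum of copies of \<open>S\<close> has a wandering vector, and it remains to descend to a single copy.

  For at least two generators, a component of that vector is a nonzero absolutely continuous \<open>x\<close>.
  If \<open>v = a\<^sup>m b\<close>, which does not overlap itself, then \<open>\<langle>S\<^sub>w S\<^sub>v x, S\<^sub>v x\<rangle>\<close> tends in \<open>\<ell>\<^sup>2\<close> to a
  multiple of the indicator of the empty word as \<open>m\<close> grows.  Were there no wandering vector, all
  invariant subspaces would be reducing, and the vectors \<open>S\<^sub>u\<^sup>* x\<close> provide corrections with negligible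
  cross terms.  Successive approximation then gives \<open>x, y\<close> with \<open>\<langle>S\<^sub>w x, y\<rangle> = 1\<close> for \<open>w = []\<close> and \<open>0\<close>
  otherwise, hence a wandering vector after all.

  For one generator the entries of a wandering tuple have spectral densities that add up to 1, and for
  a suitable unimodular \<open>\<zeta>\<close> the density of \<open>x + \<zeta> y\<close> together with the remaining entries is
  log-integrable.  The lower bound in Szego's theorem then shortens the tuple by one.
\<close>

section \<open>Row isometries\<close>

text \<open>The split by the number of generators is forced: a word that does not overlap itself
  needs two different letters. Infinitely many generators cause no third case, because every
  approximation involves finitely many words and square-summability is tested on finite families.

  For several generators the difficulty is the order of choices. The correction must be nearly
  orthogonal to the whole orbit of \<open>x\<close>, also along words that stop inside the run a^m
  b. Those words pair \<open>z\<close> with the adjoint of a^l b applied to \<open>x\<close>, a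
  vector that does not depend on m, so \<open>z\<close> can be fixed before m. Such vectors are only
  known to be limits of absolutely continuous ones, which is why closures appear.

  For one generator no spectral measure is constructed. Densities become squared norms of finite
  Fourier sums divided by N, integrals of logarithms become products over roots of unity, and
  Jensen's inequality for a polynomial becomes the maximum modulus principle, which selects a
  rotation of the grid.\<close>

lemma cinner_add_right: "cinner x (y + z) = cinner x y + cinner x (z :: 'a::complex_inner)"
  by (metis cinner_add_left cinner_commute complex_cnj_add)

lemma cinner_scaleC_right: "cinner x (c *\<^sub>C y) = cnj c * cinner x (y :: 'a::complex_inner)"
  by (metis cinner_scaleC_left cinner_commute complex_cnj_mult)

lemma cmod_cinner_le: "cmod (cinner x y) \<le> norm x * norm (y :: 'a::complex_inner)"
proof -
  \<comment> \<open>A phase that turns \<open>cinner x y\<close> into its modulus, so that the real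
    Cauchy-Schwarz inequality applies.\<close>
  define c where "c = (if cinner x y = 0 then 1 else cnj (sgn (cinner x y)))"
  have "cmod c = 1" by (simp add: c_def norm_sgn)
  have "c * cinner x y = complex_of_real (cmod (cinner x y))"
    by (simp add: c_def complex_sgn_def scaleR_conv_of_real)
      (simp add: mult.commute complex_norm_square[symmetric] power2_eq_square flip: mult.assoc)
  then have "cmod (cinner x y) = inner (c *\<^sub>C x) y"
    by (simp add: inner_eq_Re_cinner cinner_scaleC_left)
  also have "\<dots> \<le> norm (c *\<^sub>C x) * norm y" by (rule norm_cauchy_schwarz)
  finally show ?thesis by (simp add: norm_scaleC \<open>cmod c = 1\<close>)
qed

lemma bounded_bilinear_cinner: "bounded_bilinear (cinner :: 'a::complex_inner \<Rightarrow> 'a \<Rightarrow> complex)"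
proof
  fix x y :: 'a and r :: real
  show "cinner (r *\<^sub>R x) y = r *\<^sub>R cinner x y" "cinner x (r *\<^sub>R y) = r *\<^sub>R cinner x y"
    by (simp_all add: scaleR_scaleC[where 'a='a] cinner_scaleC_left cinner_scaleC_right scaleR_conv_of_real)
  show "\<exists>K. \<forall>a b::'a. cmod (cinner a b) \<le> norm a * norm b * K"
    using cmod_cinner_le by (intro exI[of _ 1]) auto
qed (simp_all add: cinner_add_left cinner_add_right)

lemma bounded_bilinear_scaleC: "bounded_bilinear (scaleC :: complex \<Rightarrow> 'a::complex_inner \<Rightarrow> 'a)"
proof
  fix a :: complex and x :: 'a and r :: real
  show "(r *\<^sub>R a) *\<^sub>C x = r *\<^sub>R (a *\<^sub>C x)" "a *\<^sub>C (r *\<^sub>R x) = r *\<^sub>R (a *\<^sub>C x)"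
    by (simp_all add: scaleR_scaleC[where 'a='a] scaleC_scaleC scaleR_conv_of_real mult.commute)
  show "\<exists>K. \<forall>a (b::'a). norm (a *\<^sub>C b) \<le> norm a * norm b * K"
    by (intro exI[of _ 1]) (simp add: norm_scaleC)
qed (simp_all add: scaleC_add_left scaleC_add_right)

interpretation cinner: bounded_bilinear "cinner :: 'a::complex_inner \<Rightarrow> 'a \<Rightarrow> complex"
  by (rule bounded_bilinear_cinner)

interpretation scaleC: bounded_bilinear "scaleC :: complex \<Rightarrow> 'a::complex_inner \<Rightarrow> 'a"
  by (rule bounded_bilinear_scaleC)

declare scaleC.zero_left [simp] scaleC.zero_right [simp] scaleC_one [simp]
  cinner.zero_left [simp] cinner.zero_right [simp]

lemma norm_add_sq:
  "(norm (x + y :: 'a::complex_inner))\<^sup>2 = (norm x)\<^sup>2 + (norm y)\<^sup>2 + 2 * Re (cinner x y)"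
  by (simp add: power2_norm_eq_inner inner_simps inner_commute flip: inner_eq_Re_cinner)

lemma eq_by_cinner: "(\<And>x. cinner x z = cinner x (y :: 'b::complex_inner)) \<Longrightarrow> z = y"
  using vector_eq_ldot[of z y] by (simp add: inner_eq_Re_cinner)

lemma cadjoint_eqI:
  fixes T :: "'a::complex_inner \<Rightarrow> 'a"
  assumes "\<And>x y. cinner (T x) y = cinner x (T' y)"
  shows "cadjoint T = T'"
  unfolding cadjoint_def
proof (rule the_equality)
  show "\<forall>x y. cinner (T x) y = cinner x (T' y)" by (intro allI assms)
  fix R assume R: "\<forall>x y. cinner (T x) y = cinner x (R y)"
  have "cinner x (R y) = cinner x (T' y)" for x y
    using R assms[of x y] by simp
  then show "R = T'" by (rule ext[OF eq_by_cinner])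
qed

lemma cinner_cadjoint_left:
  fixes T :: "'a::chilbert_space \<Rightarrow> 'a"
  assumes "T \<in> bounded_operators"
  shows "cinner (cadjoint T x) y = cinner x (T y)"
  using cinner_commute[of "cadjoint T x" y] cinner_commute[of x "T y"] cinner_cadjoint[OF assms, of y x]
  by simp


lemma cadjoint_bounded_operators:
  fixes T :: "'a::chilbert_space \<Rightarrow> 'a"
  assumes T: "T \<in> bounded_operators"
  shows "cadjoint T \<in> bounded_operators"
proof -
  obtain K where K: "\<And>x. norm (T x) \<le> norm x * K"
    using T bounded_linear.bounded[of T] by (auto simp: bounded_operators_def)
  have sc: "cadjoint T (c *\<^sub>C x) = c *\<^sub>C cadjoint T x" for c x
    by (rule eq_by_cinner) (simp add: cinner_scaleC_right flip: cinner_cadjoint[OF T])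
  have "bounded_linear (cadjoint T)"
  proof (rule bounded_linear_intro)
    show "cadjoint T (x + y) = cadjoint T x + cadjoint T y" for x y
      by (rule eq_by_cinner) (simp add: cinner_add_right flip: cinner_cadjoint[OF T])
    show "cadjoint T (r *\<^sub>R x) = r *\<^sub>R cadjoint T x" for r x
      by (simp add: scaleR_scaleC sc)
    show "norm (cadjoint T x) \<le> norm x * K" for x
    proof (cases "cadjoint T x = 0")
      case False
      have "(norm (cadjoint T x))\<^sup>2 = cmod (cinner (cadjoint T x) (cadjoint T x))"
        by (simp only: cinner_self norm_of_real) simp
      also have "\<dots> = cmod (cinner (T (cadjoint T x)) x)" by (simp add: cinner_cadjoint[OF T])
      also have "\<dots> \<le> norm (T (cadjoint T x)) * norm x" by (rule cmod_cinner_le)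
      also have "\<dots> \<le> (norm (cadjoint T x) * K) * norm x" by (intro mult_right_mono K) auto
      finally have "norm (cadjoint T x) * norm (cadjoint T x) \<le> norm (cadjoint T x) * (norm x * K)"
        by (simp add: power2_eq_square mult_ac)
      then show ?thesis using False by simp
    next
      case True
      have "0 \<le> norm x * K" using K[of x] norm_ge_zero order_trans by blast
      then show ?thesis using True by simp
    qed
  qed
  then show ?thesis using sc by (simp add: bounded_operators_def)
qed

section \<open>Words in the generators, their adjoints, and polynomials\<close>

locale row_isometry =
  fixes n :: enat and S :: "nat \<Rightarrow> 'a::chilbert_space \<Rightarrow> 'a"
  assumes bop: "\<And>i. i \<in> letters n \<Longrightarrow> S i \<in> bounded_operators"
    and cinner_S: "\<And>i j x y. i \<in> letters n \<Longrightarrow> j \<in> letters n \<Longrightarrow>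
      cinner (S i x) (S j y) = (if i = j then cinner x y else 0)"
begin

abbreviation "\<W> \<equiv> free_semigroup n"
abbreviation "opw \<equiv> word_operator S"
abbreviation "adj i \<equiv> cadjoint (S i)"

lemma words_simps [simp]:
  "[] \<in> \<W>" "i # w \<in> \<W> \<longleftrightarrow> i \<in> letters n \<and> w \<in> \<W>" "u @ v \<in> \<W> \<longleftrightarrow> u \<in> \<W> \<and> v \<in> \<W>"
  by (auto simp: free_semigroup_def)

lemma opw_append: "opw (u @ v) x = opw u (opw v x)"
  by (induction u) auto

lemma bounded_linear_S: "i \<in> letters n \<Longrightarrow> bounded_linear (S i)"
  and S_scaleC: "i \<in> letters n \<Longrightarrow> S i (c *\<^sub>C x) = c *\<^sub>C S i x"
  using bop by (auto simp: bounded_operators_def)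

lemma bounded_linear_opw: "w \<in> \<W> \<Longrightarrow> bounded_linear (opw w)"
  by (induction w) (auto simp: id_def o_def intro: bounded_linear_ident bounded_linear_compose bounded_linear_S)

lemma opw_scaleC: "w \<in> \<W> \<Longrightarrow> opw w (c *\<^sub>C x) = c *\<^sub>C opw w x"
  by (induction w) (auto simp: S_scaleC)

lemma opw_add: "w \<in> \<W> \<Longrightarrow> opw w (x + y) = opw w x + opw w y"
  and opw_diff: "w \<in> \<W> \<Longrightarrow> opw w (x - y) = opw w x - opw w y"
  and opw_sum: "w \<in> \<W> \<Longrightarrow> opw w (sum f A) = (\<Sum>i\<in>A. opw w (f i))"
  and opw_zero: "w \<in> \<W> \<Longrightarrow> opw w 0 = 0"
  and opw_tendsto: "w \<in> \<W> \<Longrightarrow> (f \<longlongrightarrow> x) G \<Longrightarrow> ((\<lambda>m. opw w (f m)) \<longlongrightarrow> opw w x) G"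
  using bounded_linear_opw
  by (auto simp: linear_simps bounded_linear.linear linear_sum linear_diff linear_add linear_0 intro: bounded_linear.tendsto)

lemma cinner_opw: "w \<in> \<W> \<Longrightarrow> cinner (opw w x) (opw w y) = cinner x y"
  by (induction w) (auto simp: cinner_S)

lemma norm_opw: "w \<in> \<W> \<Longrightarrow> norm (opw w x) = norm x"
  by (simp add: norm_eq_sqrt_cinner cinner_opw)

lemma cinner_adj: "i \<in> letters n \<Longrightarrow> cinner (S i x) y = cinner x (adj i y)"
  using cinner_cadjoint bop by blast

lemma adj_bop: "i \<in> letters n \<Longrightarrow> adj i \<in> bounded_operators"
  by (rule cadjoint_bounded_operators[OF bop])

lemma bounded_linear_adj: "i \<in> letters n \<Longrightarrow> bounded_linear (adj i)"
  and adj_scaleC: "i \<in> letters n \<Longrightarrow> adj i (c *\<^sub>C x) = c *\<^sub>C adj i x"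
  using adj_bop by (auto simp: bounded_operators_def)

lemma adj_add: "i \<in> letters n \<Longrightarrow> adj i (x + y) = adj i x + adj i y"
  and adj_diff: "i \<in> letters n \<Longrightarrow> adj i (x - y) = adj i x - adj i y"
  and adj_sum: "i \<in> letters n \<Longrightarrow> adj i (sum f A) = (\<Sum>j\<in>A. adj i (f j))"
  using bounded_linear_adj by (auto simp: bounded_linear.linear linear_add linear_sum linear_diff)

lemma adj_S: "i \<in> letters n \<Longrightarrow> j \<in> letters n \<Longrightarrow> adj i (S j x) = (if i = j then x else 0)"
  by (rule eq_by_cinner) (auto simp: cinner_S cinner.zero_right simp flip: cinner_adj)

lemma norm_S: "i \<in> letters n \<Longrightarrow> norm (S i x) = norm x"
  by (simp add: norm_eq_sqrt_cinner cinner_S)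

lemma norm_adj_le: "i \<in> letters n \<Longrightarrow> norm (adj i x) \<le> norm x"
proof -
  assume i: "i \<in> letters n"
  have "(norm (adj i x))\<^sup>2 = cmod (cinner (adj i x) (adj i x))"
    by (simp only: cinner_self norm_of_real) simp
  also have "\<dots> = cmod (cinner (S i (adj i x)) x)" by (simp add: cinner_adj i)
  also have "\<dots> \<le> norm (adj i x) * norm x" using cmod_cinner_le norm_S[OF i] by metis
  finally show ?thesis
    by (metis mult_left_le_imp_le norm_ge_zero order_le_less power2_eq_square)
qed

lemma S_sum: "i \<in> letters n \<Longrightarrow> S i (sum f A) = (\<Sum>j\<in>A. S i (f j))"
  using bounded_linear_S by (auto simp: bounded_linear.linear linear_sum)

definition pol :: "(nat list \<Rightarrow> complex) \<Rightarrow> nat list set \<Rightarrow> 'a \<Rightarrow> 'a" where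
  "pol a W x = (\<Sum>w\<in>W. a w *\<^sub>C opw w x)"

text \<open>The ranges of the generators are orthogonal, so \<open>adj i\<close> deletes a leading
  \<open>i\<close> and kills every other nonempty word. A constant term would leave a multiple of
  \<open>adj i x\<close> itself.\<close>

lemma adj_pol:
  assumes i: "i \<in> letters n" and W: "finite W" "W \<subseteq> \<W> - {[]}"
  defines "V \<equiv> {w. i # w \<in> W}"
  shows "finite V" "V \<subseteq> \<W>" "adj i (pol a W x) = pol (\<lambda>w. a (i # w)) V x"
proof -
  have "V = (#) i -` W" by (auto simp: V_def)
  then show "finite V" using W(1) by (simp add: finite_vimageI)
  show "V \<subseteq> \<W>" using W(2) by (force simp: V_def)
  have "adj i (pol a W x) = (\<Sum>w\<in>W. a w *\<^sub>C adj i (opw w x))"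
    unfolding pol_def by (simp add: adj_sum adj_scaleC i)
  also have "\<dots> = (\<Sum>w\<in>(#) i ` V. a w *\<^sub>C adj i (opw w x))"
  proof (rule sum.mono_neutral_right)
    show "\<forall>w\<in>W - (#) i ` V. a w *\<^sub>C adj i (opw w x) = 0"
    proof
      fix w assume w: "w \<in> W - (#) i ` V"
      then obtain j u where "w = j # u" "j \<in> letters n" using W(2)
        by (cases w) auto
      then show "a w *\<^sub>C adj i (opw w x) = 0" using w i by (auto simp: V_def adj_S)
    qed
  qed (use W in \<open>auto simp: V_def\<close>)
  also have "\<dots> = pol (\<lambda>w. a (i # w)) V x"
    unfolding pol_def by (subst sum.reindex) (auto simp: adj_S i)
  finally show "adj i (pol a W x) = pol (\<lambda>w. a (i # w)) V x" .
qed

text \<open>A tuple \<open>X 0, \<dots>, X (k - 1)\<close> stands for a vector of the \<open>k\<close>-fold direct sum of the space, on which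
  \<open>S\<close> acts diagonally; \<open>nondeg\<close> says that it is not a limit of vectors \<open>p(S) X\<close> with \<open>p\<close> free of constant term.\<close>

definition nondeg :: "nat \<Rightarrow> (nat \<Rightarrow> 'a) \<Rightarrow> bool" where
  "nondeg k X \<longleftrightarrow> (\<exists>c>0. \<forall>a W. finite W \<and> W \<subseteq> \<W> - {[]} \<longrightarrow>
      c \<le> (\<Sum>j<k. (norm (X j + pol a W (X j)))\<^sup>2))"

definition wander :: "nat \<Rightarrow> (nat \<Rightarrow> 'a) \<Rightarrow> bool" where
  "wander k X \<longleftrightarrow> (\<forall>u\<in>\<W>. \<forall>v\<in>\<W>.
      (\<Sum>j<k. cinner (opw u (X j)) (opw v (X j))) = (if u = v then 1 else 0))"

lemma wander_1: "wander 1 X \<Longrightarrow> wandering_vector n S (X 0)"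
  unfolding wander_def wandering_vector_def
  by (auto simp: norm_eq_sqrt_cinner dest!: bspec[of _ _ "[]"])

text \<open>Cancelling common leading letters ends either with one word exhausted or with two
  different letters, whose generators have orthogonal ranges.\<close>

lemma cinner_opw_cases:
  assumes "u \<in> \<W>" "v \<in> \<W>"
  shows "(\<exists>g\<in>\<W>. u = v @ g) \<or> (\<exists>g\<in>\<W>. v = u @ g) \<or> (\<forall>x y. cinner (opw u x) (opw v y) = 0)"
  using assms
proof (induction u arbitrary: v)
  case (Cons i u)
  show ?case
  proof (cases v)
    case (Cons j v')
    then show ?thesis using Cons.prems Cons.IH[of v'] by (cases "i = j") (auto simp: cinner_S)
  qed (use Cons in auto)
qed auto

end

section \<open>The Wold decomposition for tuples\<close>

text \<open>The parallelogram law, as for the nearest point of a closed convex set. Here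
  \<open>C\<close> is only closed under midpoints, so the extremal tuple \<open>z\<close> may lie
  outside it and comes with a sequence from \<open>C\<close> that converges to it.\<close>

lemma minimizing_tuple:
  fixes C :: "(nat \<Rightarrow> 'b::{real_inner, complete_space}) set"
  assumes ne: "C \<noteq> {}"
    and mid: "\<And>x y. x \<in> C \<Longrightarrow> y \<in> C \<Longrightarrow> (\<lambda>j. (1/2) *\<^sub>R (x j + y j)) \<in> C"
  obtains X z where "\<And>m. X m \<in> C" "\<And>j. j < k \<Longrightarrow> (\<lambda>m. X m j) \<longlonglongrightarrow> z j"
    "\<And>x. x \<in> C \<Longrightarrow> (\<Sum>j<k. (norm (z j))\<^sup>2) \<le> (\<Sum>j<k. (norm (x j))\<^sup>2)"
proof -
  define Q where "Q x = (\<Sum>j<k. (norm (x j :: 'b))\<^sup>2)" for x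
  define d where "d = Inf (Q ` C)"
  have bdd: "bdd_below (Q ` C)" by (rule bdd_belowI[of _ 0]) (auto simp: Q_def sum_nonneg)
  have dle: "d \<le> Q x" if "x \<in> C" for x
    unfolding d_def by (rule cInf_lower) (use that bdd in auto)
  have "\<exists>x\<in>C. Q x < d + 1 / Suc m" for m
  proof -
    have "Inf (Q ` C) < d + 1 / Suc m" by (simp add: d_def)
    then show ?thesis using cInf_lessD[of "Q ` C"] ne by fastforce
  qed
  then obtain X where XC: "\<And>m. X m \<in> C" and Xd: "\<And>m. Q (X m) < d + 1 / Suc m"
    by metis
  have par: "(norm (x j - y j))\<^sup>2 \<le> 2 * Q x + 2 * Q y - 4 * d"
    if "x \<in> C" "y \<in> C" "j < k" for x y j
  proof -
    have "(norm (x j - y j))\<^sup>2 \<le> (\<Sum>j<k. (norm (x j - y j))\<^sup>2)"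
      using that(3) by (intro member_le_sum) auto
    also have "\<dots> = (\<Sum>j<k. 2 * (norm (x j))\<^sup>2 + 2 * (norm (y j))\<^sup>2 - 4 * (norm ((1/2) *\<^sub>R (x j + y j)))\<^sup>2)"
      by (intro sum.cong refl) (simp add: power_divide, simp add: power2_norm_eq_inner inner_simps inner_commute)
    also have "\<dots> = 2 * Q x + 2 * Q y - 4 * Q (\<lambda>j. (1/2) *\<^sub>R (x j + y j))"
      by (simp add: Q_def sum.distrib sum_subtractf sum_distrib_left)
    finally show ?thesis using dle[OF mid[OF that(1,2)]] by linarith
  qed
  have "convergent (\<lambda>m. X m j)" if "j < k" for j
  proof (rule Cauchy_convergent, rule metric_CauchyI)
    fix e :: real assume "0 < e"
    then obtain M where M: "1 / real (Suc M) < e\<^sup>2 / 4"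
      using reals_Archimedean[of "e\<^sup>2 / 4"] by (auto simp: inverse_eq_divide)
    have small: "Q (X m) < d + e\<^sup>2 / 4" if "m \<ge> M" for m
    proof -
      have "1 / real (Suc m) \<le> 1 / real (Suc M)" using that by (simp add: frac_le)
      then show ?thesis using Xd[of m] M by linarith
    qed
    have "dist (X m j) (X l j) < e" if "m \<ge> M" "l \<ge> M" for m l
    proof -
      have "(norm (X m j - X l j))\<^sup>2 < e\<^sup>2"
        using par[OF XC[of m] XC[of l] \<open>j < k\<close>] small[OF that(1)] small[OF that(2)] by linarith
      then show ?thesis using \<open>0 < e\<close> by (simp add: dist_norm power2_less_imp_less)
    qed
    then show "\<exists>M. \<forall>m\<ge>M. \<forall>l\<ge>M. dist (X m j) (X l j) < e" by blast
  qed
  then obtain z where z: "\<And>j. j < k \<Longrightarrow> (\<lambda>m. X m j) \<longlonglongrightarrow> z j"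
    unfolding convergent_def by metis
  have "(\<lambda>m. Q (X m)) \<longlonglongrightarrow> Q z"
    unfolding Q_def by (intro tendsto_sum tendsto_power tendsto_norm z) auto
  moreover have "(\<lambda>m. d + 1 / real (Suc m)) \<longlonglongrightarrow> d"
    using tendsto_add[OF tendsto_const LIMSEQ_Suc[OF lim_1_over_n], of d] by simp
  ultimately have "Q z \<le> d"
    by (rule LIMSEQ_le) (use Xd in \<open>auto intro!: exI[of _ 0] less_imp_le\<close>)
  then have "Q z \<le> Q x" if "x \<in> C" for x using dle[OF that] by linarith
  then show ?thesis using that[OF XC z] unfolding Q_def by blast
qed

context row_isometry
begin

lemma pol_add:
  assumes "finite W" "finite V"
  shows "pol a W x + pol b V x
    = pol (\<lambda>w. (if w \<in> W then a w else 0) + (if w \<in> V then b w else 0)) (W \<union> V) x"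
proof -
  have "pol a W x = (\<Sum>w\<in>W \<union> V. (if w \<in> W then a w else 0) *\<^sub>C opw w x)"
    unfolding pol_def using assms by (intro sum.mono_neutral_cong_left) auto
  moreover have "pol b V x = (\<Sum>w\<in>W \<union> V. (if w \<in> V then b w else 0) *\<^sub>C opw w x)"
    unfolding pol_def using assms by (intro sum.mono_neutral_cong_left) auto
  ultimately show ?thesis by (simp add: pol_def scaleC_add_left sum.distrib)
qed

lemma scaleC_pol: "c *\<^sub>C pol a W x = pol (\<lambda>w. c * a w) W x"
  by (simp add: pol_def scaleC.sum_right scaleC_scaleC)

lemma opw_pol:
  assumes "u \<in> \<W>" "W \<subseteq> \<W>"
  shows "opw u (pol a W x) = pol (\<lambda>w. a (drop (length u) w)) ((@) u ` W) x"
  unfolding pol_def using assms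
  by (subst sum.reindex) (auto simp: opw_sum opw_scaleC opw_append inj_on_def intro!: sum.cong)

text \<open>A minimiser \<open>z\<close> over \<open>X\<close> plus the span of its nonempty words
  is orthogonal to that span. Since \<open>opw w z\<close> with \<open>w\<close> nonempty lies in
  the closure of the span, \<open>z\<close> is orthogonal to its own shifts, and
  \<open>nondeg\<close> keeps it away from 0.\<close>

lemma wold:
  assumes "nondeg k X"
  shows "\<exists>Z. wander k Z"
proof -
  obtain c where c: "c > 0"
    "\<And>a W. finite W \<Longrightarrow> W \<subseteq> \<W> - {[]} \<Longrightarrow> c \<le> (\<Sum>j<k. (norm (X j + pol a W (X j)))\<^sup>2)"
    using assms unfolding nondeg_def by (elim exE conjE) simp
  define C where "C = {x. \<exists>a W. finite W \<and> W \<subseteq> \<W> - {[]} \<and> x = (\<lambda>j. X j + pol a W (X j))}"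
  have CI: "(\<lambda>j. X j + pol a W (X j)) \<in> C" if "finite W" "W \<subseteq> \<W> - {[]}" for a W
    using that unfolding C_def by auto
  have add_pol: "(\<lambda>j. x j + t *\<^sub>C pol b V (X j)) \<in> C"
    if x: "x \<in> C" and V: "finite V" "V \<subseteq> \<W> - {[]}" for x t b V
  proof -
    obtain a W where W: "finite W" "W \<subseteq> \<W> - {[]}" "x = (\<lambda>j. X j + pol a W (X j))"
      using x unfolding C_def by auto
    show ?thesis
      unfolding W(3) add.assoc scaleC_pol pol_add[OF W(1) V(1)] by (rule CI) (use W V in auto)
  qed
  have mid: "(\<lambda>j. (1/2) *\<^sub>R (x j + y j)) \<in> C" if xC: "x \<in> C" and yC: "y \<in> C" for x y
  proof -
    obtain a W where W: "finite W" "W \<subseteq> \<W> - {[]}" "x = (\<lambda>j. X j + pol a W (X j))"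
      using xC unfolding C_def by auto
    obtain b V where V: "finite V" "V \<subseteq> \<W> - {[]}" "y = (\<lambda>j. X j + pol b V (X j))"
      using yC unfolding C_def by auto
    have "(\<lambda>j. (1/2) *\<^sub>R (x j + y j))
      = (\<lambda>j. (X j + pol (\<lambda>w. 1/2 * a w) W (X j)) + (1/2) *\<^sub>C pol b V (X j))"
    proof
      fix j
      have "x j + y j = 2 *\<^sub>R X j + (pol a W (X j) + pol b V (X j))"
        unfolding W(3) V(3) by (simp add: scaleR_2 add.commute add.left_commute)
      then have "(1/2) *\<^sub>R (x j + y j) = X j + ((1/2) *\<^sub>R pol a W (X j) + (1/2) *\<^sub>R pol b V (X j))"
        by (simp add: scaleR_add_right)
      also have "\<dots> = X j + pol (\<lambda>w. 1/2 * a w) W (X j) + (1/2) *\<^sub>C pol b V (X j)"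
        by (simp add: scaleR_scaleC[where 'a='a] scaleC_pol add.assoc)
      finally show "(1/2) *\<^sub>R (x j + y j) = X j + pol (\<lambda>w. 1/2 * a w) W (X j) + (1/2) *\<^sub>C pol b V (X j)" .
    qed
    then show ?thesis using add_pol[OF CI[OF W(1,2)] V(1,2)] by simp
  qed
  have "C \<noteq> {}" using CI[of "{}"] by blast
  from minimizing_tuple[OF this mid, of k] obtain Y z where YC: "\<And>m. Y m \<in> C"
    and Yz: "\<And>j. j < k \<Longrightarrow> (\<lambda>m. Y m j) \<longlonglongrightarrow> z j"
    and zmin: "\<And>x. x \<in> C \<Longrightarrow> (\<Sum>j<k. (norm (z j))\<^sup>2) \<le> (\<Sum>j<k. (norm (x j))\<^sup>2)"
    by blast
  have orth: "(\<Sum>j<k. cinner (z j) (v j)) = 0"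
    if v: "\<And>x t. x \<in> C \<Longrightarrow> (\<lambda>j. x j + t *\<^sub>C v j) \<in> C" for v
  proof -
    define s where "s = (\<Sum>j<k. cinner (z j) (v j))"
    define q where "q = (\<Sum>j<k. (norm (v j))\<^sup>2)"
    have q0: "q \<ge> 0" unfolding q_def by (intro sum_nonneg) auto
    have le: "(\<Sum>j<k. (norm (z j))\<^sup>2) \<le> (\<Sum>j<k. (norm (z j + t *\<^sub>C v j))\<^sup>2)" for t
    proof (rule LIMSEQ_le_const)
      show "(\<lambda>m. \<Sum>j<k. (norm (Y m j + t *\<^sub>C v j))\<^sup>2) \<longlonglongrightarrow> (\<Sum>j<k. (norm (z j + t *\<^sub>C v j))\<^sup>2)"
        by (intro tendsto_sum tendsto_power tendsto_norm tendsto_add Yz tendsto_const) auto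
      show "\<exists>N. \<forall>m\<ge>N. (\<Sum>j<k. (norm (z j))\<^sup>2) \<le> (\<Sum>j<k. (norm (Y m j + t *\<^sub>C v j))\<^sup>2)"
        using zmin[OF v[OF YC]] by blast
    qed
    have "(\<Sum>j<k. (norm (z j + t *\<^sub>C v j))\<^sup>2)
      = (\<Sum>j<k. (norm (z j))\<^sup>2) + (cmod t)\<^sup>2 * q + 2 * Re (cnj t * s)" for t
      by (simp add: norm_add_sq norm_scaleC cinner_scaleC_right power_mult_distrib q_def s_def
          sum.distrib sum_distrib_left sum_subtractf right_diff_distrib)
    then have ineq: "0 \<le> (cmod t)\<^sup>2 * q + 2 * Re (cnj t * s)" for t
      using le[of t] by simp
    \<comment> \<open>The step t = -\<tau> s changes the squared norm by \<tau> |s|^2 (\<tau> q -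
      2), which is negative unless s = 0. The added 1 covers q = 0.\<close>
    define \<tau> where "\<tau> = 1 / (q + 1)"
    have \<tau>: "\<tau> > 0" "\<tau> * q < 1" using q0 by (auto simp: \<tau>_def divide_simps)
    have "cnj (- complex_of_real \<tau> * s) * s = - complex_of_real \<tau> * (s * cnj s)" by simp
    also have "\<dots> = complex_of_real (- \<tau> * (cmod s)\<^sup>2)"
      unfolding complex_norm_square[symmetric] by simp
    finally have "Re (cnj (- complex_of_real \<tau> * s) * s) = - \<tau> * (cmod s)\<^sup>2"
      by (simp only: Re_complex_of_real)
    moreover have "(cmod (- complex_of_real \<tau> * s))\<^sup>2 = \<tau>\<^sup>2 * (cmod s)\<^sup>2"
      by (simp add: norm_mult power_mult_distrib)
    ultimately have "0 \<le> \<tau>\<^sup>2 * (cmod s)\<^sup>2 * q - 2 * \<tau> * (cmod s)\<^sup>2"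
      using ineq[of "- complex_of_real \<tau> * s"] by simp
    also have "\<dots> = (\<tau> * (cmod s)\<^sup>2) * (\<tau> * q - 2)" by (simp add: power2_eq_square algebra_simps)
    finally have "\<not> \<tau> * (cmod s)\<^sup>2 > 0" using \<tau>(2) by (simp add: zero_le_mult_iff)
    then have "s = 0" using \<tau>(1) by (auto simp: zero_less_mult_iff)
    then show ?thesis by (simp add: s_def)
  qed
  have orthw: "(\<Sum>j<k. cinner (z j) (opw w (z j))) = 0" if w: "w \<in> \<W>" "w \<noteq> []" for w
  proof -
    have "(\<Sum>j<k. cinner (z j) (opw w (Y m j))) = 0" for m
    proof (rule orth)
      fix x t assume x: "x \<in> C"
      obtain a W where W: "finite W" "W \<subseteq> \<W> - {[]}" "Y m = (\<lambda>j. X j + pol a W (X j))"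
        using YC[of m] unfolding C_def by auto
      \<comment> \<open>\<open>Y m\<close> is \<open>X\<close> plus nonempty words applied to
        \<open>X\<close>; after \<open>w\<close> every word is nonempty, so the result is an
        admissible direction. The first summand is the image of \<open>X\<close> itself.\<close>
      have "opw w (Y m j) = pol (\<lambda>_. 1) {w} (X j) + pol (\<lambda>u. a (drop (length w) u)) ((@) w ` W) (X j)" for j
        using w W by (subst opw_pol[symmetric]) (auto simp: W(3) opw_add pol_def scaleC_one)
      then have eq: "(\<lambda>j. x j + t *\<^sub>C opw w (Y m j)) = (\<lambda>j. (x j + t *\<^sub>C pol (\<lambda>_. 1) {w} (X j)) +
          t *\<^sub>C pol (\<lambda>u. a (drop (length w) u)) ((@) w ` W) (X j))"
        by (simp add: scaleC_add_right add.assoc)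
      show "(\<lambda>j. x j + t *\<^sub>C opw w (Y m j)) \<in> C"
        unfolding eq by (intro add_pol x) (use W w in auto)
    qed
    moreover have "(\<lambda>m. \<Sum>j<k. cinner (z j) (opw w (Y m j))) \<longlonglongrightarrow> (\<Sum>j<k. cinner (z j) (opw w (z j)))"
      by (intro tendsto_sum cinner.tendsto tendsto_const opw_tendsto Yz w) auto
    ultimately show ?thesis using LIMSEQ_unique[OF tendsto_const] by fastforce
  qed
  define q where "q = (\<Sum>j<k. (norm (z j))\<^sup>2)"
  have "c \<le> q"
  proof (rule LIMSEQ_le_const)
    show "(\<lambda>m. \<Sum>j<k. (norm (Y m j))\<^sup>2) \<longlonglongrightarrow> q"
      unfolding q_def by (intro tendsto_sum tendsto_power tendsto_norm Yz) auto
    have "c \<le> (\<Sum>j<k. (norm (Y m j))\<^sup>2)" for m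
      using YC[of m] c(2) unfolding C_def by auto
    then show "\<exists>N. \<forall>m\<ge>N. c \<le> (\<Sum>j<k. (norm (Y m j))\<^sup>2)" by blast
  qed
  then have q: "q > 0" using c(1) by linarith
  define d where "d = complex_of_real (1 / sqrt q)"
  define Z where "Z j = d *\<^sub>C z j" for j
  have "wander k Z"
    unfolding wander_def
  proof (intro ballI)
    fix u v assume uv: "u \<in> \<W>" "v \<in> \<W>"
    have scale: "(\<Sum>j<k. cinner (opw u (Z j)) (opw v (Z j)))
      = complex_of_real (1 / q) * (\<Sum>j<k. cinner (opw u (z j)) (opw v (z j)))"
    proof -
      have "complex_of_real (1 / q) = d * cnj d"
        using q by (simp add: d_def flip: of_real_mult)
      then show ?thesis
        using uv by (simp add: Z_def opw_scaleC cinner_scaleC_left cinner_scaleC_right sum_distrib_left mult_ac)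
    qed
    have flip: "(\<Sum>j<k. cinner (opw w (z j)) (z j)) = 0" if "w \<in> \<W>" "w \<noteq> []" for w
    proof -
      have "(\<Sum>j<k. cinner (opw w (z j)) (z j)) = cnj (\<Sum>j<k. cinner (z j) (opw w (z j)))"
        unfolding cnj_sum by (intro sum.cong refl cinner_commute)
      then show ?thesis using orthw[OF that] by simp
    qed
    show "(\<Sum>j<k. cinner (opw u (Z j)) (opw v (Z j))) = (if u = v then 1 else 0)"
    proof (cases "u = v")
      case True
      then have "(\<Sum>j<k. cinner (opw u (z j)) (opw v (z j))) = complex_of_real q"
        using uv by (simp add: cinner_self norm_opw q_def)
      then show ?thesis unfolding scale using q True by (simp flip: of_real_mult)
    next
      case False
      have "(\<Sum>j<k. cinner (opw u (z j)) (opw v (z j))) = 0"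
        using cinner_opw_cases[OF uv]
      proof (elim disjE bexE)
        fix g assume g: "g \<in> \<W>" "u = v @ g"
        then have "g \<noteq> []" using False by auto
        then show ?thesis using g uv by (simp add: opw_append cinner_opw flip)
      next
        fix g assume g: "g \<in> \<W>" "v = u @ g"
        then have "g \<noteq> []" using False by auto
        then show ?thesis using g uv by (simp add: opw_append cinner_opw orthw)
      qed simp
      then show ?thesis using False by (simp add: scale)
    qed
  qed
  then show ?thesis by blast
qed

end

section \<open>Approximation of the adjoints\<close>

text \<open>Only the subbasic case has content: |<(R - T) x, y>| is at most ||R x - T x||
  ||y||.\<close>

lemma wot_open_strong_neighbourhood:
  assumes "openin weak_operator_topology W" "T \<in> W"
  shows "\<exists>F e. finite F \<and> e > 0 \<and>
    (\<forall>R\<in>bounded_operators. (\<forall>h\<in>F. norm (R h - T h) < e) \<longrightarrow> R \<in> W)"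
proof -
  have "generate_topology_on {{T \<in> bounded_operators. cinner (T x) y \<in> U} | x y U. open U} W"
    using assms(1) by (simp add: weak_operator_topology_def openin_topology_generated_by_iff)
  then show ?thesis using assms(2)
  proof (induction)
    case (Int a b)
    then have T: "T \<in> a" "T \<in> b" by auto
    from Int.IH(1)[OF T(1)] obtain F e where F: "finite F" "e > 0"
        "\<forall>R\<in>bounded_operators. (\<forall>h\<in>F. norm (R h - T h) < e) \<longrightarrow> R \<in> a"
      by (elim exE conjE)
    from Int.IH(2)[OF T(2)] obtain G d where G: "finite G" "d > 0"
        "\<forall>R\<in>bounded_operators. (\<forall>h\<in>G. norm (R h - T h) < d) \<longrightarrow> R \<in> b"
      by (elim exE conjE)
    from F G show ?case by (intro exI[of _ "F \<union> G"] exI[of _ "min e d"]) auto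
  next
    case (UN K)
    then obtain k where k: "k \<in> K" "T \<in> k" by blast
    show ?case using UN.IH[OF k] k(1) by blast
  next
    case (Basis s)
    then obtain x y U where s: "s = {T \<in> bounded_operators. cinner (T x) y \<in> U}" "open U" by blast
    then obtain e where e: "e > 0" "\<And>z. dist z (cinner (T x) y) < e \<Longrightarrow> z \<in> U"
      using Basis.prems unfolding open_dist by auto
    have ny: "norm y + 1 > 0" using norm_ge_zero[of y] by linarith
    show ?case
    proof (intro exI conjI ballI impI)
      show "finite {x}" "e / (norm y + 1) > 0" using e(1) ny by auto
      fix R assume R: "R \<in> bounded_operators" "\<forall>h\<in>{x}. norm (R h - T h) < e / (norm y + 1)"
      have "dist (cinner (R x) y) (cinner (T x) y) \<le> norm (R x - T x) * norm y"
        unfolding dist_norm cinner.diff_left[symmetric] by (rule cmod_cinner_le)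
      also have "\<dots> \<le> norm (R x - T x) * (norm y + 1)" by (intro mult_left_mono) auto
      also have "\<dots> < e" using R(2) ny by (simp add: pos_less_divide_eq)
      finally show "R \<in> s" using e(2) R(1) s(1) by blast
    qed
  qed auto
qed

text \<open>Reduces membership to norm approximation at the vectors of a finite \<open>F\<close> by
  one and the same operator. A single operator for all of \<open>F\<close> is the reason why tuples
  of vectors enter the proof.\<close>

lemma wot_closed_strong_limit:
  assumes A: "closedin weak_operator_topology A" and T: "T \<in> bounded_operators"
    and lim: "\<And>F e. finite F \<Longrightarrow> e > 0 \<Longrightarrow> \<exists>R\<in>A. \<forall>h\<in>F. norm (R h - T h) < e"
  shows "T \<in> A"
proof (rule ccontr)
  assume "T \<notin> A"
  with A T have "openin weak_operator_topology (bounded_operators - A)" "T \<in> bounded_operators - A"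
    by (auto simp: closedin_def topspace_weak_operator_topology)
  from wot_open_strong_neighbourhood[OF this] obtain F e where "finite F" "e > 0"
    and Fe: "\<forall>R\<in>bounded_operators. (\<forall>h\<in>F. norm (R h - T h) < e) \<longrightarrow> R \<in> bounded_operators - A"
    by blast
  from lim[OF this(1,2)] obtain R where R: "R \<in> A" "\<forall>h\<in>F. norm (R h - T h) < e" by blast
  have "A \<subseteq> bounded_operators"
    using closedin_subset[OF A] by (simp add: topspace_weak_operator_topology)
  with R Fe show False by blast
qed

text \<open>The adjoint is continuous in the weak operator topology because <T* x, y> is the
  conjugate of <T y, x>, so a subbasic set pulls back to a subbasic set. The strong operator
  topology has no such property in general.\<close>

lemma openin_cadjoint_vimage:
  fixes W :: "('a::chilbert_space \<Rightarrow> 'a) set"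
  assumes "openin weak_operator_topology W"
  shows "openin weak_operator_topology {T \<in> bounded_operators. cadjoint T \<in> W}"
proof -
  let ?B = "{{T \<in> bounded_operators. cinner (T x) y \<in> U} | x y U. open U} :: ('a \<Rightarrow> 'a) set set"
  have "generate_topology_on ?B W"
    using assms by (simp add: weak_operator_topology_def openin_topology_generated_by_iff)
  then show ?thesis
  proof (induction)
    case (Int a b)
    have "{T \<in> bounded_operators. cadjoint T \<in> a \<inter> b}
      = {T \<in> bounded_operators. cadjoint T \<in> a} \<inter> {T \<in> bounded_operators. cadjoint T \<in> b}" by blast
    then show ?case using openin_Int[OF Int.IH] by simp
  next
    case (UN K)
    have "{T \<in> bounded_operators. cadjoint T \<in> \<Union> K}
      = (\<Union>k\<in>K. {T \<in> bounded_operators. cadjoint T \<in> k})" by blast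
    then show ?case using UN.IH by (auto intro!: openin_Union)
  next
    case (Basis s)
    then obtain x y U where s: "s = {T \<in> bounded_operators. cinner (T x) y \<in> U}" "open U" by blast
    have eq: "{T \<in> bounded_operators. cadjoint T \<in> s}
      = {T \<in> bounded_operators. cinner (T y) x \<in> cnj -` U}"
      unfolding s by (auto simp: cadjoint_bounded_operators cinner_cadjoint_left simp flip: cinner_commute)
    have "open (cnj -` U)"
      using s(2) by (intro continuous_open_vimage) (auto intro: continuous_intros)
    then have "{T \<in> bounded_operators. cinner (T y) x \<in> cnj -` U} \<in> ?B" by blast
    from topology_generated_by_Basis[OF this] show ?case
      unfolding weak_operator_topology_def eq .
  qed simp
qed

context row_isometry
begin

lemma S_in_algebra: "i \<in> letters n \<Longrightarrow> S i \<in> free_semigroup_algebra n S"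
  unfolding free_semigroup_algebra_def by (rule subsetD[OF hull_subset]) simp

lemma pol_in_algebra:
  assumes A: "wot_closed_unital_algebra A" "S ` letters n \<subseteq> A" and W: "finite W" "W \<subseteq> \<W>"
  shows "pol a W \<in> A"
proof -
  have opw: "opw w \<in> A" if "w \<in> \<W>" for w
    using that A by (induction w) (auto simp: wot_closed_unital_algebra_def)
  have "(\<lambda>x. 0 *\<^sub>C id x) \<in> A" using A unfolding wot_closed_unital_algebra_def by blast
  then have zero: "(\<lambda>x. 0) \<in> A" by simp
  have add: "(\<lambda>x. T x + R x) \<in> A" if "T \<in> A" "R \<in> A" for T R
    using that A unfolding wot_closed_unital_algebra_def by blast
  have sc: "(\<lambda>x. c *\<^sub>C T x) \<in> A" if "T \<in> A" for T c
    using that A unfolding wot_closed_unital_algebra_def by blast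
  have "(\<lambda>x. \<Sum>w\<in>W. a w *\<^sub>C opw w x) \<in> A"
    using W
  proof (induction W rule: finite_induct)
    case (insert u W)
    then show ?case using add[OF sc[OF opw[of u]] insert.IH] by simp
  qed (simp add: zero)
  then show ?thesis by (simp add: pol_def[abs_def])
qed

text \<open>The elements whose adjoint also lies in the algebra form a closed unital algebra; once
  it contains the generators, minimality of the hull makes it everything.\<close>

lemma von_neumann_if_adj:
  assumes "\<And>i. i \<in> letters n \<Longrightarrow> adj i \<in> free_semigroup_algebra n S"
  shows "von_neumann_algebra (free_semigroup_algebra n S)"
proof -
  let ?A = "free_semigroup_algebra n S"
  have A: "wot_closed_unital_algebra ?A"
    using bop by (rule wot_closed_unital_algebra_free_semigroup_algebra)
  then have sub: "?A \<subseteq> bounded_operators" and cl: "closedin weak_operator_topology ?A"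
    by (auto simp: wot_closed_unital_algebra_def)
  have mem: "T \<in> bounded_operators" if "T \<in> ?A" for T using that sub by blast
  note ops = A[unfolded wot_closed_unital_algebra_def, THEN conjunct2]
  define B where "B = {T \<in> ?A. cadjoint T \<in> ?A}"
  have adj_sum': "cadjoint (\<lambda>x. T x + R x) = (\<lambda>x. cadjoint T x + cadjoint R x)"
    if "T \<in> ?A" "R \<in> ?A" for T R
    by (rule cadjoint_eqI) (use that mem in \<open>auto simp: cinner_add_left cinner_add_right cinner_cadjoint\<close>)
  have adj_comp: "cadjoint (T \<circ> R) = cadjoint R \<circ> cadjoint T" if "T \<in> ?A" "R \<in> ?A" for T R
    by (rule cadjoint_eqI) (use that mem in \<open>auto simp: cinner_cadjoint\<close>)
  have adj_sc: "cadjoint (\<lambda>x. c *\<^sub>C T x) = (\<lambda>x. cnj c *\<^sub>C cadjoint T x)" if "T \<in> ?A" for c T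
    by (rule cadjoint_eqI) (use that mem in \<open>auto simp: cinner_scaleC_left cinner_scaleC_right cinner_cadjoint\<close>)
  have adj_id: "cadjoint (id :: 'a \<Rightarrow> 'a) = id" by (rule cadjoint_eqI) simp
  have closedB: "closedin weak_operator_topology B"
    unfolding closedin_def topspace_weak_operator_topology
  proof
    show "B \<subseteq> bounded_operators" using sub by (auto simp: B_def)
    have "bounded_operators - B = (bounded_operators - ?A) \<union>
        {T \<in> bounded_operators. cadjoint T \<in> bounded_operators - ?A}"
      by (auto simp: B_def cadjoint_bounded_operators)
    moreover have op: "openin weak_operator_topology (bounded_operators - ?A)"
      using cl by (simp add: closedin_def topspace_weak_operator_topology)
    ultimately show "openin weak_operator_topology (bounded_operators - B)"
      using openin_Un[OF op openin_cadjoint_vimage[OF op]] by simp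
  qed
  have "wot_closed_unital_algebra B"
    unfolding wot_closed_unital_algebra_def
  proof (intro conjI ballI allI)
    show "B \<subseteq> bounded_operators" using sub by (auto simp: B_def)
    show "id \<in> B" using ops by (simp add: B_def adj_id)
    show "(\<lambda>x. T x + R x) \<in> B" "T \<circ> R \<in> B" if "T \<in> B" "R \<in> B" for T R
      using that ops by (auto simp: B_def adj_sum' adj_comp)
    show "(\<lambda>x. c *\<^sub>C T x) \<in> B" if "T \<in> B" for c T
      using that ops by (auto simp: B_def adj_sc)
  qed (rule closedB)
  moreover have "S ` letters n \<subseteq> B" using assms S_in_algebra by (auto simp: B_def)
  ultimately have "?A \<subseteq> B" unfolding free_semigroup_algebra_def by (intro hull_minimal) auto
  then show ?thesis using A by (auto simp: von_neumann_algebra_def B_def)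
qed

lemma not_von_neumann_nondeg:
  assumes "\<not> von_neumann_algebra (free_semigroup_algebra n S)"
  shows "\<exists>k X. nondeg k X"
proof (rule ccontr)
  assume deg: "\<nexists>k X. nondeg k X"
  have "adj i \<in> A" if i: "i \<in> letters n" and A: "wot_closed_unital_algebra A" "S ` letters n \<subseteq> A" for i A
  proof (rule wot_closed_strong_limit)
    show "closedin weak_operator_topology A" using A by (simp add: wot_closed_unital_algebra_def)
    show "adj i \<in> bounded_operators" using i by (rule adj_bop)
    fix F :: "'a set" and e :: real assume F: "finite F" and e: "e > 0"
    then obtain xs where xs: "set xs = F" using finite_list by blast
    have "\<not> nondeg (length xs) (nth xs)" using deg by blast
    then obtain a W where W: "finite W" "W \<subseteq> \<W> - {[]}"
      and lt: "(\<Sum>j<length xs. (norm (xs ! j + pol a W (xs ! j)))\<^sup>2) < e\<^sup>2"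
      using e unfolding nondeg_def by (auto simp: not_le dest!: spec[of _ "e\<^sup>2"])
    define V where "V = {w. i # w \<in> W}"
    have V: "finite V" "V \<subseteq> \<W>" and adj_pol: "\<And>x. adj i (pol a W x) = pol (\<lambda>w. a (i # w)) V x"
      using adj_pol[OF i W] unfolding V_def by auto
    have "norm (pol (\<lambda>w. - a (i # w)) V h - adj i h) < e" if hF: "h \<in> F" for h
    proof -
      obtain j where j: "j < length xs" "h = xs ! j" using hF xs by (auto simp: in_set_conv_nth)
      have "(norm (h + pol a W h))\<^sup>2 \<le> (\<Sum>j<length xs. (norm (xs ! j + pol a W (xs ! j)))\<^sup>2)"
        unfolding j(2) using j(1) by (intro member_le_sum) auto
      then have "norm (h + pol a W h) < e" using lt e by (meson less_imp_le order_le_less_trans power2_less_imp_less)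
      \<comment> \<open>Applying the contraction \<open>adj i\<close> to the small vector
        \<open>h + pol a W h\<close> turns it into the approximation error for
        \<open>adj i h\<close>.\<close>
      moreover have "pol (\<lambda>w. - a (i # w)) V h - adj i h = - adj i (h + pol a W h)"
        by (simp add: adj_add i adj_pol) (simp add: pol_def scaleC.minus_left sum_negf)
      ultimately show ?thesis using norm_adj_le[OF i, of "h + pol a W h"] by simp
    qed
    then show "\<exists>R\<in>A. \<forall>h\<in>F. norm (R h - adj i h) < e"
      using pol_in_algebra[OF A V] by blast
  qed
  then have "adj i \<in> free_semigroup_algebra n S" if "i \<in> letters n" for i
    using that by (simp add: free_semigroup_algebra_def hull_def)
  then show False using von_neumann_if_adj assms by blast
qed

end

section \<open>Several generators\<close>

definition l2_bound :: "'i set \<Rightarrow> ('i \<Rightarrow> complex) \<Rightarrow> real \<Rightarrow> bool" where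
  "l2_bound A f r \<longleftrightarrow> (\<forall>F. finite F \<and> F \<subseteq> A \<longrightarrow> L2_set (\<lambda>i. cmod (f i)) F \<le> r)"

lemma l2_boundI: "(\<And>F. finite F \<Longrightarrow> F \<subseteq> A \<Longrightarrow> L2_set (\<lambda>i. cmod (f i)) F \<le> r) \<Longrightarrow> l2_bound A f r"
  and l2_boundD: "l2_bound A f r \<Longrightarrow> finite F \<Longrightarrow> F \<subseteq> A \<Longrightarrow> L2_set (\<lambda>i. cmod (f i)) F \<le> r"
  by (auto simp: l2_bound_def)

lemma l2_bound_nonneg: "l2_bound A f r \<Longrightarrow> 0 \<le> r"
  using l2_boundD[of A f r "{}"] by simp

lemma l2_bound_iff_sum:
  "0 \<le> r \<Longrightarrow> l2_bound A f r \<longleftrightarrow> (\<forall>F. finite F \<and> F \<subseteq> A \<longrightarrow> (\<Sum>i\<in>F. (cmod (f i))\<^sup>2) \<le> r\<^sup>2)"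
  unfolding l2_bound_def L2_set_def by (metis real_sqrt_le_iff real_sqrt_abs abs_of_nonneg)

lemma l2_bound_sumD:
  assumes "l2_bound A f r" "finite F" "F \<subseteq> A"
  shows "(\<Sum>i\<in>F. (cmod (f i))\<^sup>2) \<le> r\<^sup>2"
  using assms l2_bound_nonneg[OF assms(1)] l2_bound_iff_sum by blast

lemma l2_bound_mono: "l2_bound A f r \<Longrightarrow> B \<subseteq> A \<Longrightarrow> r \<le> s \<Longrightarrow> l2_bound B f s"
  unfolding l2_bound_def by (meson order_trans)

lemma l2_bound_point: "l2_bound A f r \<Longrightarrow> i \<in> A \<Longrightarrow> cmod (f i) \<le> r"
  using l2_boundD[of A f r "{i}"] by simp

lemma l2_bound_add:
  assumes "l2_bound A f r" "l2_bound A g s"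
  shows "l2_bound A (\<lambda>i. f i + g i) (r + s)"
proof (rule l2_boundI)
  fix F assume F: "finite F" "F \<subseteq> A"
  have "L2_set (\<lambda>i. cmod (f i + g i)) F \<le> L2_set (\<lambda>i. cmod (f i) + cmod (g i)) F"
    by (intro L2_set_mono) (auto intro: norm_triangle_ineq)
  also have "\<dots> \<le> L2_set (\<lambda>i. cmod (f i)) F + L2_set (\<lambda>i. cmod (g i)) F" by (rule L2_set_triangle_ineq)
  also have "\<dots> \<le> r + s" using assms F by (intro add_mono l2_boundD)
  finally show "L2_set (\<lambda>i. cmod (f i + g i)) F \<le> r + s" .
qed

lemma l2_bound_cmult:
  assumes "l2_bound A f r"
  shows "l2_bound A (\<lambda>i. c * f i) (cmod c * r)"
proof (rule l2_boundI)
  fix F assume F: "finite F" "F \<subseteq> A"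
  have "L2_set (\<lambda>i. cmod (c * f i)) F = cmod c * L2_set (\<lambda>i. cmod (f i)) F"
    by (simp add: norm_mult L2_set_right_distrib)
  then show "L2_set (\<lambda>i. cmod (c * f i)) F \<le> cmod c * r"
    using l2_boundD[OF assms F] by (simp add: mult_left_mono)
qed

lemma l2_bound_sum:
  assumes "finite I" "\<And>k. k \<in> I \<Longrightarrow> l2_bound A (f k) (r k)"
  shows "l2_bound A (\<lambda>i. \<Sum>k\<in>I. f k i) (\<Sum>k\<in>I. r k)"
  using assms by (induction rule: finite_induct) (auto simp: l2_bound_add, simp add: l2_bound_def L2_set_def)

lemma l2_bound_Un:
  assumes "l2_bound A f r" "l2_bound B f s"
  shows "l2_bound (A \<union> B) f (r + s)"
proof -
  have rs: "0 \<le> r" "0 \<le> s" using assms l2_bound_nonneg by auto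
  show ?thesis
    unfolding l2_bound_iff_sum[OF add_nonneg_nonneg[OF rs]]
  proof (intro allI impI)
    fix F assume F: "finite F \<and> F \<subseteq> A \<union> B"
    have "(\<Sum>i\<in>F. (cmod (f i))\<^sup>2) = (\<Sum>i\<in>F \<inter> A. (cmod (f i))\<^sup>2) + (\<Sum>i\<in>F - A. (cmod (f i))\<^sup>2)"
      using F by (metis sum.Int_Diff)
    also have "\<dots> \<le> r\<^sup>2 + s\<^sup>2"
      using F by (intro add_mono l2_bound_sumD[OF assms(1)] l2_bound_sumD[OF assms(2)]) auto
    also have "\<dots> \<le> (r + s)\<^sup>2" using rs by (simp add: power2_sum)
    finally show "(\<Sum>i\<in>F. (cmod (f i))\<^sup>2) \<le> (r + s)\<^sup>2" .
  qed
qed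

text \<open>Comparison along a relabelling \<open>h\<close>: a choice of \<open>b\<close> for each
  nonzero value is a right inverse of \<open>h\<close>, hence injective, so no term of
  \<open>g\<close> is used twice. It covers restriction, extension by zero and shifts of
  words.\<close>

lemma l2_bound_dominated:
  assumes g: "l2_bound B g r"
    and f: "\<And>i. i \<in> A \<Longrightarrow> f i \<noteq> 0 \<Longrightarrow> \<exists>b\<in>B. i = h b \<and> cmod (f i) \<le> cmod (g b)"
  shows "l2_bound A f r"
proof -
  have r: "0 \<le> r" using g by (rule l2_bound_nonneg)
  show ?thesis
    unfolding l2_bound_iff_sum[OF r]
  proof (intro allI impI)
    fix F assume F: "finite F \<and> F \<subseteq> A"
    let ?F = "{i \<in> F. f i \<noteq> 0}"
    from f F obtain k where k: "\<And>i. i \<in> ?F \<Longrightarrow> k i \<in> B \<and> i = h (k i) \<and> cmod (f i) \<le> cmod (g (k i))"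
      by (metis (mono_tags, lifting) mem_Collect_eq subsetD)
    then have inj: "inj_on k ?F" unfolding inj_on_def by metis
    have "(\<Sum>i\<in>F. (cmod (f i))\<^sup>2) = (\<Sum>i\<in>?F. (cmod (f i))\<^sup>2)"
      using F by (intro sum.mono_neutral_right) auto
    also have "\<dots> \<le> (\<Sum>i\<in>?F. (cmod (g (k i)))\<^sup>2)"
      using k by (intro sum_mono power_mono) auto
    also have "\<dots> = (\<Sum>b\<in>k ` ?F. (cmod (g b))\<^sup>2)" using inj by (simp add: sum.reindex)
    also have "\<dots> \<le> r\<^sup>2" using F k by (intro l2_bound_sumD[OF g]) auto
    finally show "(\<Sum>i\<in>F. (cmod (f i))\<^sup>2) \<le> r\<^sup>2" .
  qed
qed

lemma l2_bound_zero: "0 \<le> r \<Longrightarrow> (\<And>i. i \<in> A \<Longrightarrow> f i = 0) \<Longrightarrow> l2_bound A f r"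
  by (auto simp: l2_bound_iff_sum subset_iff)

lemma l2_bound_finite:
  assumes "finite A" "\<And>i. i \<in> A \<Longrightarrow> cmod (f i) \<le> r i"
  shows "l2_bound A f (\<Sum>i\<in>A. r i)"
proof (rule l2_boundI)
  fix F assume F: "finite F" "F \<subseteq> A"
  have "L2_set (\<lambda>i. cmod (f i)) F \<le> (\<Sum>i\<in>F. cmod (f i))" by (rule L2_set_le_sum) auto
  also have "\<dots> \<le> (\<Sum>i\<in>A. cmod (f i))" using assms(1) F by (intro sum_mono2) auto
  also have "\<dots> \<le> (\<Sum>i\<in>A. r i)" using assms(2) by (rule sum_mono)
  finally show "L2_set (\<lambda>i. cmod (f i)) F \<le> (\<Sum>i\<in>A. r i)" .
qed

text \<open>A finite subfamily whose sum of squares comes within e^2 of the supremum leaves at most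
  \<open>e\<close> outside.\<close>

lemma l2_bound_tail:
  assumes f: "l2_bound A f r" and e: "e > 0"
  obtains G where "finite G" "G \<subseteq> A" "l2_bound (A - G) f e"
proof -
  define Q where "Q F = (\<Sum>i\<in>F. (cmod (f i))\<^sup>2)" for F
  define \<F> where "\<F> = {F. finite F \<and> F \<subseteq> A}"
  have r: "0 \<le> r" using f by (rule l2_bound_nonneg)
  have le: "Q F \<le> r\<^sup>2" if "F \<in> \<F>" for F
    using that l2_bound_sumD[OF f] by (auto simp: Q_def \<F>_def)
  then have bdd: "bdd_above (Q ` \<F>)" by (intro bdd_aboveI[of _ "r\<^sup>2"]) auto
  have ne: "\<F> \<noteq> {}" by (auto simp: \<F>_def)
  have "Sup (Q ` \<F>) - e\<^sup>2 < Sup (Q ` \<F>)" using e by simp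
  then obtain G where G: "G \<in> \<F>" "Sup (Q ` \<F>) - e\<^sup>2 < Q G"
    using less_cSup_iff[of "Q ` \<F>"] ne bdd by auto
  have "l2_bound (A - G) f e"
    unfolding l2_bound_iff_sum[OF less_imp_le[OF e]]
  proof (intro allI impI)
    fix F assume F: "finite F \<and> F \<subseteq> A - G"
    then have "F \<union> G \<in> \<F>" using G(1) by (auto simp: \<F>_def)
    then have "Q (F \<union> G) \<le> Sup (Q ` \<F>)" using bdd by (intro cSup_upper) auto
    moreover have "Q (F \<union> G) = Q F + Q G"
      using F G(1) unfolding Q_def by (intro sum.union_disjoint) (auto simp: \<F>_def)
    ultimately show "(\<Sum>i\<in>F. (cmod (f i))\<^sup>2) \<le> e\<^sup>2" using G(2) by (simp add: Q_def)
  qed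
  then show ?thesis using that G(1) by (auto simp: \<F>_def)
qed

text \<open>The letter \<open>b\<close> occurs only at the end. A shift by at most \<open>m\<close>
  would put an \<open>a\<close> of the shifted copy where the other copy has its
  \<open>b\<close>.\<close>

lemma overlap_free:
  assumes "a \<noteq> b" "s @ (replicate m a @ [b]) = (replicate m a @ [b]) @ g" "s \<noteq> []"
  shows "\<exists>u. s = (replicate m a @ [b]) @ u \<and> g = u @ (replicate m a @ [b])"
proof -
  let ?v = "replicate m a @ [b]"
  have "length s > m"
  proof (rule ccontr)
    assume "\<not> length s > m"
    then have "(s @ ?v) ! m = ?v ! (m - length s)" by (simp add: nth_append)
    also have "m - length s < m" using \<open>\<not> length s > m\<close> assms(3) by (cases s) auto
    then have "?v ! (m - length s) = a" by (simp add: nth_append)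
    finally show False using assms(1,2) by (simp add: nth_append)
  qed
  then have "length ?v \<le> length s" by simp
  then obtain u where u: "s = ?v @ u"
    using assms(2) by (metis append_eq_append_conv_if append_take_drop_id)
  then show ?thesis using assms(2) by simp
qed

section \<open>Absolutely continuous vectors and recurrence\<close>

context row_isometry
begin

text \<open>The adjoint of \<open>opw w\<close>; adjoints reverse products, so the leading letter
  acts first.\<close>

primrec adjw :: "nat list \<Rightarrow> 'a \<Rightarrow> 'a" where
  "adjw [] x = x"
| "adjw (i # w) x = adjw w (adj i x)"

lemma cinner_adjw: "w \<in> \<W> \<Longrightarrow> cinner (opw w x) y = cinner x (adjw w y)"
  by (induction w arbitrary: y) (auto simp: cinner_adj)

lemma cinner_adjw': "w \<in> \<W> \<Longrightarrow> cinner y (opw w x) = cinner (adjw w y) x"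
  by (metis cinner_adjw cinner_commute)

text \<open>Absolutely continuous vectors: by duality the bound says that \<open>p \<mapsto> p(S) x\<close> is bounded from
  \<open>\<ell>\<^sup>2\<close> of the words into the space.\<close>

definition ac :: "'a \<Rightarrow> bool" where
  "ac x \<longleftrightarrow> (\<exists>C\<ge>0. \<forall>y. l2_bound \<W> (\<lambda>w. cinner (opw w x) y) (C * norm y))"

lemma acD: "ac x \<Longrightarrow> \<exists>C\<ge>0. \<forall>y. l2_bound \<W> (\<lambda>w. cinner (opw w x) y) (C * norm y)"
  by (simp add: ac_def)

lemma ac_add: "ac x \<Longrightarrow> ac y \<Longrightarrow> ac (x + y)"
proof -
  assume "ac x" "ac y"
  then obtain C D where CD: "C \<ge> 0" "D \<ge> 0"
    "\<And>z. l2_bound \<W> (\<lambda>w. cinner (opw w x) z) (C * norm z)"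
    "\<And>z. l2_bound \<W> (\<lambda>w. cinner (opw w y) z) (D * norm z)" using acD by meson
  have "l2_bound \<W> (\<lambda>w. cinner (opw w (x + y)) z) ((C + D) * norm z)" for z
  proof (rule l2_bound_dominated)
    show "l2_bound \<W> (\<lambda>w. cinner (opw w x) z + cinner (opw w y) z) ((C + D) * norm z)"
      unfolding distrib_right by (intro l2_bound_add CD)
  qed (auto simp: opw_add cinner_add_left)
  then show ?thesis unfolding ac_def using CD(1,2) by (intro exI[of _ "C + D"]) auto
qed

lemma ac_scaleC: "ac x \<Longrightarrow> ac (c *\<^sub>C x)"
proof -
  assume "ac x"
  then obtain C where C: "C \<ge> 0" "\<And>z. l2_bound \<W> (\<lambda>w. cinner (opw w x) z) (C * norm z)"
    using acD by meson
  have "l2_bound \<W> (\<lambda>w. cinner (opw w (c *\<^sub>C x)) z) ((cmod c * C) * norm z)" for z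
  proof (rule l2_bound_dominated)
    show "l2_bound \<W> (\<lambda>w. c * cinner (opw w x) z) ((cmod c * C) * norm z)"
      unfolding mult.assoc by (intro l2_bound_cmult C)
  qed (auto simp: opw_scaleC cinner_scaleC_left)
  then show ?thesis unfolding ac_def using C(1) by (intro exI[of _ "cmod c * C"]) auto
qed

text \<open>The coefficient of \<open>opw v x\<close> at \<open>w\<close> is that of
  \<open>x\<close> at \<open>w @ v\<close>, and dropping the suffix recovers
  \<open>w\<close>.\<close>

lemma ac_opw: "v \<in> \<W> \<Longrightarrow> ac x \<Longrightarrow> ac (opw v x)"
proof -
  assume v: "v \<in> \<W>" and "ac x"
  then obtain C where C: "C \<ge> 0" "\<And>z. l2_bound \<W> (\<lambda>w. cinner (opw w x) z) (C * norm z)"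
    using acD by meson
  have "l2_bound \<W> (\<lambda>w. cinner (opw w (opw v x)) z) (C * norm z)" for z
    using C(2)[of z]
    by (rule l2_bound_dominated[where h = "\<lambda>u. take (length u - length v) u"])
      (use v in \<open>auto simp: opw_append intro!: bexI[of _ "_ @ v"]\<close>)
  then show ?thesis unfolding ac_def using C(1) by blast
qed

lemma ac_zero: "ac 0"
  unfolding ac_def by (intro exI[of _ 0]) (auto simp: opw_zero intro!: l2_bound_zero)

lemma ac_pol: "finite W \<Longrightarrow> W \<subseteq> \<W> \<Longrightarrow> ac x \<Longrightarrow> ac (pol a W x)"
  unfolding pol_def by (induction W rule: finite_induct) (auto intro!: ac_zero ac_add ac_scaleC ac_opw)

text \<open>Parseval: the images of a wandering tuple under the words are orthonormal in the direct
  sum.\<close>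

lemma wander_norm_pol:
  assumes X: "wander k X" and W: "finite W" "W \<subseteq> \<W>"
  shows "(\<Sum>j<k. (norm (pol a W (X j)))\<^sup>2) = (\<Sum>w\<in>W. (cmod (a w))\<^sup>2)"
proof -
  have "complex_of_real (\<Sum>j<k. (norm (pol a W (X j)))\<^sup>2) = (\<Sum>j<k. cinner (pol a W (X j)) (pol a W (X j)))"
    by (simp add: cinner_self)
  also have "\<dots> = (\<Sum>j<k. \<Sum>u\<in>W. \<Sum>v\<in>W. a u * cnj (a v) * cinner (opw u (X j)) (opw v (X j)))"
    unfolding pol_def cinner.sum_left cinner.sum_right
    by (simp add: cinner_scaleC_left cinner_scaleC_right sum_distrib_left mult_ac)
      (rule sum.cong[OF refl], rule sum.swap)
  also have "\<dots> = (\<Sum>u\<in>W. \<Sum>v\<in>W. a u * cnj (a v) * (\<Sum>j<k. cinner (opw u (X j)) (opw v (X j))))"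
    unfolding sum_distrib_left by (subst sum.swap, intro sum.cong refl, subst sum.swap) simp
  also have "\<dots> = (\<Sum>u\<in>W. \<Sum>v\<in>W. if u = v then a u * cnj (a v) else 0)"
    by (intro sum.cong refl) (use X W in \<open>auto simp: wander_def subset_iff\<close>)
  also have "\<dots> = (\<Sum>u\<in>W. a u * cnj (a u))" using W by simp
  also have "\<dots> = complex_of_real (\<Sum>w\<in>W. (cmod (a w))\<^sup>2)"
    by (simp only: of_real_sum complex_norm_square)
  finally show ?thesis using of_real_eq_iff by blast
qed

text \<open>Duality with C = 1. If \<open>t\<close> is the sum of the squared coefficients, the
  polynomial \<open>p\<close> with the conjugate coefficients satisfies <p, y> = t, while Parseval
  gives ||p||^2 \<le> t. So t^2 \<le> t ||y||^2.\<close>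

lemma wander_ac:
  assumes X: "wander k X" and j: "j < k"
  shows "ac (X j)"
proof -
  have "l2_bound \<W> (\<lambda>w. cinner (opw w (X j)) y) (norm y)" for y
    unfolding l2_bound_iff_sum[OF norm_ge_zero]
  proof (intro allI impI)
    fix F assume F: "finite F \<and> F \<subseteq> \<W>"
    define \<alpha> where "\<alpha> w = cinner (opw w (X j)) y" for w
    define t where "t = (\<Sum>w\<in>F. (cmod (\<alpha> w))\<^sup>2)"
    define p where "p = pol (\<lambda>w. cnj (\<alpha> w)) F (X j)"
    have t0: "t \<ge> 0" unfolding t_def by (intro sum_nonneg) auto
    have "cinner p y = (\<Sum>w\<in>F. \<alpha> w * cnj (\<alpha> w))"
      unfolding p_def pol_def by (simp add: cinner.sum_left cinner_scaleC_left \<alpha>_def mult.commute)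
    also have "\<dots> = complex_of_real t" unfolding t_def by (simp only: of_real_sum complex_norm_square)
    finally have "t = cmod (cinner p y)" using t0 by simp
    also have "\<dots> \<le> norm p * norm y" by (rule cmod_cinner_le)
    finally have "t\<^sup>2 \<le> (norm p)\<^sup>2 * (norm y)\<^sup>2"
      using t0 power_mono by (fastforce simp flip: power_mult_distrib)
    also have "(norm p)\<^sup>2 \<le> (\<Sum>j<k. (norm (pol (\<lambda>w. cnj (\<alpha> w)) F (X j)))\<^sup>2)"
      unfolding p_def using j by (intro member_le_sum) auto
    also have "\<dots> = t" using wander_norm_pol[OF X] F by (simp add: t_def)
    finally have "t * t \<le> t * (norm y)\<^sup>2" by (simp add: power2_eq_square mult_right_mono)
    then show "t \<le> (norm y)\<^sup>2" using t0 by (cases "t = 0") auto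
  qed
  then show ?thesis unfolding ac_def by (intro exI[of _ 1]) auto
qed

lemma norm_pol_le:
  assumes "finite W" "W \<subseteq> \<W>"
  shows "norm (pol a W x) \<le> (\<Sum>w\<in>W. cmod (a w)) * norm x"
proof -
  have "norm (pol a W x) \<le> (\<Sum>w\<in>W. norm (a w *\<^sub>C opw w x))" unfolding pol_def by (rule norm_sum)
  also have "\<dots> = (\<Sum>w\<in>W. cmod (a w)) * norm x"
    unfolding sum_distrib_right by (rule sum.cong) (use assms in \<open>auto simp: norm_scaleC norm_opw subset_iff\<close>)
  finally show ?thesis .
qed

lemma pol_diff: "W \<subseteq> \<W> \<Longrightarrow> pol a W (x - y) = pol a W x - pol a W y"
  unfolding pol_def sum_subtractf[symmetric]
  by (rule sum.cong) (auto simp: opw_diff scaleC.diff_right subset_iff)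

text \<open>By \<open>wold\<close>, this is the absence of wandering vectors.  It makes all closed invariant subspaces
  reducing, with \<open>x = \<Sum> S\<^sub>i S\<^sub>i\<^sup>* x\<close> on each of them.\<close>

definition recurrent :: bool where
  "recurrent \<longleftrightarrow> (\<forall>x e. e > 0 \<longrightarrow>
    (\<exists>a W. finite W \<and> W \<subseteq> \<W> - {[]} \<and> norm (x + pol a W x) < e))"

lemma recurrentD:
  "recurrent \<Longrightarrow> e > 0 \<Longrightarrow> \<exists>a W. finite W \<and> W \<subseteq> \<W> - {[]} \<and> norm (x + pol a W x) < e"
  by (simp add: recurrent_def)

text \<open>Recurrence gives x close to -p(S) x with p free of constant term, so
  \<open>adj i x\<close> is close to -q(S) x, where q arises by deleting a leading \<open>i\<close>.
  Polynomials preserve \<open>ac\<close>; the approximant \<open>y\<close> of \<open>x\<close> is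
  taken close relative to the coefficient sum \<open>K\<close> of q.\<close>

lemma adj_closure_ac:
  assumes nw: recurrent
    and x: "x \<in> closure (Collect ac)" and i: "i \<in> letters n"
  shows "adj i x \<in> closure (Collect ac)"
  unfolding closure_approachable
proof (intro allI impI)
  fix e :: real assume e: "e > 0"
  then obtain a W where W: "finite W" "W \<subseteq> \<W> - {[]}" and lt: "norm (x + pol a W x) < e / 2"
    using recurrentD[OF nw, of "e / 2" x] by auto
  define V where "V = {w. i # w \<in> W}"
  define b where "b w = a (i # w)" for w
  have V: "finite V" "V \<subseteq> \<W>" "\<And>x. adj i (pol a W x) = pol b V x"
    using adj_pol[OF i W] unfolding V_def b_def by auto
  define K where "K = (\<Sum>w\<in>V. cmod (b w))"
  have K: "K \<ge> 0" unfolding K_def by (intro sum_nonneg) auto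
  obtain y where y: "ac y" "norm (y - x) < e / (2 * (K + 1))"
    using x e K unfolding closure_approachable dist_norm
    by (metis add_nonneg_pos divide_pos_pos mem_Collect_eq mult_pos_pos zero_less_numeral zero_less_one)
  have "norm (pol b V (y - x)) \<le> K * norm (y - x)" unfolding K_def by (rule norm_pol_le[OF V(1,2)])
  also have "\<dots> \<le> K * (e / (2 * (K + 1)))" using y(2) K by (intro mult_left_mono) auto
  also have "\<dots> \<le> e / 2" using K e by (simp add: field_simps)
  finally have 1: "norm (pol b V (y - x)) \<le> e / 2" .
  have "norm (adj i (x + pol a W x)) < e / 2" using norm_adj_le[OF i] lt by (rule order_le_less_trans)
  moreover have "- pol b V y - adj i x = - pol b V (y - x) - adj i (x + pol a W x)"
    by (simp add: pol_diff V adj_add i)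
  ultimately have "norm (- pol b V y - adj i x) < e"
    using 1 norm_triangle_ineq4[of "- pol b V (y - x)" "adj i (x + pol a W x)"] by simp
  moreover have "ac (- pol b V y)"
    using ac_scaleC[OF ac_pol[OF V(1,2) y(1), of b], of "- 1"] by (simp add: scaleC.minus_left)
  ultimately show "\<exists>y\<in>Collect ac. dist y (adj i x) < e" by (auto simp: dist_norm)
qed

lemma adjw_closure_ac:
  assumes nw: recurrent
    and x: "x \<in> closure (Collect ac)" and w: "w \<in> \<W>"
  shows "adjw w x \<in> closure (Collect ac)"
  using x w by (induction w arbitrary: x) (auto intro: adj_closure_ac[OF nw])

text \<open>Approximate form of x = \<Sum> S_i S_i* x. The projection \<open>P\<close> onto the
  ranges of the finitely many leading letters of p fixes p(S) x, so x - P x equals y - P y for the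
  small vector y = x + p(S) x.\<close>

lemma norm_adj_sum:
  assumes nw: recurrent
    and e: "e > 0"
  obtains I where "finite I" "I \<subseteq> letters n" "(norm x)\<^sup>2 \<le> (\<Sum>i\<in>I. (norm (adj i x))\<^sup>2) + e"
proof -
  obtain a W where W: "finite W" "W \<subseteq> \<W> - {[]}" and lt: "norm (x + pol a W x) < sqrt e"
    using recurrentD[OF nw, of "sqrt e" x] e by auto
  define I where "I = hd ` W"
  have I: "finite I" "I \<subseteq> letters n"
    using W by (auto simp: I_def) (metis Diff_iff list.collapse singletonI subsetD words_simps(2))
  define P where "P y = (\<Sum>i\<in>I. S i (adj i y))" for y
  have Il: "i \<in> letters n" if "i \<in> I" for i using that I by auto
  have adjP: "adj j (P y) = adj j y" if "j \<in> I" for j y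
  proof -
    have "adj j (P y) = (\<Sum>i\<in>I. if j = i then adj i y else 0)"
      unfolding P_def using that by (simp add: adj_sum adj_S Il)
    then show ?thesis using that I by simp
  qed
  have cP: "cinner (P y) z = (\<Sum>i\<in>I. cinner (adj i y) (adj i z))" for y z
    unfolding P_def cinner.sum_left by (intro sum.cong refl) (simp add: cinner_adj Il)
  have split: "(norm y)\<^sup>2 = (norm (P y))\<^sup>2 + (norm (y - P y))\<^sup>2" for y
  proof -
    have "cinner (P y) (y - P y) = 0" unfolding cP by (simp add: adj_diff Il adjP)
    then show ?thesis using norm_add_sq[of "P y" "y - P y"] by simp
  qed
  have nP: "(norm (P y))\<^sup>2 = (\<Sum>i\<in>I. (norm (adj i y))\<^sup>2)" for y
  proof -
    have "complex_of_real ((norm (P y))\<^sup>2) = complex_of_real (\<Sum>i\<in>I. (norm (adj i y))\<^sup>2)"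
      using cP[of y "P y"] by (simp add: adjP cinner_self cong: sum.cong)
    then show ?thesis using of_real_eq_iff by blast
  qed
  have Ppol: "P (pol a W x) = pol a W x"
  proof -
    have "P (opw w x) = opw w x" if wW: "w \<in> W" for w
    proof -
      obtain j u where w: "w = j # u" "j \<in> I" using wW W(2) by (cases w) (force simp: I_def)+
      have "P (opw w x) = (\<Sum>i\<in>I. if i = j then S j (opw u x) else 0)"
        unfolding P_def w(1) using w(2)
        by (intro sum.cong refl) (use bounded_linear_S in \<open>auto simp: adj_S Il bounded_linear.linear linear_0\<close>)
      then show ?thesis using w I by simp
    qed
    moreover have "P (pol a W x) = (\<Sum>w\<in>W. a w *\<^sub>C P (opw w x))"
      unfolding P_def pol_def
      by (simp add: adj_sum adj_scaleC Il S_sum S_scaleC scaleC.sum_right cong: sum.cong) (rule sum.swap)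
    ultimately show ?thesis by (simp add: pol_def)
  qed
  define y where "y = x + pol a W x"
  have "x - P x = y - P y"
    unfolding y_def using Ppol by (simp add: P_def adj_add Il sum.distrib bounded_linear.linear linear_add bounded_linear_S cong: sum.cong)
  then have "(norm (x - P x))\<^sup>2 \<le> (norm y)\<^sup>2" using split[of y] by simp
  also have "\<dots> \<le> e" using lt e unfolding y_def
    by (metis less_imp_le norm_ge_zero power_mono real_sqrt_pow2)
  finally have "(norm x)\<^sup>2 \<le> (\<Sum>i\<in>I. (norm (adj i x))\<^sup>2) + e" using split[of x] nP[of x] by simp
  then show ?thesis using that I by blast
qed

text \<open>Otherwise the lower bound \<open>e\<close> would pass from \<open>z\<close> to all \<open>S\<^sub>u\<^sup>* z\<close> with \<open>u\<close> of a fixed length,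
  and hence to the tails of a square-summable family.\<close>

lemma small_coefficients_closure:
  assumes nw: recurrent
    and x0: "ac x0" "x0 \<noteq> 0" and F: "finite F" "F \<subseteq> Collect ac" and e: "e > 0"
  shows "\<exists>z\<in>closure (Collect ac). norm z = 1 \<and>
    l2_bound (\<W> \<times> F) (\<lambda>(w, f). cinner (opw w f) z) e"
proof (rule ccontr)
  assume neg: "\<not> ?thesis"
  define g where "g p z = cinner (opw (fst p) (snd p)) z" for p z
  define M where "M = closure (Collect ac)"
  have M_scale: "c *\<^sub>C x \<in> M" if x: "x \<in> M" for c x
  proof -
    have "scaleC c ` closure (Collect ac) \<subseteq> closure (Collect ac)"
    proof (rule image_closure_subset)
      show "continuous_on (closure (Collect ac)) (scaleC c :: 'a \<Rightarrow> 'a)"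
        by (intro linear_continuous_on scaleC.bounded_linear_right)
      show "scaleC c ` Collect ac \<subseteq> closure (Collect ac)"
        by (auto intro!: subsetD[OF closure_subset] ac_scaleC)
    qed simp
    then show ?thesis using x unfolding M_def by auto
  qed
  have base: "\<exists>K. finite K \<and> K \<subseteq> \<W> \<times> F \<and> e\<^sup>2 * (norm z)\<^sup>2 \<le> (\<Sum>p\<in>K. (cmod (g p z))\<^sup>2)"
    if z: "z \<in> M" for z
  proof (cases "z = 0")
    case False
    define c where "c = complex_of_real (1 / norm z)"
    have "norm (c *\<^sub>C z) = 1" using False by (simp add: norm_scaleC c_def norm_divide)
    then have "\<not> l2_bound (\<W> \<times> F) (\<lambda>p. g p (c *\<^sub>C z)) e"
      using neg M_scale[OF z, of c] by (auto simp: M_def g_def case_prod_beta')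
    then obtain K where K: "finite K" "K \<subseteq> \<W> \<times> F" "e\<^sup>2 < (\<Sum>p\<in>K. (cmod (g p (c *\<^sub>C z)))\<^sup>2)"
      using e by (auto simp: l2_bound_iff_sum not_le)
    have "(\<Sum>p\<in>K. (cmod (g p (c *\<^sub>C z)))\<^sup>2) = (\<Sum>p\<in>K. (cmod (g p z))\<^sup>2) / (norm z)\<^sup>2"
      by (simp add: g_def cinner_scaleC_right norm_mult c_def norm_divide power_mult_distrib power_divide
          sum_divide_distrib)
    then show ?thesis using K False by (intro exI[of _ K]) (simp add: pos_less_divide_eq less_imp_le)
  next
    case True
    then show ?thesis by (intro exI[of _ "{}"]) simp
  qed
  \<comment> \<open>The coefficient of \<open>z\<close> at \<open>i # w\<close> is that of
    \<open>adj i z\<close> at \<open>w\<close>. So the words of length at least N + 1 for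
    \<open>z\<close> split by leading letter into words of length at least N for the vectors
    \<open>adj i z\<close>, which stay in \<open>M\<close>.\<close>
  have tails: "\<exists>K. finite K \<and> K \<subseteq> {w\<in>\<W>. length w \<ge> N} \<times> F \<and>
      e\<^sup>2 * (norm z)\<^sup>2 \<le> (\<Sum>p\<in>K. (cmod (g p z))\<^sup>2) + d" if "z \<in> M" "d > 0" for N z d
    using that
  proof (induction N arbitrary: z d)
    case 0
    obtain K where K: "finite K" "K \<subseteq> \<W> \<times> F" "e\<^sup>2 * (norm z)\<^sup>2 \<le> (\<Sum>p\<in>K. (cmod (g p z))\<^sup>2)"
      using base[OF 0(1)] by (elim exE conjE)
    then show ?case using 0(2) by (intro exI[of _ K]) auto
  next
    case (Suc N)
    have "d / (2 * e\<^sup>2) > 0" using Suc.prems e by simp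
    from norm_adj_sum[OF nw this, of z] obtain I where I: "finite I" "I \<subseteq> letters n"
      "(norm z)\<^sup>2 \<le> (\<Sum>i\<in>I. (norm (adj i z))\<^sup>2) + d / (2 * e\<^sup>2)" by blast
    \<comment> \<open>Half of \<open>d\<close> pays for truncating to the letters in
      \<open>I\<close>; the other half is shared among them. The added 1 covers empty
      \<open>I\<close>.\<close>
    define d' where "d' = d / (2 * (real (card I) + 1))"
    have d': "d' > 0" "card I * d' \<le> d / 2" using Suc.prems(2) by (auto simp: d'_def field_simps)
    have "\<exists>K. finite K \<and> K \<subseteq> {w\<in>\<W>. length w \<ge> N} \<times> F \<and>
      e\<^sup>2 * (norm (adj i z))\<^sup>2 \<le> (\<Sum>p\<in>K. (cmod (g p (adj i z)))\<^sup>2) + d'" if "i \<in> I" for i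
      using Suc.IH[of "adj i z" d'] adj_closure_ac[OF nw, of z i] Suc.prems(1) I(2) that d'(1)
      by (auto simp: M_def)
    then have "\<forall>i\<in>I. \<exists>K. finite K \<and> K \<subseteq> {w\<in>\<W>. length w \<ge> N} \<times> F \<and>
      e\<^sup>2 * (norm (adj i z))\<^sup>2 \<le> (\<Sum>p\<in>K. (cmod (g p (adj i z)))\<^sup>2) + d'" by (rule ballI)
    from bchoice[OF this] obtain K where "\<forall>i\<in>I. finite (K i) \<and> K i \<subseteq> {w\<in>\<W>. length w \<ge> N} \<times> F \<and>
      e\<^sup>2 * (norm (adj i z))\<^sup>2 \<le> (\<Sum>p\<in>K i. (cmod (g p (adj i z)))\<^sup>2) + d'" by (elim exE)
    then have K: "\<And>i. i \<in> I \<Longrightarrow> finite (K i)" "\<And>i. i \<in> I \<Longrightarrow> K i \<subseteq> {w\<in>\<W>. length w \<ge> N} \<times> F"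
      "\<And>i. i \<in> I \<Longrightarrow> e\<^sup>2 * (norm (adj i z))\<^sup>2 \<le> (\<Sum>p\<in>K i. (cmod (g p (adj i z)))\<^sup>2) + d'"
      by auto
    define h where "h i p = (i # fst p, snd p)" for i and p :: "nat list \<times> 'a"
    define L where "L = (\<Union>i\<in>I. h i ` K i)"
    have "finite L" using I(1) K(1) by (simp add: L_def)
    moreover have "L \<subseteq> {w\<in>\<W>. length w \<ge> Suc N} \<times> F"
    proof
      fix q assume "q \<in> L"
      then obtain i p where q: "i \<in> I" "p \<in> K i" "q = h i p" by (auto simp: L_def)
      then have "p \<in> {w\<in>\<W>. length w \<ge> N} \<times> F" using K(2) by blast
      then show "q \<in> {w\<in>\<W>. length w \<ge> Suc N} \<times> F"
        using q I(2) by (cases p) (auto simp: h_def)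
    qed
    ultimately have L: "finite L" "L \<subseteq> {w\<in>\<W>. length w \<ge> Suc N} \<times> F" .
    have "e\<^sup>2 * (norm z)\<^sup>2 \<le> e\<^sup>2 * ((\<Sum>i\<in>I. (norm (adj i z))\<^sup>2) + d / (2 * e\<^sup>2))"
      using I(3) by (intro mult_left_mono) auto
    also have "\<dots> = (\<Sum>i\<in>I. e\<^sup>2 * (norm (adj i z))\<^sup>2) + d / 2"
      using e by (simp add: distrib_left sum_distrib_left)
    also have "\<dots> \<le> (\<Sum>i\<in>I. (\<Sum>p\<in>K i. (cmod (g p (adj i z)))\<^sup>2) + d') + d / 2"
      by (intro add_right_mono sum_mono K(3))
    also have "\<dots> \<le> (\<Sum>i\<in>I. \<Sum>p\<in>K i. (cmod (g p (adj i z)))\<^sup>2) + d"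
      using d'(2) by (simp add: sum.distrib)
    also have "(\<Sum>i\<in>I. \<Sum>p\<in>K i. (cmod (g p (adj i z)))\<^sup>2) = (\<Sum>i\<in>I. \<Sum>p\<in>h i ` K i. (cmod (g p z))\<^sup>2)"
    proof (rule sum.cong[OF refl])
      fix i assume "i \<in> I"
      then have "i \<in> letters n" using I by auto
      then show "(\<Sum>p\<in>K i. (cmod (g p (adj i z)))\<^sup>2) = (\<Sum>p\<in>h i ` K i. (cmod (g p z))\<^sup>2)"
        by (subst sum.reindex) (auto simp: inj_on_def h_def g_def cinner_adj)
    qed
    also have "\<dots> = (\<Sum>p\<in>L. (cmod (g p z))\<^sup>2)"
      unfolding L_def using I(1) K(1) by (intro sum.UNION_disjoint[symmetric]) (auto simp: h_def)
    finally show ?case using L by (intro exI[of _ L]) auto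
  qed
  have "\<exists>r. l2_bound (\<W> \<times> F) (\<lambda>p. g p x0) r"
  proof -
    have "\<exists>r. l2_bound \<W> (\<lambda>w. cinner (opw w f) x0) r" if "f \<in> F" for f
      using F(2) that acD[of f] by auto
    then obtain r where r: "\<And>f. f \<in> F \<Longrightarrow> l2_bound \<W> (\<lambda>w. cinner (opw w f) x0) (r f)" by metis
    have "l2_bound (\<W> \<times> G) (\<lambda>p. g p x0) (\<Sum>f\<in>G. r f)" if "finite G" "G \<subseteq> F" for G
      using that
    proof (induction G rule: finite_induct)
      case (insert f G)
      have "l2_bound (\<W> \<times> {f}) (\<lambda>p. g p x0) (r f)"
        by (rule l2_bound_dominated[OF r[of f], of _ _ "\<lambda>w. (w, f)"]) (use insert in \<open>auto simp: g_def\<close>)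
      from l2_bound_Un[OF this insert.IH] insert show ?case by (simp add: Sigma_Un_distrib2[symmetric] insert_def[symmetric])
    qed (simp add: l2_bound_def)
    then show ?thesis using F(1) by blast
  qed
  then obtain r where r: "l2_bound (\<W> \<times> F) (\<lambda>p. g p x0) r" by blast
  \<comment> \<open>A tail of mass at most d^2 and the lower bound with loss d^2 give e^2 ||x0||^2
    \<le> 2 d^2, which is only half of the left-hand side.\<close>
  define d where "d = e * norm x0 / 2"
  have d: "d > 0" using e x0 by (simp add: d_def)
  obtain G where G: "finite G" "G \<subseteq> \<W> \<times> F" "l2_bound (\<W> \<times> F - G) (\<lambda>p. g p x0) d"
    by (rule l2_bound_tail[OF r d])
  have "finite ((\<lambda>p. length (fst p)) ` G)" using G(1) by simp
  then obtain N where N: "\<And>p. p \<in> G \<Longrightarrow> length (fst p) < N"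
    by (auto simp: finite_nat_set_iff_bounded)
  have "x0 \<in> M" using x0 closure_subset unfolding M_def by blast
  from tails[OF this, of "d\<^sup>2" N] d obtain K where K: "finite K" "K \<subseteq> {w\<in>\<W>. length w \<ge> N} \<times> F"
    "e\<^sup>2 * (norm x0)\<^sup>2 \<le> (\<Sum>p\<in>K. (cmod (g p x0))\<^sup>2) + d\<^sup>2" by auto
  have "K \<subseteq> \<W> \<times> F - G"
  proof
    fix p assume "p \<in> K"
    then have "p \<in> {w\<in>\<W>. length w \<ge> N} \<times> F" using K(2) by blast
    then show "p \<in> \<W> \<times> F - G" using N[of p] by (cases p) auto
  qed
  then have "(\<Sum>p\<in>K. (cmod (g p x0))\<^sup>2) \<le> d\<^sup>2" using l2_bound_sumD[OF G(3) K(1)] by blast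
  then have "e\<^sup>2 * (norm x0)\<^sup>2 \<le> 2 * d\<^sup>2" using K(3) by simp
  moreover have "e\<^sup>2 * (norm x0)\<^sup>2 > 0" using e x0 by simp
  ultimately show False by (simp add: d_def power2_eq_square algebra_simps)
qed

text \<open>Replaces the vector found in the closure by a normalised absolutely continuous one. The
  coefficient families of the finitely many \<open>f\<close> depend on the vector with a common
  Lipschitz constant \<open>C\<close> in the l2 norm.\<close>

lemma small_coefficients:
  assumes nw: recurrent
    and x0: "ac x0" "x0 \<noteq> 0" and F: "finite F" "F \<subseteq> Collect ac" and e: "e > 0"
  shows "\<exists>z. ac z \<and> norm z = 1 \<and> (\<forall>f\<in>F. l2_bound \<W> (\<lambda>w. cinner (opw w f) z) e)"
proof -
  have e4: "e / 4 > 0" using e by simp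
  obtain z where z: "z \<in> closure (Collect ac)" "norm z = 1"
    "l2_bound (\<W> \<times> F) (\<lambda>(w, f). cinner (opw w f) z) (e / 4)"
    using small_coefficients_closure[OF nw x0 F e4] by (elim bexE conjE)
  have "\<forall>f\<in>F. \<exists>C\<ge>0. \<forall>y. l2_bound \<W> (\<lambda>w. cinner (opw w f) y) (C * norm y)"
    using F(2) acD by auto
  from bchoice[OF this] obtain C0
    where C0: "\<forall>f\<in>F. C0 f \<ge> 0 \<and> (\<forall>y. l2_bound \<W> (\<lambda>w. cinner (opw w f) y) (C0 f * norm y))"
    by (elim exE)
  define C where "C = (\<Sum>f\<in>F. C0 f)"
  have C: "C \<ge> 0" "\<And>f. f \<in> F \<Longrightarrow> C0 f \<le> C"
    unfolding C_def using C0 F(1) by (auto intro: sum_nonneg member_le_sum)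
  \<comment> \<open>The bound 1/2 keeps \<open>norm a\<close> at least 1/2, so normalising costs at
    most a factor 2, applied to e / 4 + C d.\<close>
  define d where "d = min (1/2) (e / (4 * (C + 1)))"
  have d: "d > 0" "d \<le> 1/2" "C * d \<le> e / 4"
  proof -
    show "d > 0" using e C(1) by (simp add: d_def)
    show "d \<le> 1/2" by (simp only: d_def min.cobounded1)
    have "C * d \<le> C * (e / (4 * (C + 1)))" using C(1) by (intro mult_left_mono) (auto simp: d_def)
    also have "\<dots> \<le> e / 4" using C(1) e by (simp add: field_simps)
    finally show "C * d \<le> e / 4" .
  qed
  obtain a where a: "ac a" "norm (a - z) < d"
    using z(1) d(1) unfolding closure_approachable dist_norm by auto
  have na: "norm a \<ge> 1/2" using a(2) d(2) z(2) norm_triangle_ineq3[of a z] by linarith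
  define c where "c = complex_of_real (1 / norm a)"
  have cn: "cmod c \<le> 2" using na by (simp add: c_def norm_divide divide_simps)
  have "l2_bound \<W> (\<lambda>w. cinner (opw w f) (c *\<^sub>C a)) e" if f: "f \<in> F" for f
  proof -
    have "l2_bound \<W> (\<lambda>w. cinner (opw w f) z) (e / 4)"
      by (rule l2_bound_dominated[OF z(3), of _ _ fst]) (use f in auto)
    moreover have "l2_bound \<W> (\<lambda>w. cinner (opw w f) (a - z)) (C0 f * norm (a - z))"
      using C0 f by blast
    moreover have "C0 f * norm (a - z) \<le> e / 4"
    proof -
      have "C0 f * norm (a - z) \<le> C * d" using C f a(2) by (intro mult_mono) auto
      then show ?thesis using d(3) by linarith
    qed
    ultimately have "l2_bound \<W> (\<lambda>w. cinner (opw w f) z + cinner (opw w f) (a - z)) (e / 4 + e / 4)"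
      by (intro l2_bound_add) (auto intro: l2_bound_mono)
    then have "l2_bound \<W> (\<lambda>w. cnj c * cinner (opw w f) a) (cmod (cnj c) * (e / 4 + e / 4))"
      by (intro l2_bound_cmult) (simp add: cinner_add_right[symmetric])
    moreover have "cmod (cnj c) * (e / 4 + e / 4) \<le> e"
      using mult_right_mono[OF cn, of "e / 4 + e / 4"] e by simp
    ultimately show ?thesis by (auto simp: cinner_scaleC_right intro: l2_bound_mono)
  qed
  moreover have "norm (c *\<^sub>C a) = 1" using na by (auto simp: norm_scaleC c_def norm_divide)
  ultimately show ?thesis using ac_scaleC[OF a(1), of c] by (intro exI[of _ "c *\<^sub>C a"]) auto
qed

text \<open>Each \<open>h\<close> is merely a limit of absolutely continuous vectors, so a close one
  joins the finite family of \<open>small_coefficients\<close>; its coefficient at the empty word is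
  its product with \<open>z\<close>.\<close>

lemma small_coefficients_and_products:
  assumes nw: recurrent
    and x0: "ac x0" "x0 \<noteq> 0" and x: "ac x" and H: "finite H" "H \<subseteq> closure (Collect ac)"
    and e: "e > 0" and d: "d > 0"
  shows "\<exists>z. ac z \<and> norm z = 1 \<and> l2_bound \<W> (\<lambda>w. cinner (opw w x) z) e \<and> (\<forall>h\<in>H. cmod (cinner h z) \<le> d)"
proof -
  have d2: "d / 2 > 0" using d by simp
  then have "\<forall>h\<in>H. \<exists>h'. ac h' \<and> norm (h' - h) < d / 2"
    using H(2) unfolding closure_approachable dist_norm by (metis mem_Collect_eq subsetD closure_approachable dist_norm)
  from bchoice[OF this] obtain q where q: "\<forall>h\<in>H. ac (q h) \<and> norm (q h - h) < d / 2" by (elim exE)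
  define F where "F = insert x (q ` H)"
  have F: "finite F" "F \<subseteq> Collect ac" using H x q by (auto simp: F_def)
  have "min e (d / 2) > 0" using e d by simp
  from small_coefficients[OF nw x0 F this] obtain z where z: "ac z" "norm z = 1"
    "\<forall>f\<in>F. l2_bound \<W> (\<lambda>w. cinner (opw w f) z) (min e (d / 2))" by (elim exE conjE)
  have "cmod (cinner h z) \<le> d" if h: "h \<in> H" for h
  proof -
    have "cmod (cinner (q h) z) \<le> d / 2"
      using l2_bound_point[of \<W> "\<lambda>w. cinner (opw w (q h)) z" "min e (d / 2)" "[]"] z(3) h
      by (auto simp: F_def)
    moreover have "cmod (cinner (q h - h) z) \<le> d / 2"
      using cmod_cinner_le[of "q h - h" z] q h z(2) by fastforce
    moreover have "cinner h z = cinner (q h) z - cinner (q h - h) z" by (simp add: cinner.diff_left)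
    ultimately show ?thesis using norm_triangle_ineq4[of "cinner (q h) z" "cinner (q h - h) z"] by simp
  qed
  moreover have "l2_bound \<W> (\<lambda>w. cinner (opw w x) z) e"
    using z(3) by (auto simp: F_def intro: l2_bound_mono)
  ultimately show ?thesis using z by (intro exI[of _ z]) auto
qed

section \<open>The words a^m b: orthogonality and vanishing correlations\<close>

lemma adjw_run_norm_sum:
  assumes ab: "a \<in> letters n" "b \<in> letters n" "a \<noteq> b"
  shows "l2_bound UNIV (\<lambda>l. complex_of_real (norm (adjw (replicate l a @ [b]) h))) (norm h)"
proof -
  have two: "(norm (adj a y))\<^sup>2 + (norm (adj b y))\<^sup>2 \<le> (norm y)\<^sup>2" for y
  proof -
    define p where "p = S a (adj a y) + S b (adj b y)"
    have ap: "adj a p = adj a y" "adj b p = adj b y"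
      using ab by (auto simp: p_def adj_add adj_S)
    have cp: "cinner p x = cinner (adj a y) (adj a x) + cinner (adj b y) (adj b x)" for x
      using ab by (simp add: p_def cinner_add_left cinner_adj)
    have "cinner p (y - p) = 0" unfolding cp using ab by (simp add: adj_diff ap)
    then have "(norm y)\<^sup>2 = (norm p)\<^sup>2 + (norm (y - p))\<^sup>2" using norm_add_sq[of p "y - p"] by simp
    moreover have "complex_of_real ((norm p)\<^sup>2) = complex_of_real ((norm (adj a y))\<^sup>2 + (norm (adj b y))\<^sup>2)"
      using cp[of p] by (simp add: ap cinner_self)
    then have "(norm p)\<^sup>2 = (norm (adj a y))\<^sup>2 + (norm (adj b y))\<^sup>2" using of_real_eq_iff by blast
    ultimately show ?thesis by simp
  qed
  \<comment> \<open>No word a^l b is a prefix of another, so their ranges are orthogonal and this is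
    Bessel's inequality, obtained by peeling off one letter at a time.\<close>
  have fin: "(\<Sum>l<m. (norm (adjw (replicate l a @ [b]) h))\<^sup>2) \<le> (norm h)\<^sup>2" for m
  proof (induction m arbitrary: h)
    case (Suc m)
    have "(\<Sum>l<Suc m. (norm (adjw (replicate l a @ [b]) h))\<^sup>2)
      = (norm (adj b h))\<^sup>2 + (\<Sum>l<m. (norm (adjw (replicate l a @ [b]) (adj a h)))\<^sup>2)"
      by (subst sum.lessThan_Suc_shift) simp
    then show ?case using Suc[of "adj a h"] two[of h] by linarith
  qed simp
  show ?thesis
    unfolding l2_bound_iff_sum[OF norm_ge_zero]
  proof (intro allI impI)
    fix F :: "nat set" assume F: "finite F \<and> F \<subseteq> UNIV"
    then obtain m where "F \<subseteq> {..<m}" by (auto simp: finite_nat_iff_bounded)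
    then have "(\<Sum>l\<in>F. (norm (adjw (replicate l a @ [b]) h))\<^sup>2) \<le> (\<Sum>l<m. (norm (adjw (replicate l a @ [b]) h))\<^sup>2)"
      by (intro sum_mono2) auto
    then show "(\<Sum>l\<in>F. (cmod (complex_of_real (norm (adjw (replicate l a @ [b]) h))))\<^sup>2) \<le> (norm h)\<^sup>2"
      using fin[of m] by simp
  qed
qed

lemma adjw_run_small:
  assumes ab: "a \<in> letters n" "b \<in> letters n" "a \<noteq> b" and e: "e > 0"
  shows "\<forall>\<^sub>F m in sequentially. norm (adjw (replicate m a @ [b]) h) \<le> e"
proof -
  obtain G where G: "finite G" "G \<subseteq> (UNIV :: nat set)"
    "l2_bound (UNIV - G) (\<lambda>l. complex_of_real (norm (adjw (replicate l a @ [b]) h))) e"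
    by (rule l2_bound_tail[OF adjw_run_norm_sum[OF ab, of h] e])
  from G(1) obtain m0 where m0: "\<forall>m\<in>G. m < m0" by (auto simp: finite_nat_set_iff_bounded)
  have "norm (adjw (replicate m a @ [b]) h) \<le> e" if "m \<ge> m0" for m
    using l2_bound_point[OF G(3), of m] m0 that by force
  then show ?thesis unfolding eventually_sequentially by blast
qed

text \<open>The words w a^m b are longer than m, so for large m they miss the finitely many words
  that carry all but \<open>e\<close> of the coefficients.\<close>

lemma tail_run_small:
  assumes ab: "a \<in> letters n" "b \<in> letters n" and z: "ac z" and e: "e > 0"
  shows "\<forall>\<^sub>F m in sequentially. l2_bound \<W> (\<lambda>w. cinner (opw (w @ replicate m a @ [b]) z) y) e"
proof -
  obtain C where "l2_bound \<W> (\<lambda>w. cinner (opw w z) y) (C * norm y)" using acD[OF z] by auto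
  from l2_bound_tail[OF this e] obtain G where G: "finite G"
    "l2_bound (\<W> - G) (\<lambda>w. cinner (opw w z) y) e" by metis
  have "finite (length ` G)" using G(1) by simp
  then obtain m0 where m0: "\<forall>w\<in>G. length w < m0" by (auto simp: finite_nat_set_iff_bounded)
  have "l2_bound \<W> (\<lambda>w. cinner (opw (w @ replicate m a @ [b]) z) y) e" if m: "m \<ge> m0" for m
  proof (rule l2_bound_dominated[OF G(2), of _ _ "\<lambda>u. take (length u - Suc m) u"])
    fix w assume w: "w \<in> \<W>"
    have "replicate m a \<in> \<W>" using ab by (induction m) auto
    then have "w @ replicate m a @ [b] \<in> \<W> - G" using m0 m w ab by force
    then show "\<exists>u\<in>\<W> - G. w = take (length u - Suc m) u \<and>
        cmod (cinner (opw (w @ replicate m a @ [b]) z) y) \<le> cmod (cinner (opw u z) y)"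
      by (intro bexI[of _ "w @ replicate m a @ [b]"]) auto
  qed
  then show ?thesis unfolding eventually_sequentially by blast
qed

text \<open>Only prefix-comparable words w v and t v interact, and \<open>overlap_free\<close> then
  leaves w = t or w = t v u. The opposite case t = w v u would make \<open>t\<close> longer than m.
  The surviving products are coefficients of \<open>z\<close> at words ending in \<open>v\<close>,
  which \<open>tail_run_small\<close> controls.\<close>

lemma run_orthonormal_error:
  assumes ab: "a \<in> letters n" "b \<in> letters n" "a \<noteq> b" and z: "norm z = 1"
    and t: "t \<in> \<W>" "length t \<le> m" and w: "w \<in> \<W>"
  defines "v \<equiv> replicate m a @ [b]"
  shows "cinner (opw w (opw v z)) (opw t (opw v z)) = (if w = t then 1 else 0) \<or>
    (\<exists>u\<in>\<W>. w = t @ v @ u \<and> w \<noteq> t \<and> cinner (opw w (opw v z)) (opw t (opw v z)) = cinner (opw (u @ v) z) z)"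
proof -
  have rep: "replicate m a \<in> \<W>" using ab by (induction m) auto
  then have v: "v \<in> \<W>" using ab by (simp add: v_def)
  have one: "cinner (opw w (opw v z)) (opw w (opw v z)) = 1"
    using w v z by (simp add: cinner_self norm_opw)
  have free: "\<exists>u. s = v @ u \<and> g = u @ v" if "s @ v = v @ g" "s \<noteq> []" for s g
    using overlap_free[OF ab(3), of s m g] that unfolding v_def by simp
  have "w @ v \<in> \<W>" "t @ v \<in> \<W>" using w t v by auto
  from cinner_opw_cases[OF this] show ?thesis
  proof (elim disjE bexE)
    fix g assume g: "g \<in> \<W>" "w @ v = (t @ v) @ g"
    then have "length (w @ v) = length ((t @ v) @ g)" by simp
    then have "length t \<le> length w" by (simp only: length_append)
    then obtain s where s: "w = t @ s"
      using g(2) by (metis append_assoc append_eq_append_conv_if append_take_drop_id)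
    show ?thesis
    proof (cases "s = []")
      case True
      then show ?thesis using s one by simp
    next
      case False
      have "s @ v = v @ g" using g(2) s by simp
      from free[OF this False] obtain u where u: "s = v @ u" "g = u @ v" by blast
      then have "u \<in> \<W>" using w s by simp
      moreover have "cinner (opw w (opw v z)) (opw t (opw v z)) = cinner (opw (u @ v) z) z"
        using u s t v by (simp add: opw_append cinner_opw)
      ultimately show ?thesis using s u False by auto
    qed
  next
    fix g assume g: "g \<in> \<W>" "t @ v = (w @ v) @ g"
    then have "length (t @ v) = length ((w @ v) @ g)" by simp
    then have "length w \<le> length t" by (simp only: length_append)
    then obtain s where s: "t = w @ s"
      using g(2) by (metis append_assoc append_eq_append_conv_if append_take_drop_id)
    show ?thesis
    proof (cases "s = []")
      case True
      then show ?thesis using s one by simp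
    next
      case False
      have "s @ v = v @ g" using g(2) s by simp
      from free[OF this False] obtain u where "s = v @ u" by blast
      then show ?thesis using t(2) s by (simp add: v_def)
    qed
  next
    assume "\<forall>x y. cinner (opw (w @ v) x) (opw (t @ v) y) = 0"
    then show ?thesis using one by (auto simp: opw_append)
  qed
qed

text \<open>Only words \<open>w\<close> comparable with t v contribute, in four classes of size e /
  4: extensions of t v (\<open>A1\<close>, coefficients of \<open>x\<close> against
  \<open>z\<close>); proper prefixes of t (\<open>A2\<close>, finitely many, small for large m); and
  words ending inside the run, either with \<open>l\<close> in the finite set \<open>G\<close>
  (\<open>A3\<close>, where \<open>z\<close> is almost orthogonal) or beyond it (\<open>A4\<close>,
  a Bessel tail).\<close>

lemma cross_term_bound:
  assumes ab: "a \<in> letters n" "b \<in> letters n" "a \<noteq> b" and e: "e > 0"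
    and z: "norm z = 1" "l2_bound \<W> (\<lambda>w. cinner (opw w x) z) (e / 4)"
    and G: "finite G" "l2_bound (UNIV - G) (\<lambda>l. complex_of_real (norm (adjw (replicate l a @ [b]) x))) (e / 4)"
    and zG: "\<And>l. l \<in> G \<Longrightarrow> cmod (cinner (adjw (replicate l a @ [b]) x) z) \<le> e / (4 * (card G + 1))"
    and t: "t \<in> \<W>"
    and m: "\<And>i. i < length t \<Longrightarrow> norm (adjw (replicate m a @ [b]) (adjw (drop i t) x)) \<le> e / (4 * (length t + 1))"
  shows "l2_bound \<W> (\<lambda>w. cinner (opw w x) (opw t (opw (replicate m a @ [b]) z))) e"
proof -
  define v where "v = replicate m a @ [b]"
  have rep: "replicate l a \<in> \<W>" for l using ab by (induction l) auto
  then have v: "v \<in> \<W>" and run: "\<And>l. replicate l a @ [b] \<in> \<W>" using ab by (auto simp: v_def)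
  define f where "f w = cinner (opw w x) (opw t (opw v z))" for w
  define A1 where "A1 = {t @ v @ u | u. u \<in> \<W>}"
  define A2 where "A2 = (\<lambda>i. take i t) ` {..<length t}"
  define A3 where "A3 = (\<lambda>l. t @ replicate (m - l) a) ` ({..m} \<inter> G)"
  define A4 where "A4 = (\<lambda>l. t @ replicate (m - l) a) ` ({..m} - G)"
  \<comment> \<open>\<open>l\<close> counts the letters \<open>a\<close> of the run that
    \<open>w\<close> leaves over. With this parameter the vectors paired with \<open>z\<close> do
    not depend on \<open>m\<close>.\<close>
  have value_run: "f (t @ replicate (m - l) a) = cinner (adjw (replicate l a @ [b]) x) z" if "l \<le> m" for l
  proof -
    have "v = replicate (m - l) a @ replicate l a @ [b]"
      using that by (simp add: v_def replicate_add[symmetric])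
    then have "f (t @ replicate (m - l) a) = cinner x (opw (replicate l a @ [b]) z)"
      using t rep by (simp add: f_def opw_append cinner_opw)
    then show ?thesis using run by (simp add: cinner_adjw')
  qed
  have 1: "l2_bound A1 f (e / 4)"
    by (rule l2_bound_dominated[OF z(2), of _ _ "\<lambda>u. t @ v @ u"])
      (use t v in \<open>auto simp: A1_def f_def opw_append cinner_opw\<close>)
  have 2: "l2_bound A2 f (e / 4)"
  proof -
    have "l2_bound {..<length t} (\<lambda>i. f (take i t)) (\<Sum>i<length t. e / (4 * (length t + 1)))"
    proof (rule l2_bound_finite)
      fix i assume i: "i \<in> {..<length t}"
      have tw: "take i t \<in> \<W>" "drop i t \<in> \<W>" using t words_simps(3)[of "take i t" "drop i t"] by auto
      have "opw t y = opw (take i t) (opw (drop i t) y)" for y by (simp flip: opw_append)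
      then have "f (take i t) = cinner (opw (take i t) x) (opw (take i t) (opw (drop i t) (opw v z)))"
        by (simp add: f_def)
      also have "\<dots> = cinner x (opw (drop i t) (opw v z))" by (rule cinner_opw[OF tw(1)])
      also have "\<dots> = cinner (adjw v (adjw (drop i t) x)) z"
        using tw v by (simp add: cinner_adjw')
      finally have "cmod (f (take i t)) \<le> norm (adjw v (adjw (drop i t) x)) * norm z"
        by (simp only: cmod_cinner_le)
      then show "cmod (f (take i t)) \<le> e / (4 * (length t + 1))"
        using m[of i] i z(1) by (simp add: v_def)
    qed simp
    moreover have "(\<Sum>i<length t. e / (4 * (length t + 1))) \<le> e / 4" using e by (simp add: field_simps)
    ultimately have "l2_bound {..<length t} (\<lambda>i. f (take i t)) (e / 4)" by (auto intro: l2_bound_mono)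
    then show ?thesis by (rule l2_bound_dominated[of _ _ _ _ _ "\<lambda>i. take i t"]) (auto simp: A2_def)
  qed
  have 3: "l2_bound A3 f (e / 4)"
  proof -
    have "l2_bound G (\<lambda>l. cinner (adjw (replicate l a @ [b]) x) z) (\<Sum>l\<in>G. e / (4 * (card G + 1)))"
      by (rule l2_bound_finite) (use G zG in auto)
    moreover have "(\<Sum>l\<in>G. e / (4 * (card G + 1))) \<le> e / 4" using e by (simp add: field_simps)
    ultimately have "l2_bound G (\<lambda>l. cinner (adjw (replicate l a @ [b]) x) z) (e / 4)" by (auto intro: l2_bound_mono)
    then show ?thesis
      by (rule l2_bound_dominated[of _ _ _ _ _ "\<lambda>l. t @ replicate (m - l) a"]) (auto simp: A3_def value_run)
  qed
  have 4: "l2_bound A4 f (e / 4)"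
  proof (rule l2_bound_dominated[OF G(2), of _ _ "\<lambda>l. t @ replicate (m - l) a"])
    fix i assume "i \<in> A4"
    then obtain l where l: "i = t @ replicate (m - l) a" "l \<le> m" "l \<notin> G" by (auto simp: A4_def)
    have "cmod (f i) \<le> norm (adjw (replicate l a @ [b]) x) * norm z"
      unfolding l(1) value_run[OF l(2)] by (rule cmod_cinner_le)
    then show "\<exists>l\<in>UNIV - G. i = t @ replicate (m - l) a \<and>
        cmod (f i) \<le> cmod (complex_of_real (norm (adjw (replicate l a @ [b]) x)))"
      using l z(1) by auto
  qed
  define A where "A = (A1 \<union> A2) \<union> (A3 \<union> A4)"
  have "l2_bound A f ((e / 4 + e / 4) + (e / 4 + e / 4))"
    unfolding A_def by (intro l2_bound_Un 1 2 3 4)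
  then have A: "l2_bound A f e" by simp
  have "l2_bound \<W> f e"
  proof (rule l2_bound_dominated[OF A, of _ _ id])
    fix w assume w: "w \<in> \<W>" "f w \<noteq> 0"
    have tv: "t @ v \<in> \<W>" using t v by simp
    have "w \<in> A"
      using cinner_opw_cases[OF w(1) tv]
    proof (elim disjE bexE)
      fix u assume "u \<in> \<W>" "w = (t @ v) @ u"
      then show ?thesis by (auto simp: A_def A1_def)
    next
      fix g assume g: "g \<in> \<W>" "t @ v = w @ g"
      show ?thesis
      proof (cases "length w < length t")
        case True
        then have "w = take (length w) t" using g(2) by (metis append_eq_append_conv_if append_eq_conv_conj less_imp_le take_all_iff take_append)
        then show ?thesis using True by (auto simp: A_def A2_def)
      next
        case False
        then obtain p where p: "w = t @ p" "v = p @ g"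
          using g(2) by (auto simp: append_eq_append_conv2)
        show ?thesis
        proof (cases "g = []")
          case True
          then have "w = t @ v @ []" using p by simp
          then show ?thesis unfolding A_def A1_def using words_simps(1) by blast
        next
          case False
          have "length p + length g = Suc m" using arg_cong[OF p(2), of length] by (simp add: v_def)
          then have lp: "length p \<le> m" using False by (cases g) auto
          have "p = take (length p) v" using p(2) by simp
          also have "\<dots> = replicate (length p) a" using lp by (simp add: v_def min_def)
          finally have "w = t @ replicate (m - (m - length p)) a" using p(1) lp by simp
          then show ?thesis unfolding A_def A3_def A4_def by (cases "m - length p \<in> G") auto
        qed
      qed
    next
      assume "\<forall>x y. cinner (opw w x) (opw (t @ v) y) = 0"
      then show ?thesis using w(2) by (simp add: f_def opw_append)
    qed
    then show "\<exists>b\<in>A. w = id b \<and> cmod (f w) \<le> cmod (f b)" by auto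
  qed
  then show ?thesis unfolding f_def[abs_def] v_def .
qed

text \<open>The corrections are multiples of \<open>S\<^sub>v z\<close> and \<open>\<Sum> cnj (\<zeta> t) S\<^sub>t S\<^sub>v z\<close> with \<open>v = a\<^sup>m b\<close>.  Here \<open>z\<close> is chosen
  first, almost orthogonal to everything generated by \<open>x\<close>, and then \<open>m\<close> large enough to spread out
  the correlations of \<open>z\<close> with itself and with \<open>y\<close>.\<close>

lemma factorization_step:
  assumes nw: recurrent and x0: "ac x0" "x0 \<noteq> 0"
    and ab: "a \<in> letters n" "b \<in> letters n" "a \<noteq> b"
    and x: "ac x" and y: "ac y" and e: "e > 0" and e': "e' > 0"
    and err: "l2_bound \<W> (\<lambda>w. (if w = [] then 1 else 0) - cinner (opw w x) y) e"
  shows "\<exists>x' y'. ac x' \<and> ac y' \<and> norm (x' - x) \<le> sqrt e \<and> norm (y' - y) \<le> sqrt e \<and>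
    l2_bound \<W> (\<lambda>w. (if w = [] then 1 else 0) - cinner (opw w x') y') e'"
proof -
  define \<zeta> where "\<zeta> w = (if w = [] then 1 else 0) - cinner (opw w x) y" for w
  have e4: "e' / 4 > 0" using e' by simp
  obtain G where G: "finite G" "G \<subseteq> \<W>" "l2_bound (\<W> - G) \<zeta> (e' / 4)"
    using l2_bound_tail[OF err e4] unfolding \<zeta>_def[symmetric] by metis
  \<comment> \<open>The error is written as \<open>s\<close> times \<zeta> / s. Its l2 norm is at
    most e = s^2, so both factors have norm at most sqrt e.\<close>
  define s where "s = sqrt e"
  have s: "s > 0" "s\<^sup>2 = e" using e by (auto simp: s_def)
  define K where "K = (\<Sum>t\<in>G. cmod (\<zeta> t))"
  have K: "K \<ge> 0" unfolding K_def by (intro sum_nonneg) auto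
  \<comment> \<open>The cross terms at \<open>t\<close> enter with weight |\<zeta> t| / s, in total
    \<open>K / s\<close>.\<close>
  define d where "d = e' / (4 * (K / s + 1))"
  have d: "d > 0" "K / s * d \<le> e' / 4"
  proof -
    have q: "K / s \<ge> 0" using K s(1) by simp
    then show "d > 0" using e' by (simp add: d_def)
    have "k * (e' / (4 * (k + 1))) \<le> e' / 4" if "k \<ge> 0" for k using that e' by (simp add: field_simps)
    from this[OF q] show "K / s * d \<le> e' / 4" unfolding d_def .
  qed
  define v where "v m = replicate m a @ [b]" for m
  have rep: "replicate l a \<in> \<W>" for l using ab by (induction l) auto
  then have v: "v m \<in> \<W>" for m using ab by (auto simp: v_def)
  have d4: "d / 4 > 0" using d by simp
  obtain J where J: "finite J" "J \<subseteq> UNIV" "l2_bound (UNIV - J) (\<lambda>l. complex_of_real (norm (adjw (v l) x))) (d / 4)"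
    unfolding v_def by (rule l2_bound_tail[OF adjw_run_norm_sum[OF ab, of x] d4])
  define H where "H = (\<lambda>l. adjw (v l) x) ` J"
  have xM: "x \<in> closure (Collect ac)" using x closure_subset by blast
  have H: "finite H" "H \<subseteq> closure (Collect ac)"
    using J(1) adjw_closure_ac[OF nw xM v] by (auto simp: H_def)
  define d2 where "d2 = d / (4 * (card J + 1))"
  have d2: "d2 > 0" using d by (simp add: d2_def)
  obtain z where z: "ac z" "norm z = 1" "l2_bound \<W> (\<lambda>w. cinner (opw w x) z) (d / 4)"
    "\<forall>h\<in>H. cmod (cinner h z) \<le> d2"
    using small_coefficients_and_products[OF nw x0 x H d4 d2] by (elim exE conjE)
  have ev1: "\<forall>\<^sub>F m in sequentially. \<forall>t\<in>G. length t \<le> m"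
    using G(1) by (intro eventually_ball_finite ballI eventually_ge_at_top)
  have ev2: "\<forall>\<^sub>F m in sequentially. l2_bound \<W> (\<lambda>w. cinner (opw (w @ v m) z) y) (e' / (4 * s))"
    unfolding v_def by (rule tail_run_small) (use ab z e' s in auto)
  have ev3: "\<forall>\<^sub>F m in sequentially. l2_bound \<W> (\<lambda>w. cinner (opw (w @ v m) z) z) (e' / (4 * (K + 1)))"
    unfolding v_def by (rule tail_run_small) (use ab z e' K in auto)
  have ev4: "\<forall>\<^sub>F m in sequentially. \<forall>t\<in>G. \<forall>i\<in>{..<length t}.
      norm (adjw (v m) (adjw (drop i t) x)) \<le> d / (4 * (length t + 1))"
    unfolding v_def using G(1)
    by (intro eventually_ball_finite ballI adjw_run_small) (use ab d in auto)
  obtain m where m1: "\<forall>t\<in>G. length t \<le> m"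
    and m2: "l2_bound \<W> (\<lambda>w. cinner (opw (w @ v m) z) y) (e' / (4 * s))"
    and m3: "l2_bound \<W> (\<lambda>w. cinner (opw (w @ v m) z) z) (e' / (4 * (K + 1)))"
    and m4: "\<forall>t\<in>G. \<forall>i\<in>{..<length t}. norm (adjw (v m) (adjw (drop i t) x)) \<le> d / (4 * (length t + 1))"
    using eventually_happens[OF eventually_conj[OF ev1 eventually_conj[OF ev2 eventually_conj[OF ev3 ev4]]]]
    by auto
  define V where "V = opw (v m) z"
  have acV: "ac V" unfolding V_def by (rule ac_opw[OF v z(1)])
  define x' where "x' = x + complex_of_real s *\<^sub>C V"
  \<comment> \<open>The conjugate compensates for the conjugate-linear second argument, so the main
    product restores \<open>\<zeta>\<close> on \<open>G\<close>.\<close>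
  define q where "q t = cnj (\<zeta> t) / complex_of_real s" for t
  define y' where "y' = y + pol q G V"
  have E: "l2_bound \<W> (\<lambda>w. cinner (opw w V) (opw t V) - (if w = t then 1 else 0)) (e' / (4 * (K + 1)))"
    if t: "t \<in> G" for t
  proof (rule l2_bound_dominated[OF m3, of _ _ "\<lambda>u. t @ v m @ u"])
    fix w assume w: "w \<in> \<W>" "cinner (opw w V) (opw t V) - (if w = t then 1 else 0) \<noteq> 0"
    have "t \<in> \<W>" "length t \<le> m" using t G m1 by auto
    from run_orthonormal_error[OF ab z(2) this w(1)] w(2)
    show "\<exists>u\<in>\<W>. w = t @ v m @ u \<and>
      cmod (cinner (opw w V) (opw t V) - (if w = t then 1 else 0)) \<le> cmod (cinner (opw (u @ v m) z) z)"
      unfolding V_def v_def by auto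
  qed
  have orth: "cinner (opw u V) (opw t V) = (if u = t then 1 else 0)" if ut: "u \<in> G" "t \<in> G" for u t
  proof -
    have "t \<in> \<W>" "length t \<le> m" "u \<in> \<W>" "length u \<le> m" using ut G m1 by auto
    from run_orthonormal_error[OF ab z(2) this(1,2,3)] this(4) show ?thesis
      unfolding V_def v_def by auto
  qed
  have "norm (x' - x) = s"
    using s(1) by (simp add: x'_def norm_scaleC V_def norm_opw v z(2))
  then have nx: "norm (x' - x) \<le> sqrt e" by (simp add: s_def)
  have ny: "norm (y' - y) \<le> sqrt e"
  proof -
    have "complex_of_real ((norm (pol q G V))\<^sup>2) = (\<Sum>u\<in>G. \<Sum>t\<in>G. q u * cnj (q t) * cinner (opw u V) (opw t V))"
      unfolding cinner_self[symmetric] pol_def cinner.sum_left cinner.sum_right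
      by (subst sum.swap) (simp add: cinner_scaleC_left cinner_scaleC_right mult_ac)
    also have "\<dots> = (\<Sum>u\<in>G. \<Sum>t\<in>G. if u = t then q u * cnj (q t) else 0)"
      by (rule sum.cong[OF refl], rule sum.cong[OF refl]) (simp add: orth)
    also have "\<dots> = (\<Sum>u\<in>G. q u * cnj (q u))" using G(1) by simp
    also have "\<dots> = complex_of_real (\<Sum>u\<in>G. (cmod (q u))\<^sup>2)"
      by (simp only: of_real_sum complex_norm_square)
    finally have "(norm (pol q G V))\<^sup>2 = (\<Sum>u\<in>G. (cmod (q u))\<^sup>2)" using of_real_eq_iff by blast
    also have "\<dots> = (\<Sum>u\<in>G. (cmod (\<zeta> u))\<^sup>2) / s\<^sup>2"
      using s(1) by (simp add: q_def norm_divide power_divide sum_divide_distrib)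
    also have "\<dots> \<le> e\<^sup>2 / s\<^sup>2"
      using l2_bound_sumD[OF err[folded \<zeta>_def] G(1,2)] by (intro divide_right_mono) auto
    also have "\<dots> = e" using s e by (simp add: power2_eq_square)
    finally have "norm (pol q G V) \<le> sqrt e" by (rule real_le_rsqrt)
    then show ?thesis by (simp add: y'_def)
  qed
  \<comment> \<open>The new error: \<open>c1\<close> is the uncorrected tail of
    \<open>\<zeta>\<close>, \<open>c2\<close> pairs the change of \<open>x\<close> with the old
    \<open>y\<close>, \<open>c3\<close> pairs the old \<open>x\<close> with the change of
    \<open>y\<close>, and \<open>c4\<close> is the failure of the orbit of \<open>V\<close> to be
    orthonormal.\<close>
  define c1 where "c1 w = (if w \<in> G then 0 else \<zeta> w)" for w
  define c2 where "c2 w = - complex_of_real s * cinner (opw (w @ v m) z) y" for w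
  define c3 where "c3 w = (\<Sum>t\<in>G. - (\<zeta> t / complex_of_real s) * cinner (opw w x) (opw t V))" for w
  define c4 where "c4 w = (\<Sum>t\<in>G. - \<zeta> t * (cinner (opw w V) (opw t V) - (if w = t then 1 else 0)))" for w
  have b1: "l2_bound \<W> c1 (e' / 4)"
    by (rule l2_bound_dominated[OF G(3), of _ _ id]) (auto simp: c1_def)
  have b2: "l2_bound \<W> c2 (e' / 4)"
  proof -
    have eq: "cmod (- complex_of_real s) * (e' / (4 * s)) = e' / 4" using s(1) by simp
    show ?thesis
      using l2_bound_cmult[OF m2, of "- complex_of_real s"] unfolding c2_def[abs_def] eq .
  qed
  have b3: "l2_bound \<W> c3 (e' / 4)"
  proof -
    have "l2_bound \<W> (\<lambda>w. cinner (opw w x) (opw t V)) d" if t: "t \<in> G" for t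
      unfolding V_def v_def
    proof (rule cross_term_bound[OF ab d(1) z(2) z(3) J(1) J(3)[unfolded v_def]])
      show "t \<in> \<W>" using t G by blast
      show "cmod (cinner (adjw (replicate l a @ [b]) x) z) \<le> d / (4 * (card J + 1))" if "l \<in> J" for l
        using z(4) that by (auto simp: H_def v_def d2_def)
      show "norm (adjw (replicate m a @ [b]) (adjw (drop i t) x)) \<le> d / (4 * (length t + 1))"
        if "i < length t" for i
        using m4 t that by (auto simp: v_def)
    qed
    then have "l2_bound \<W> c3 (\<Sum>t\<in>G. cmod (- (\<zeta> t / complex_of_real s)) * d)"
      unfolding c3_def by (intro l2_bound_sum[OF G(1)] l2_bound_cmult)
    moreover have "(\<Sum>t\<in>G. cmod (- (\<zeta> t / complex_of_real s)) * d) = K / s * d"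
      using s(1) by (simp add: K_def norm_divide sum_distrib_right sum_divide_distrib)
    ultimately show ?thesis using d(2) by (auto intro: l2_bound_mono)
  qed
  have b4: "l2_bound \<W> c4 (e' / 4)"
  proof -
    have "l2_bound \<W> c4 (\<Sum>t\<in>G. cmod (- \<zeta> t) * (e' / (4 * (K + 1))))"
      unfolding c4_def by (intro l2_bound_sum[OF G(1)] l2_bound_cmult E)
    moreover have "(\<Sum>t\<in>G. cmod (- \<zeta> t) * (e' / (4 * (K + 1)))) = K * (e' / (4 * (K + 1)))"
      by (simp only: norm_minus_cancel sum_distrib_right[symmetric] K_def[symmetric])
    moreover have "K * (e' / (4 * (K + 1))) \<le> e' / 4" using K e' by (simp add: field_simps)
    ultimately show ?thesis by (auto intro: l2_bound_mono)
  qed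
  have "l2_bound \<W> (\<lambda>w. (c1 w + c2 w) + (c3 w + c4 w)) ((e' / 4 + e' / 4) + (e' / 4 + e' / 4))"
    by (intro l2_bound_add b1 b2 b3 b4)
  then have bound: "l2_bound \<W> (\<lambda>w. (c1 w + c2 w) + (c3 w + c4 w)) e'" by simp
  have "l2_bound \<W> (\<lambda>w. (if w = [] then 1 else 0) - cinner (opw w x') y') e'"
  proof (rule l2_bound_dominated[OF bound, of _ _ id])
    fix w assume w: "w \<in> \<W>"
    have s0: "complex_of_real s \<noteq> 0" using s(1) by simp
    have "cinner (opw w x') y' = cinner (opw w x) y + complex_of_real s * cinner (opw w V) y
        + cinner (opw w x) (pol q G V) + complex_of_real s * cinner (opw w V) (pol q G V)"
      using w by (simp add: x'_def y'_def opw_add opw_scaleC cinner_add_left cinner_add_right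
          cinner_scaleC_left algebra_simps)
    moreover have "complex_of_real s * cinner (opw w V) y = - c2 w"
      by (simp add: c2_def V_def opw_append)
    moreover have "cinner (opw w x) (pol q G V) = - c3 w"
      by (simp add: pol_def c3_def q_def cinner.sum_right cinner_scaleC_right sum_negf)
    moreover have "complex_of_real s * cinner (opw w V) (pol q G V) = (\<Sum>t\<in>G. \<zeta> t * cinner (opw w V) (opw t V))"
      using s0 by (simp add: pol_def q_def cinner.sum_right cinner_scaleC_right sum_distrib_left)
    moreover have "\<dots> = - c4 w + (\<Sum>t\<in>G. if w = t then \<zeta> t else 0)"
      unfolding c4_def sum_negf[symmetric] sum.distrib[symmetric]
      by (rule sum.cong) (auto simp: algebra_simps)
    moreover have "(\<Sum>t\<in>G. if w = t then \<zeta> t else 0) = (if w \<in> G then \<zeta> w else 0)"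
      using G(1) by simp
    ultimately have "(if w = [] then 1 else 0) - cinner (opw w x') y' = (c1 w + c2 w) + (c3 w + c4 w)"
      by (simp add: c1_def \<zeta>_def)
    then show "\<exists>b\<in>\<W>. w = id b \<and>
        cmod ((if w = [] then 1 else 0) - cinner (opw w x') y') \<le> cmod ((c1 b + c2 b) + (c3 b + c4 b))"
      using w by (intro bexI[of _ w]) auto
  qed
  moreover have "ac x'" unfolding x'_def by (intro ac_add ac_scaleC x acV)
  moreover have "ac y'" unfolding y'_def by (intro ac_add ac_pol y acV G)
  ultimately show ?thesis using nx ny by blast
qed

lemma convergent_of_summable_increments:
  fixes X :: "nat \<Rightarrow> 'b::banach"
  assumes "\<And>k. norm (X (Suc k) - X k) \<le> (1/2)^k"
  shows "convergent X"
proof -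
  have "summable (\<lambda>k. X (Suc k) - X k)"
    by (rule summable_comparison_test'[of "\<lambda>k. (1/2)^k"]) (use assms in \<open>auto intro: summable_geometric\<close>)
  then have "convergent (\<lambda>m. \<Sum>k<m. X (Suc k) - X k)" by (simp add: summable_iff_convergent)
  then have "convergent (\<lambda>m. (X m - X 0) + X 0)"
    unfolding sum_lessThan_telescope by (intro convergent_add convergent_const)
  then show ?thesis by simp
qed

text \<open>Errors 4^-k make the increments at most 2^-k, hence summable. The iteration starts from
  (0, 0) with error 1, and only the identity at each single word is carried to the limit.\<close>

lemma exact_factorization:
  assumes nw: recurrent and x0: "ac x0" "x0 \<noteq> 0"
    and ab: "a \<in> letters n" "b \<in> letters n" "a \<noteq> b"
  shows "\<exists>x y. \<forall>w\<in>\<W>. cinner (opw w x) y = (if w = [] then 1 else 0)"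
proof -
  define P where "P k p \<longleftrightarrow> ac (fst p) \<and> ac (snd p) \<and>
    l2_bound \<W> (\<lambda>w. (if w = [] then 1 else 0) - cinner (opw w (fst p)) (snd p)) ((1/4)^k)" for k p
  define Q where "Q k p p' \<longleftrightarrow> norm (fst p' - fst p) \<le> (1/2)^k \<and> norm (snd p' - snd p) \<le> (1/2)^k"
    for k :: nat and p p' :: "'a \<times> 'a"
  have "\<exists>X. \<forall>k. P k (X k) \<and> Q k (X k) (X (Suc k))"
  proof (rule dependent_nat_choice)
    have "l2_bound \<W> (\<lambda>w. (if w = [] then 1 else 0) - cinner (opw w 0) 0) 1"
    proof (rule l2_bound_dominated[of "{[]}" "\<lambda>_. 1" _ _ _ id])
      show "l2_bound {[] :: nat list} (\<lambda>_. 1) 1" using l2_bound_finite[of "{[]}" "\<lambda>_. 1" "\<lambda>_. 1"] by simp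
    qed (auto split: if_splits)
    then show "\<exists>p. P 0 p" by (intro exI[of _ "(0, 0)"]) (simp add: P_def ac_zero)
  next
    fix p k assume p: "P k p"
    have sq: "sqrt ((1/4)^k) = (1/2)^k"
    proof -
      have "(1/4 :: real)^k = ((1/2)^k)\<^sup>2" by (simp add: power_mult[symmetric] power_one_over power2_eq_square flip: power_mult_distrib)
      then show ?thesis by simp
    qed
    have "\<exists>x' y'. ac x' \<and> ac y' \<and> norm (x' - fst p) \<le> sqrt ((1/4)^k) \<and> norm (y' - snd p) \<le> sqrt ((1/4)^k) \<and>
      l2_bound \<W> (\<lambda>w. (if w = [] then 1 else 0) - cinner (opw w x') y') ((1/4)^Suc k)"
      using p by (intro factorization_step[OF nw x0 ab]) (auto simp: P_def)
    then obtain x' y' where "ac x'" "ac y'" "norm (x' - fst p) \<le> (1/2)^k" "norm (y' - snd p) \<le> (1/2)^k"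
      "l2_bound \<W> (\<lambda>w. (if w = [] then 1 else 0) - cinner (opw w x') y') ((1/4)^Suc k)"
      unfolding sq by (elim exE conjE)
    then show "\<exists>p'. P (Suc k) p' \<and> Q k p p'" by (intro exI[of _ "(x', y')"]) (simp add: P_def Q_def)
  qed
  then obtain X where PX: "\<And>k. P k (X k)" and QX: "\<And>k. Q k (X k) (X (Suc k))" by auto
  obtain x where x: "(\<lambda>k. fst (X k)) \<longlonglongrightarrow> x"
    using convergent_of_summable_increments[of "\<lambda>k. fst (X k)"] QX by (auto simp: Q_def convergent_def)
  obtain y where y: "(\<lambda>k. snd (X k)) \<longlonglongrightarrow> y"
    using convergent_of_summable_increments[of "\<lambda>k. snd (X k)"] QX by (auto simp: Q_def convergent_def)
  have "cinner (opw w x) y = (if w = [] then 1 else 0)" if w: "w \<in> \<W>" for w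
  proof -
    have "(\<lambda>k. (if w = [] then 1 else 0) - cinner (opw w (fst (X k))) (snd (X k)))
        \<longlonglongrightarrow> (if w = [] then 1 else 0) - cinner (opw w x) y"
      by (intro tendsto_diff tendsto_const cinner.tendsto opw_tendsto x y w)
    moreover have "(\<lambda>k. (if w = [] then 1 else 0) - cinner (opw w (fst (X k))) (snd (X k))) \<longlonglongrightarrow> 0"
    proof (rule tendsto_norm_zero_cancel, rule tendsto_sandwich[OF _ _ tendsto_const])
      show "\<forall>\<^sub>F k in sequentially. norm ((if w = [] then 1 else 0) - cinner (opw w (fst (X k))) (snd (X k))) \<le> (1/4)^k"
      proof (rule always_eventually, rule allI)
        fix k
        have "l2_bound \<W> (\<lambda>w. (if w = [] then 1 else 0) - cinner (opw w (fst (X k))) (snd (X k))) ((1/4)^k)"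
          using PX[of k] by (simp add: P_def)
        from l2_bound_point[OF this w]
        show "norm ((if w = [] then 1 else 0) - cinner (opw w (fst (X k))) (snd (X k))) \<le> (1/4)^k" .
      qed
      show "(\<lambda>k. (1/4 :: real)^k) \<longlonglongrightarrow> 0" by (rule LIMSEQ_realpow_zero) auto
    qed auto
    ultimately have "(if w = [] then 1 else 0) - cinner (opw w x) y = 0" by (rule LIMSEQ_unique)
    then show ?thesis by simp
  qed
  then show ?thesis by blast
qed

text \<open>\<open>y\<close> is orthogonal to all nonempty words of \<open>x\<close> and <x, y> = 1,
  so the distance of \<open>x\<close> from their span is at least 1 / ||y||.\<close>

lemma nondeg_of_factorization:
  assumes "\<forall>w\<in>\<W>. cinner (opw w x) y = (if w = [] then 1 else 0)"
  shows "nondeg 1 (\<lambda>_. x)"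
proof -
  have xy: "cinner x y = 1" using assms by (auto dest: bspec[of _ _ "[]"])
  then have y0: "norm y > 0" by auto
  have "1 / (norm y)\<^sup>2 \<le> (norm (x + pol a W x))\<^sup>2" if W: "finite W" "W \<subseteq> \<W> - {[]}" for a W
  proof -
    have "cinner (pol a W x) y = (\<Sum>w\<in>W. a w * cinner (opw w x) y)"
      by (simp add: pol_def cinner.sum_left cinner_scaleC_left)
    also have "\<dots> = 0"
    proof (intro sum.neutral ballI)
      fix w assume "w \<in> W"
      then have "w \<in> \<W>" "w \<noteq> []" using W by auto
      then show "a w * cinner (opw w x) y = 0" using assms by simp
    qed
    finally have "cinner (x + pol a W x) y = 1" using xy by (simp add: cinner_add_left)
    then have "1 \<le> norm (x + pol a W x) * norm y" using cmod_cinner_le[of "x + pol a W x" y] by simp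
    then have "1 / norm y \<le> norm (x + pol a W x)" using y0 by (simp add: pos_divide_le_eq)
    then have "(1 / norm y)\<^sup>2 \<le> (norm (x + pol a W x))\<^sup>2" using y0 by (intro power_mono) auto
    then show ?thesis by (simp add: power_divide)
  qed
  then show ?thesis unfolding nondeg_def using y0 by (intro exI[of _ "1 / (norm y)\<^sup>2"]) auto
qed

end

section \<open>A single generator\<close>

lemma norm_root_unity: "z ^ N = 1 \<Longrightarrow> N > 0 \<Longrightarrow> cmod z = 1"
  by (metis norm_ge_zero norm_one norm_power power_eq_1_iff gr_implies_not0)

text \<open>By counting roots, some N-th root of unity \<open>r\<close> has r^k \<noteq> 1;
  multiplication by \<open>r\<close> permutes the roots and scales the sum by r^k.\<close>

lemma sum_power_roots_unity:
  assumes "0 < k" "k < N"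
  shows "(\<Sum>z | z ^ N = 1. z ^ k) = (0 :: complex)"
proof -
  have "\<not> {z::complex. z ^ N = 1} \<subseteq> {z. z ^ k = 1}"
    using card_mono[of "{z::complex. z ^ k = 1}" "{z. z ^ N = 1}"] assms
    by (auto simp: card_roots_unity_eq finite_roots_unity)
  then obtain r :: complex where r: "r ^ N = 1" "r ^ k \<noteq> 1" by blast
  then have "r \<noteq> 0" using assms by (auto simp: power_0_left)
  have "(\<Sum>z | z ^ N = 1. z ^ k) = (\<Sum>z | z ^ N = 1. (r * z) ^ k)"
    by (rule sum.reindex_bij_witness[of _ "\<lambda>z. r * z" "\<lambda>z. z / r"])
      (use r \<open>r \<noteq> 0\<close> in \<open>auto simp: power_mult_distrib power_divide\<close>)
  also have "\<dots> = r ^ k * (\<Sum>z | z ^ N = 1. z ^ k)"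
    by (simp add: power_mult_distrib sum_distrib_left)
  finally show ?thesis using r(2) by simp
qed

lemma sum_roots_unity_orthogonal:
  assumes "m < N" "l < N"
  shows "(\<Sum>z | z ^ N = 1. cnj z ^ m * z ^ l) = (if m = l then of_nat N else (0 :: complex))"
proof -
  have N: "N > 0" using assms by simp
  have un: "cnj z * z = 1" if "z ^ N = 1" for z
    using norm_root_unity[OF that N] complex_norm_square[of z] by (simp add: mult.commute)
  consider "m = l" | "m < l" | "l < m" by linarith
  then show ?thesis
  proof cases
    case 1
    have "(\<Sum>z | z ^ N = 1. cnj z ^ m * z ^ l) = (\<Sum>z\<in>{z::complex. z ^ N = 1}. 1)"
      by (rule sum.cong) (use 1 un in \<open>auto simp flip: power_mult_distrib\<close>)
    then show ?thesis using 1 N by (simp add: card_roots_unity_eq)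
  next
    case 2
    have "cnj z ^ m * z ^ l = z ^ (l - m)" if "z ^ N = 1" for z
    proof -
      have "z ^ l = z ^ m * z ^ (l - m)" using 2 by (simp flip: power_add)
      then have "cnj z ^ m * z ^ l = (cnj z * z) ^ m * z ^ (l - m)" by (simp add: power_mult_distrib)
      then show ?thesis using un[OF that] by simp
    qed
    then have "(\<Sum>z | z ^ N = 1. cnj z ^ m * z ^ l) = (\<Sum>z | z ^ N = 1. z ^ (l - m))"
      by (intro sum.cong) auto
    then show ?thesis using 2 assms sum_power_roots_unity[of "l - m" N] by simp
  next
    case 3
    have "cnj z ^ m * z ^ l = cnj (z ^ (m - l))" if "z ^ N = 1" for z
    proof -
      have "cnj z ^ m = cnj z ^ l * cnj z ^ (m - l)" using 3 by (simp flip: power_add)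
      then have "cnj z ^ m * z ^ l = (cnj z * z) ^ l * cnj z ^ (m - l)" by (simp add: power_mult_distrib)
      then show ?thesis using un[OF that] by simp
    qed
    then have "(\<Sum>z | z ^ N = 1. cnj z ^ m * z ^ l) = cnj (\<Sum>z | z ^ N = 1. z ^ (m - l))"
      unfolding cnj_sum by (intro sum.cong) auto
    then show ?thesis using 3 assms sum_power_roots_unity[of "m - l" N] by simp
  qed
qed

text \<open>The rotation \<open>c\<close> of the grid remains free, to be chosen later by
  \<open>exists_unit_norm_ge\<close>.\<close>

lemma discrete_parseval:
  fixes y :: "nat \<Rightarrow> 'a::complex_inner"
  assumes c: "cmod c = 1"
  shows "(\<Sum>z | z ^ N = 1. (norm (\<Sum>m<N. (cnj (c * z)) ^ m *\<^sub>C y m))\<^sup>2) = real N * (\<Sum>m<N. (norm (y m))\<^sup>2)"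
proof -
  have cc: "cnj c ^ m * c ^ m = 1" for m
    using c complex_norm_square[of c] by (simp add: mult.commute flip: power_mult_distrib)
  have "complex_of_real (\<Sum>z | z ^ N = 1. (norm (\<Sum>m<N. (cnj (c * z)) ^ m *\<^sub>C y m))\<^sup>2)
    = (\<Sum>z | z ^ N = 1. \<Sum>l<N. \<Sum>m<N. cnj c ^ m * c ^ l * (cnj z ^ m * z ^ l) * cinner (y m) (y l))"
    unfolding of_real_sum cinner_self[symmetric] cinner.sum_left cinner.sum_right
    by (simp add: cinner_scaleC_left cinner_scaleC_right power_mult_distrib mult_ac)
  also have "\<dots> = (\<Sum>l<N. \<Sum>m<N. cnj c ^ m * c ^ l * cinner (y m) (y l) * (\<Sum>z | z ^ N = 1. cnj z ^ m * z ^ l))"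
    unfolding sum_distrib_left
    by (subst sum.swap, rule sum.cong[OF refl], subst sum.swap, rule sum.cong[OF refl], rule sum.cong) (auto simp: mult_ac)
  also have "\<dots> = (\<Sum>l<N. \<Sum>m<N. if m = l then cnj c ^ l * c ^ l * cinner (y l) (y l) * of_nat N else 0)"
    by (rule sum.cong[OF refl], rule sum.cong[OF refl]) (simp add: sum_roots_unity_orthogonal)
  also have "\<dots> = complex_of_real (real N * (\<Sum>m<N. (norm (y m))\<^sup>2))"
    by (simp add: cc) (simp add: cinner_self sum_distrib_left mult_ac)
  finally show ?thesis using of_real_eq_iff by blast
qed

text \<open>Both sides are monic of degree \<open>L\<close> with the same \<open>L\<close> zeros, so
  their difference has too many zeros for its degree.\<close>

lemma prod_linear_roots_unity:
  assumes "L > 0"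
  shows "(\<Prod>z | z ^ L = 1. x - z) = x ^ L - (1 :: complex)"
proof -
  let ?Z = "{z::complex. z ^ L = 1}"
  define P where "P = (\<Prod>z\<in>?Z. [:- z, 1:])"
  define Q where "Q = monom 1 L - (1 :: complex poly)"
  have fin: "finite ?Z" using assms by (simp add: finite_roots_unity)
  have degP: "degree P = L"
    unfolding P_def using assms by (subst degree_prod_eq_sum_degree) (auto simp: card_roots_unity_eq)
  have lcP: "coeff P L = 1"
    using lead_coeff_prod[of "\<lambda>z. [:- z, 1:]" ?Z] unfolding degP[unfolded P_def] by (simp add: P_def)
  have "P - Q = 0"
  proof (rule ccontr)
    assume ne: "P - Q \<noteq> 0"
    have "degree (P - Q) \<le> L - 1"
    proof (rule degree_le, intro allI impI)
      fix i assume "L - 1 < i"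
      then consider "i = L" | "i > L" using assms by linarith
      then show "coeff (P - Q) i = 0"
        by cases (use assms lcP degP in \<open>auto simp: Q_def coeff_eq_0 one_pCons coeff_pCons split: nat.splits\<close>)
    qed
    moreover have "card ?Z \<le> card {z. poly (P - Q) z = 0}"
    proof (rule card_mono)
      show "finite {z. poly (P - Q) z = 0}" using ne by (rule poly_roots_finite)
      show "?Z \<subseteq> {z. poly (P - Q) z = 0}"
        using fin by (auto simp: P_def Q_def poly_prod poly_monom intro: prod_zero)
    qed
    ultimately show False
      using card_poly_roots_bound[OF ne] assms by (simp add: card_roots_unity_eq)
  qed
  then have "poly P x = poly Q x" by simp
  then show ?thesis by (simp add: P_def Q_def poly_prod poly_monom)
qed

text \<open>The product without moduli is a^L - (-c)^L.\<close>

lemma norm_prod_roots_unity_ge: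
  assumes "L > 0"
  shows "cmod a ^ L - cmod c ^ L \<le> (\<Prod>z | z ^ L = 1. cmod (a + z * c))"
proof (cases "c = 0")
  case True
  then show ?thesis using assms by (simp add: card_roots_unity_eq)
next
  case False
  have "(\<Prod>z | z ^ L = 1. a + z * c) = (\<Prod>z | z ^ L = 1. - c * (- a / c - z))"
    by (rule prod.cong) (use False in \<open>auto simp: field_simps\<close>)
  also have "\<dots> = (- c) ^ L * ((- a / c) ^ L - 1)"
    by (simp only: prod.distrib prod_linear_roots_unity[OF assms] prod_constant card_roots_unity_eq[OF assms])
  also have "\<dots> = a ^ L - (- c) ^ L"
    using False by (simp add: right_diff_distrib flip: power_mult_distrib)
  finally have "(\<Prod>z | z ^ L = 1. cmod (a + z * c)) = cmod (a ^ L - (- c) ^ L)"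
    by (simp add: prod_norm)
  moreover have "cmod (a ^ L) - cmod ((- c) ^ L) \<le> cmod (a ^ L - (- c) ^ L)" by (rule norm_triangle_ineq2)
  ultimately show ?thesis by (simp add: norm_power)
qed

text \<open>Discrete form of \<open>\<integral> log \<bar>a + z c\<bar> \<ge> log \<bar>a\<bar>\<close>; the summand \<open>\<epsilon>\<close> allows for zeros of \<open>u + z w\<close> on the grid.\<close>

lemma prod_norm_combination_ge_dominant:
  fixes u w :: "'a::complex_inner"
  assumes \<epsilon>: "0 < \<epsilon>" "\<epsilon> < 1" and L: "L > 0" "(1 - \<epsilon> / 5) ^ L \<le> 1 / 2"
    and uw: "norm w \<le> norm u" "1 / 3 \<le> (norm u)\<^sup>2" "norm u \<le> 1" and R: "R \<ge> 0"
  shows "(1/12) ^ L \<le> (\<Prod>z | z ^ L = 1. R + (norm (u + z *\<^sub>C w))\<^sup>2 + \<epsilon>)"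
proof -
  \<comment> \<open>Shrinking \<open>b\<close> by \<rho> makes (\<rho> |b|)^L at most half of
    ||u||^L. In each squared factor this costs at most (1 - \<rho>) (2 * 2 + 1) =
    \<epsilon>.\<close>
  define \<rho> where "\<rho> = 1 - \<epsilon> / 5"
  have \<rho>: "0 \<le> \<rho>" "\<rho> \<le> 1" "\<rho> ^ L \<le> 1/2" using \<epsilon> L(2) by (auto simp: \<rho>_def)
  \<comment> \<open>Pairing with the unit vector along \<open>u\<close> reduces the claim to
    scalars, since it cannot increase norms.\<close>
  define e where "e = complex_of_real (1 / norm u) *\<^sub>C u"
  have u0: "norm u > 0" using uw(2) by (cases "u = 0") auto
  have e1: "norm e = 1" using u0 by (auto simp: e_def norm_scaleC norm_divide)
  define b where "b = cinner w e"
  have ue: "cinner u e = complex_of_real (norm u)"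
    using u0 by (simp add: e_def cinner_scaleC_right cinner_self power2_eq_square)
  have b: "cmod b \<le> norm u" using cmod_cinner_le[of w e] e1 uw(1) by (simp add: b_def)
  have fac: "(cmod (complex_of_real (norm u) + z * (complex_of_real \<rho> * b)))\<^sup>2 \<le> R + (norm (u + z *\<^sub>C w))\<^sup>2 + \<epsilon>" (is "(cmod ?l)\<^sup>2 \<le> _")
    if z: "z ^ L = 1" for z
  proof -
    define q where "q = complex_of_real (norm u) + z * b"
    have "q = cinner (u + z *\<^sub>C w) e" by (simp add: q_def cinner_add_left cinner_scaleC_left ue b_def)
    then have q: "cmod q \<le> norm (u + z *\<^sub>C w)" using cmod_cinner_le[of "u + z *\<^sub>C w" e] e1 by simp
    have "cmod z = 1" using norm_root_unity z L(1) by blast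
    then have q2: "cmod q \<le> 2"
      unfolding q_def using norm_triangle_ineq[of "complex_of_real (norm u)" "z * b"] b uw(3) by (simp add: norm_mult)
    have "?l = complex_of_real \<rho> * q + complex_of_real (1 - \<rho>) * complex_of_real (norm u)"
      by (simp add: q_def algebra_simps)
    then have "cmod ?l \<le> \<rho> * cmod q + (1 - \<rho>) * norm u"
      using norm_triangle_ineq[of "complex_of_real \<rho> * q" "complex_of_real (1 - \<rho>) * complex_of_real (norm u)"] \<rho>
      by (simp add: norm_mult del: of_real_diff)
    also have "\<dots> \<le> cmod q + (1 - \<rho>)"
      using \<rho> uw(3) mult_left_le_one_le[of "cmod q" \<rho>] mult_left_le[of "norm u" "1 - \<rho>"] by auto
    finally have "(cmod ?l)\<^sup>2 \<le> (cmod q + (1 - \<rho>))\<^sup>2" by (intro power_mono) auto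
    also have "\<dots> = (cmod q)\<^sup>2 + (1 - \<rho>) * (2 * cmod q + (1 - \<rho>))" by (simp add: power2_eq_square algebra_simps)
    also have "\<dots> \<le> (cmod q)\<^sup>2 + (1 - \<rho>) * 5" using q2 \<rho> by (intro add_left_mono mult_left_mono) auto
    also have "\<dots> \<le> (norm (u + z *\<^sub>C w))\<^sup>2 + \<epsilon>"
      using power_mono[OF q, of 2] by (simp add: \<rho>_def)
    finally show ?thesis using R by linarith
  qed
  have "norm u ^ L / 2 \<le> norm u ^ L - (\<rho> * cmod b) ^ L"
  proof -
    have "(\<rho> * cmod b) ^ L \<le> (1/2) * norm u ^ L"
      unfolding power_mult_distrib using \<rho> b by (intro mult_mono power_mono) auto
    then show ?thesis by simp
  qed
  also have "\<dots> \<le> (\<Prod>z | z ^ L = 1. cmod (complex_of_real (norm u) + z * (complex_of_real \<rho> * b)))"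
    using norm_prod_roots_unity_ge[OF L(1), of "complex_of_real (norm u)" "complex_of_real \<rho> * b"] \<rho>
    by (simp add: norm_mult)
  finally have "(norm u ^ L / 2)\<^sup>2 \<le> (\<Prod>z | z ^ L = 1. cmod (complex_of_real (norm u) + z * (complex_of_real \<rho> * b)))\<^sup>2"
    by (intro power_mono) auto
  also have "\<dots> = (\<Prod>z | z ^ L = 1. (cmod (complex_of_real (norm u) + z * (complex_of_real \<rho> * b)))\<^sup>2)"
    by (rule prod_power_distrib)
  also have "\<dots> \<le> (\<Prod>z | z ^ L = 1. R + (norm (u + z *\<^sub>C w))\<^sup>2 + \<epsilon>)"
    by (rule prod_mono) (use fac in auto)
  finally have "(norm u ^ L / 2)\<^sup>2 \<le> (\<Prod>z | z ^ L = 1. R + (norm (u + z *\<^sub>C w))\<^sup>2 + \<epsilon>)" .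
  moreover have "(1/12) ^ L \<le> (norm u ^ L / 2)\<^sup>2"
  proof -
    \<comment> \<open>The 1/3 is the lower bound for ||u||^2; the 1/4 is the square of the lost
      factor 1/2, and (1/4)^L \<le> 1/4.\<close>
    have "(1/12 :: real) ^ L = (1/3) ^ L * (1/4) ^ L" by (simp flip: power_mult_distrib)
    also have "\<dots> \<le> ((norm u)\<^sup>2) ^ L * (1/4)"
      using uw(2) L(1) power_decreasing[of 1 L "1/4 :: real"] by (intro mult_mono power_mono) auto
    also have "\<dots> = (norm u ^ L / 2)\<^sup>2" by (simp add: power_divide mult.commute flip: power_mult)
    finally show ?thesis .
  qed
  ultimately show ?thesis by linarith
qed

text \<open>One of \<open>R\<close>, ||u||^2, ||w||^2 is at least 1/3. A large \<open>R\<close>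
  bounds every factor; otherwise the longer of the two vectors plays the dominant role.\<close>

lemma prod_norm_combination_ge:
  fixes u w :: "'a::complex_inner"
  assumes \<epsilon>: "0 < \<epsilon>" "\<epsilon> < 1" and L: "L > 0" "(1 - \<epsilon> / 5) ^ L \<le> 1 / 2"
    and R: "R \<ge> 0" "R + (norm u)\<^sup>2 + (norm w)\<^sup>2 = 1"
  shows "(1/12) ^ L \<le> (\<Prod>z | z ^ L = 1. R + (norm (u + z *\<^sub>C w))\<^sup>2 + \<epsilon>)"
proof -
  have "(norm u)\<^sup>2 \<le> 1\<^sup>2" "(norm w)\<^sup>2 \<le> 1\<^sup>2"
    using R zero_le_power2[of "norm u"] zero_le_power2[of "norm w"] unfolding power_one by linarith+
  then have le1: "norm u \<le> 1" "norm w \<le> 1" by (meson power2_le_imp_le zero_le_one)+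
  consider "R \<ge> 1/3" | "(norm u)\<^sup>2 \<ge> 1/3" "norm w \<le> norm u" | "(norm w)\<^sup>2 \<ge> 1/3" "norm u \<le> norm w"
  proof -
    have "(norm w)\<^sup>2 \<le> (norm u)\<^sup>2 \<or> (norm u)\<^sup>2 \<le> (norm w)\<^sup>2" by linarith
    then show ?thesis
    proof
      assume le: "(norm w)\<^sup>2 \<le> (norm u)\<^sup>2"
      then have "norm w \<le> norm u" by (rule power2_le_imp_le) simp
      then show ?thesis using that(1,2) le R(2) by linarith
    next
      assume le: "(norm u)\<^sup>2 \<le> (norm w)\<^sup>2"
      then have "norm u \<le> norm w" by (rule power2_le_imp_le) simp
      then show ?thesis using that(1,3) le R(2) by linarith
    qed
  qed
  then show ?thesis
  proof cases
    case 1
    have "(1/12) ^ L = (\<Prod>z\<in>{z::complex. z ^ L = 1}. 1/12 :: real)"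
      using L(1) by (simp add: card_roots_unity_eq)
    also have "\<dots> \<le> (\<Prod>z | z ^ L = 1. R + (norm (u + z *\<^sub>C w))\<^sup>2 + \<epsilon>)"
    proof (rule prod_mono, intro conjI)
      fix z :: complex
      show "1/12 \<le> R + (norm (u + z *\<^sub>C w))\<^sup>2 + \<epsilon>"
        using 1 \<epsilon> zero_le_power2[of "norm (u + z *\<^sub>C w)"] by linarith
    qed simp
    finally show ?thesis .
  next
    case 2
    then show ?thesis using prod_norm_combination_ge_dominant[OF \<epsilon> L] le1 R by blast
  next
    case 3
    have "(\<Prod>z | z ^ L = 1. R + (norm (w + z *\<^sub>C u))\<^sup>2 + \<epsilon>) = (\<Prod>z | z ^ L = 1. R + (norm (u + z *\<^sub>C w))\<^sup>2 + \<epsilon>)"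
    \<comment> \<open>Inversion permutes the roots, and u + w / z = (w + z u) / z has the norm of w
      + z u, so \<open>u\<close> and \<open>w\<close> may be exchanged.\<close>
    proof (rule prod.reindex_bij_witness[of _ inverse inverse])
      fix z :: complex assume z: "z \<in> {z. z ^ L = 1}"
      then have z1: "cmod z = 1" using norm_root_unity L(1) by blast
      then have "inverse z * z = 1" by (intro left_inverse) auto
      then have "u + inverse z *\<^sub>C w = inverse z *\<^sub>C (w + z *\<^sub>C u)"
        by (simp add: scaleC_add_right scaleC_scaleC)
      then show "R + (norm (u + inverse z *\<^sub>C w))\<^sup>2 + \<epsilon> = R + (norm (w + z *\<^sub>C u))\<^sup>2 + \<epsilon>"
        using z1 by (simp add: norm_scaleC norm_inverse)
    qed (auto simp: power_inverse)
    then show ?thesis using prod_norm_combination_ge_dominant[OF \<epsilon> L, of u w R] 3 le1 R by simp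
  qed
qed

text \<open>The arithmetic-geometric mean inequality, from t / c \<le> exp (t / c - 1). Zero factors
  are harmless in this form.\<close>

lemma prod_le_of_sum_le:
  fixes t :: "'i \<Rightarrow> real"
  assumes I: "finite I" and t: "\<And>i. i \<in> I \<Longrightarrow> 0 \<le> t i" and c: "c > 0" and s: "(\<Sum>i\<in>I. t i) \<le> real (card I) * c"
  shows "(\<Prod>i\<in>I. t i) \<le> c ^ card I"
proof -
  have "(\<Prod>i\<in>I. t i / c) \<le> (\<Prod>i\<in>I. exp (t i / c - 1))"
  proof (rule prod_mono, safe)
    fix i assume "i \<in> I"
    then show "0 \<le> t i / c" using t c by simp
    show "t i / c \<le> exp (t i / c - 1)" using exp_ge_add_one_self[of "t i / c - 1"] by simp
  qed
  also have "\<dots> = exp ((\<Sum>i\<in>I. t i) / c - card I)"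
    by (simp add: exp_sum[OF I, symmetric] sum_subtractf sum_divide_distrib)
  also have "\<dots> \<le> 1" using s c by (simp add: pos_divide_le_eq)
  finally have "(\<Prod>i\<in>I. t i) / c ^ card I \<le> 1" by (simp add: prod_dividef)
  then show ?thesis using c by (simp add: pos_divide_le_eq)
qed

text \<open>The maximum modulus principle. It stands in for the sub-mean value property of log |f|:
  a suitable rotation keeps a product of polynomial values at least as large as its value at the
  centre.\<close>

lemma exists_unit_norm_ge:
  assumes hol: "f holomorphic_on UNIV"
  shows "\<exists>c. cmod c = 1 \<and> cmod (f 0) \<le> cmod (f c)"
proof -
  have cont: "continuous_on A (\<lambda>z. cmod (f z))" for A
    using holomorphic_on_imp_continuous_on[OF hol] continuous_on_subset by (auto intro!: continuous_on_norm)
  have "compact (sphere (0 :: complex) 1)" "sphere (0 :: complex) 1 \<noteq> {}" by auto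
  from continuous_attains_sup[OF this cont] obtain c
    where c: "cmod c = 1" "\<And>z. cmod z = 1 \<Longrightarrow> cmod (f z) \<le> cmod (f c)" by auto
  have "cmod (f 0) \<le> cmod (f c)"
  proof (rule maximum_modulus_frontier[of f "cball 0 1"])
    show "f holomorphic_on interior (cball 0 1)" using hol holomorphic_on_subset by blast
    show "continuous_on (closure (cball 0 1)) f"
      using holomorphic_on_imp_continuous_on[OF hol] continuous_on_subset by blast
    show "cmod (f z) \<le> cmod (f c)" if "z \<in> frontier (cball 0 1)" for z using c(2) that by auto
  qed auto
  then show ?thesis using c(1) by blast
qed

section \<open>Discretised spectral densities of a single isometry\<close>

locale complex_isometry =
  fixes U :: "'a::chilbert_space \<Rightarrow> 'a"
  assumes U_add: "U (x + y) = U x + U y"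
    and U_scaleC: "U (c *\<^sub>C x) = c *\<^sub>C U x"
    and cinner_U: "cinner (U x) (U y) = cinner x y"
begin

abbreviation "Up m \<equiv> U ^^ m"

lemma Up_add: "Up m (x + y) = Up m x + Up m y"
  by (induction m) (auto simp: U_add)

lemma Up_scaleC: "Up m (c *\<^sub>C x) = c *\<^sub>C Up m x"
  by (induction m) (auto simp: U_scaleC)

lemma norm_Up: "norm (Up m x) = norm x"
  by (induction m) (auto simp: norm_eq_sqrt_cinner cinner_U)

lemma U_Up: "U (Up m x) = Up m (U x)"
  by (induction m) auto

definition upol :: "(nat \<Rightarrow> complex) \<Rightarrow> nat \<Rightarrow> 'a \<Rightarrow> 'a" where
  "upol a d x = (\<Sum>m\<le>d. a m *\<^sub>C Up m x)"

text \<open>\<open>wave N z x / sqrt N\<close> approximates the component of \<open>x\<close> over the spectral point \<open>z\<close>.\<close>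

definition wave :: "nat \<Rightarrow> complex \<Rightarrow> 'a \<Rightarrow> 'a" where
  "wave N z x = (\<Sum>m<N. (cnj z) ^ m *\<^sub>C Up m x)"

lemma wave_add: "wave N z (x + y) = wave N z x + wave N z y"
  by (simp add: wave_def Up_add scaleC_add_right sum.distrib)

lemma wave_scaleC: "wave N z (c *\<^sub>C x) = c *\<^sub>C wave N z x"
  by (simp add: wave_def Up_scaleC scaleC_scaleC scaleC.sum_right mult.commute)

lemma wave_sum: "wave N z (\<Sum>i\<in>I. f i) = (\<Sum>i\<in>I. wave N z (f i))"
  by (induction I rule: infinite_finite_induct)
    (auto simp: wave_add, auto simp: wave_def Up_scaleC[of _ 0, simplified])

lemma upol_add: "upol a d (x + y) = upol a d x + upol a d y"
  by (simp add: upol_def Up_add scaleC_add_right sum.distrib)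

lemma upol_scaleC: "upol a d (c *\<^sub>C x) = c *\<^sub>C upol a d x"
  by (simp add: upol_def Up_scaleC scaleC_scaleC scaleC.sum_right mult.commute)

text \<open>Applying \<open>U\<close> shifts the sum by one index and \<open>z\<close> compensates
  the phase, so only the two boundary terms survive. The error does not grow with
  \<open>N\<close>.\<close>

lemma wave_shift:
  assumes z: "cmod z = 1" and N: "N > 0"
  shows "norm (z *\<^sub>C wave N z x - wave N z (U x)) \<le> 2 * norm x"
proof -
  obtain M where M: "N = Suc M" using N by (cases N) auto
  have zz: "z * cnj z = 1" using z complex_norm_square[of z] by simp
  have "z *\<^sub>C wave N z x = (\<Sum>m<Suc M. (z * cnj z ^ m) *\<^sub>C Up m x)"
    by (simp add: wave_def M scaleC.sum_right scaleC_scaleC scaleC_add_right)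
  also have "\<dots> = z *\<^sub>C x + (\<Sum>m<M. (z * cnj z ^ Suc m) *\<^sub>C Up (Suc m) x)"
    by (subst sum.lessThan_Suc_shift) simp
  also have "(\<Sum>m<M. (z * cnj z ^ Suc m) *\<^sub>C Up (Suc m) x) = (\<Sum>m<M. cnj z ^ m *\<^sub>C Up m (U x))"
    by (rule sum.cong) (simp_all add: zz U_Up flip: mult.assoc)
  finally have "z *\<^sub>C wave N z x - wave N z (U x) = z *\<^sub>C x - cnj z ^ M *\<^sub>C Up M (U x)"
    by (simp add: wave_def M)
  also have "norm \<dots> \<le> norm (z *\<^sub>C x) + norm (cnj z ^ M *\<^sub>C Up M (U x))" by (rule norm_triangle_ineq4)
  also have "\<dots> = 2 * norm x"
    using norm_Up[of 1 x] by (simp add: norm_scaleC z norm_power norm_Up)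
  finally show ?thesis .
qed

lemma wave_shift_power:
  assumes z: "cmod z = 1" and N: "N > 0"
  shows "norm (z ^ l *\<^sub>C wave N z x - wave N z (Up l x)) \<le> 2 * real l * norm x"
proof (induction l)
  case (Suc l)
  have "z ^ Suc l *\<^sub>C wave N z x - wave N z (Up (Suc l) x)
    = z *\<^sub>C (z ^ l *\<^sub>C wave N z x - wave N z (Up l x)) + (z *\<^sub>C wave N z (Up l x) - wave N z (U (Up l x)))"
    by (simp add: scaleC.diff_right scaleC_scaleC)
  also have "norm \<dots> \<le> 2 * real l * norm x + 2 * norm (Up l x)"
    using Suc wave_shift[OF z N, of "Up l x"]
    by (intro order_trans[OF norm_triangle_ineq] add_mono) (auto simp: norm_scaleC z)
  finally show ?case by (simp add: norm_Up algebra_simps)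
qed simp

lemma wave_upol:
  assumes z: "cmod z = 1" and N: "N > 0"
  shows "norm ((\<Sum>m\<le>d. a m * z ^ m) *\<^sub>C wave N z x - wave N z (upol a d x))
    \<le> (\<Sum>m\<le>d. cmod (a m) * (2 * real m)) * norm x"
proof -
  have "(\<Sum>m\<le>d. a m * z ^ m) *\<^sub>C wave N z x - wave N z (upol a d x)
    = (\<Sum>m\<le>d. a m *\<^sub>C (z ^ m *\<^sub>C wave N z x - wave N z (Up m x)))"
    by (simp add: upol_def wave_sum wave_scaleC scaleC.sum_left scaleC.diff_right scaleC_scaleC sum_subtractf)
  also have "norm \<dots> \<le> (\<Sum>m\<le>d. cmod (a m) * (2 * real m * norm x))"
    by (rule order_trans[OF norm_sum], rule sum_mono)
      (use wave_shift_power[OF z N] in \<open>auto simp: norm_scaleC intro: mult_left_mono\<close>)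
  finally show ?thesis by (simp add: sum_distrib_left mult_ac)
qed

lemma sum_wave_sq:
  assumes c: "cmod c = 1"
  shows "(\<Sum>z | z ^ N = 1. (norm (wave N (c * z) x))\<^sup>2) = real N * (real N * (norm x)\<^sup>2)"
  using discrete_parseval[OF c, where N = N and y = "\<lambda>m. Up m x"] by (simp add: wave_def norm_Up)

text \<open>Divided by N^2, this bounds the mean of |p|^2 times the density of \<open>x\<close> by 2
  ||p(U) x||^2 plus a term of order 1 / N. The 2 comes from (r + s)^2 \<le> 2 r^2 + 2 s^2.\<close>

lemma sum_poly_wave_sq:
  assumes c: "cmod c = 1" and N: "N > 0"
  shows "(\<Sum>z | z ^ N = 1. (cmod (\<Sum>m\<le>d. a m * (c * z) ^ m))\<^sup>2 * (norm (wave N (c * z) x))\<^sup>2)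
    \<le> 2 * (real N * (real N * (norm (upol a d x))\<^sup>2)) + 2 * real N * ((\<Sum>m\<le>d. cmod (a m) * (2 * real m)) * norm x)\<^sup>2"
proof -
  define K where "K = (\<Sum>m\<le>d. cmod (a m) * (2 * real m)) * norm x"
  have "(cmod (\<Sum>m\<le>d. a m * (c * z) ^ m))\<^sup>2 * (norm (wave N (c * z) x))\<^sup>2
      \<le> 2 * (norm (wave N (c * z) (upol a d x)))\<^sup>2 + 2 * K\<^sup>2" if z: "z ^ N = 1" for z
  proof -
    define p where "p = (\<Sum>m\<le>d. a m * (c * z) ^ m)"
    have cz: "cmod (c * z) = 1" using c norm_root_unity[OF z N] by (simp add: norm_mult)
    have "norm (p *\<^sub>C wave N (c * z) x) \<le> norm (wave N (c * z) (upol a d x)) + K"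
      using wave_upol[OF cz N, where a = a and d = d and x = x] norm_triangle_sub[of "p *\<^sub>C wave N (c * z) x" "wave N (c * z) (upol a d x)"]
      unfolding K_def p_def by linarith
    then have "(norm (p *\<^sub>C wave N (c * z) x))\<^sup>2 \<le> (norm (wave N (c * z) (upol a d x)) + K)\<^sup>2"
      by (intro power_mono) auto
    also have "\<dots> \<le> 2 * (norm (wave N (c * z) (upol a d x)))\<^sup>2 + 2 * K\<^sup>2"
      using sum_squares_bound[of "norm (wave N (c * z) (upol a d x))" K] by (simp add: power2_sum)
    finally show ?thesis unfolding p_def by (simp add: norm_scaleC power_mult_distrib)
  qed
  then have "(\<Sum>z | z ^ N = 1. (cmod (\<Sum>m\<le>d. a m * (c * z) ^ m))\<^sup>2 * (norm (wave N (c * z) x))\<^sup>2)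
    \<le> (\<Sum>z | z ^ N = 1. 2 * (norm (wave N (c * z) (upol a d x)))\<^sup>2 + 2 * K\<^sup>2)"
    by (intro sum_mono) auto
  also have "\<dots> = 2 * (real N * (real N * (norm (upol a d x))\<^sup>2)) + 2 * real N * K\<^sup>2"
    using N by (simp add: sum.distrib sum_wave_sq[OF c] card_roots_unity_eq flip: sum_distrib_left)
  finally show ?thesis unfolding K_def .
qed

text \<open>Parseval in the one-dimensional space of complex numbers. With d < N the powers that
  occur are orthogonal on the grid.\<close>

lemma sum_poly_sq:
  assumes c: "cmod c = 1" and N: "d < N"
  shows "(\<Sum>z | z ^ N = 1. (cmod (\<Sum>m\<le>d. a m * (c * z) ^ m))\<^sup>2) = real N * (\<Sum>m\<le>d. (cmod (a m))\<^sup>2)"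
proof -
  define y where "y m = (if m \<le> d then cnj (a m) else 0)" for m
  have sub: "(\<Sum>m<N. f m) = (\<Sum>m\<le>d. f m)" if "\<And>m. m > d \<Longrightarrow> f m = 0" for f :: "nat \<Rightarrow> 'c::comm_monoid_add"
    by (rule sum.mono_neutral_right) (use N that in auto)
  have "cmod (\<Sum>m\<le>d. a m * (c * z) ^ m) = cmod (\<Sum>m<N. (cnj (c * z)) ^ m *\<^sub>C y m)" for z
  proof -
    have "(\<Sum>m<N. (cnj (c * z)) ^ m *\<^sub>C y m) = (\<Sum>m\<le>d. (cnj (c * z)) ^ m *\<^sub>C y m)"
      by (rule sub) (simp add: y_def)
    also have "\<dots> = cnj (\<Sum>m\<le>d. a m * (c * z) ^ m)"
      by (simp add: y_def scaleC_complex_def mult.commute)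
    finally show ?thesis by (simp only: complex_mod_cnj)
  qed
  then have "(\<Sum>z | z ^ N = 1. (cmod (\<Sum>m\<le>d. a m * (c * z) ^ m))\<^sup>2) = real N * (\<Sum>m<N. (cmod (y m))\<^sup>2)"
    using discrete_parseval[OF c, where N = N and y = y] by simp
  also have "(\<Sum>m<N. (cmod (y m))\<^sup>2) = (\<Sum>m\<le>d. (cmod (y m))\<^sup>2)" by (rule sub) (simp add: y_def)
  finally show ?thesis by (simp add: y_def)
qed

text \<open>The densities of the entries add up to exactly 1 at every point of the circle and for
  every \<open>N\<close>, since the total autocorrelation vanishes off the diagonal.\<close>

lemma sum_wave_wandering:
  assumes X: "\<And>m l. (\<Sum>j<k. cinner (Up m (X j)) (Up l (X j))) = (if m = l then 1 else 0)"
    and z: "cmod z = 1"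
  shows "(\<Sum>j<k. (norm (wave N z (X j)))\<^sup>2) = real N"
proof -
  have zz: "cnj z ^ m * z ^ m = 1" for m
    using z complex_norm_square[of z] by (simp add: mult.commute flip: power_mult_distrib)
  have "complex_of_real (\<Sum>j<k. (norm (wave N z (X j)))\<^sup>2)
    = (\<Sum>j<k. \<Sum>l<N. \<Sum>m<N. cnj z ^ m * z ^ l * cinner (Up m (X j)) (Up l (X j)))"
    unfolding of_real_sum cinner_self[symmetric] wave_def cinner.sum_left cinner.sum_right
    by (simp add: cinner_scaleC_left cinner_scaleC_right mult_ac)
  also have "\<dots> = (\<Sum>l<N. \<Sum>m<N. cnj z ^ m * z ^ l * (\<Sum>j<k. cinner (Up m (X j)) (Up l (X j))))"
    unfolding sum_distrib_left
    by (subst sum.swap, rule sum.cong[OF refl], rule sum.swap)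
  also have "\<dots> = (\<Sum>l<N. \<Sum>m<N. if m = l then cnj z ^ l * z ^ l else 0)"
    by (rule sum.cong[OF refl], rule sum.cong[OF refl]) (simp add: X)
  also have "\<dots> = complex_of_real (real N)" by (simp add: zz)
  finally show ?thesis using of_real_eq_iff by blast
qed

text \<open>By averaging logarithms over \<open>\<zeta>\<close>, for some unimodular \<open>\<zeta>\<close> the last two entries may be replaced by
  \<open>x + \<zeta> y\<close> while the spectral density of the tuple stays log-integrable; the lower bound is then
  the easy half of Szego's theorem.  All averages are taken over roots of unity.\<close>

lemma merge_wandering_pair:
  assumes X: "\<And>m l. (\<Sum>j<Suc (Suc k). cinner (Up m (X j)) (Up l (X j))) = (if m = l then 1 else 0)"
  defines "Y \<equiv> \<lambda>\<zeta> j. if j < k then X j else X k + \<zeta> *\<^sub>C X (Suc k)"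
  shows "\<exists>\<zeta>. \<forall>a d. a 0 = 1 \<longrightarrow> 1/100 \<le> (\<Sum>j<Suc k. (norm (upol a d (Y \<zeta> j)))\<^sup>2)"
proof (rule ccontr)
  assume neg: "\<not> ?thesis"
  \<comment> \<open>The constant is chosen so that 4 c0 = 1/25 lies below the 1/12 of
    \<open>prod_norm_combination_ge\<close>.\<close>
  define c0 :: real where "c0 = 1/100"
  define g where "g p \<zeta> = (\<Sum>j<Suc k. (norm (upol (fst p) (snd p) (Y \<zeta> j)))\<^sup>2)"
    for p :: "(nat \<Rightarrow> complex) \<times> nat" and \<zeta>
  define sq where "sq p = (\<Sum>m\<le>snd p. (cmod (fst p m))\<^sup>2)" for p :: "(nat \<Rightarrow> complex) \<times> nat"
  define A where "A = {p :: (nat \<Rightarrow> complex) \<times> nat. fst p 0 = 1}"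
  have g_cont: "continuous_on UNIV (g p)" for p
  proof -
    have "upol (fst p) (snd p) (Y \<zeta> j) = (if j < k then upol (fst p) (snd p) (X j)
        else upol (fst p) (snd p) (X k) + \<zeta> *\<^sub>C upol (fst p) (snd p) (X (Suc k)))" for \<zeta> j
      by (simp add: Y_def upol_add upol_scaleC)
    then have "g p = (\<lambda>\<zeta>. \<Sum>j<Suc k. (norm (if j < k then upol (fst p) (snd p) (X j)
        else upol (fst p) (snd p) (X k) + \<zeta> *\<^sub>C upol (fst p) (snd p) (X (Suc k))))\<^sup>2)"
      by (simp add: g_def[abs_def])
    moreover have sc: "continuous_on UNIV (\<lambda>\<zeta>. \<zeta> *\<^sub>C v)" for v :: 'a
      by (rule bounded_linear.continuous_on[OF scaleC.bounded_linear_left continuous_on_id])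
    ultimately show ?thesis by (auto intro!: continuous_intros sc)
  qed
  \<comment> \<open>Compactness of the circle leaves finitely many offending polynomials. Their
    common coefficient bound \<open>B\<close> is thus available before \<epsilon>, then
    \<open>L\<close>, then the grid size \<open>N\<close> are chosen.\<close>
  have "sphere (0::complex) 1 \<subseteq> (\<Union>p\<in>A. {\<zeta>. g p \<zeta> < c0})"
  proof
    fix \<zeta> :: complex
    have "\<exists>a d. a 0 = 1 \<and> \<not> 1/100 \<le> (\<Sum>j<Suc k. (norm (upol a d (Y \<zeta> j)))\<^sup>2)"
      using neg unfolding not_ex not_all not_imp by (rule spec)
    then obtain a d where "a 0 = 1" "\<not> 1/100 \<le> (\<Sum>j<Suc k. (norm (upol a d (Y \<zeta> j)))\<^sup>2)"
      by (elim exE conjE)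
    then show "\<zeta> \<in> (\<Union>p\<in>A. {\<zeta>. g p \<zeta> < c0})"
      by (intro UN_I[of "(a, d)"]) (auto simp: A_def g_def c0_def not_le)
  qed
  then obtain A' where A': "A' \<subseteq> A" "finite A'" "sphere (0::complex) 1 \<subseteq> (\<Union>p\<in>A'. {\<zeta>. g p \<zeta> < c0})"
    by (rule compactE_image[rotated 2]) (auto intro: open_Collect_less g_cont)
  define B where "B = 1 + (\<Sum>p\<in>A'. sq p)"
  have sq0: "sq p \<ge> 0" for p unfolding sq_def by (intro sum_nonneg) auto
  have B: "B \<ge> 1" "\<And>p. p \<in> A' \<Longrightarrow> sq p \<le> B"
  proof -
    show "B \<ge> 1" unfolding B_def by (simp add: sum_nonneg sq0)
    show "sq p \<le> B" if "p \<in> A'" for p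
      unfolding B_def using member_le_sum[OF that, of sq] sq0 A'(2) by (simp add: add_increasing)
  qed
  \<comment> \<open>The summand \<epsilon> added to the density contributes at most \<epsilon> B =
    c0 to the weighted mean.\<close>
  define \<epsilon> where "\<epsilon> = c0 / B"
  have \<epsilon>: "0 < \<epsilon>" "\<epsilon> < 1" "\<epsilon> * B = c0" using B(1) by (auto simp: \<epsilon>_def c0_def divide_simps)
  have "(\<lambda>L. (1 - \<epsilon> / 5) ^ L) \<longlonglongrightarrow> 0" by (rule LIMSEQ_power_zero) (use \<epsilon> in auto)
  then have "\<forall>\<^sub>F L in sequentially. (1 - \<epsilon> / 5) ^ L < 1/2" by (rule order_tendstoD) simp
  then have "\<forall>\<^sub>F L in sequentially. (1 - \<epsilon> / 5) ^ L < 1/2 \<and> L > 0"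
    by (rule eventually_conj) (rule eventually_gt_at_top)
  from eventually_happens[OF this] obtain L where L: "L > 0" "(1 - \<epsilon> / 5) ^ L \<le> 1/2"
    by (auto intro: less_imp_le)
  define Z where "Z = {z::complex. z ^ L = 1}"
  have Z: "finite Z" "card Z = L" "\<And>z. z \<in> Z \<Longrightarrow> cmod z = 1"
    using L(1) norm_root_unity by (auto simp: Z_def card_roots_unity_eq finite_roots_unity)
  have "\<forall>\<zeta>\<in>Z. \<exists>p. p \<in> A' \<and> g p \<zeta> < c0" using A'(3) Z(3) by fastforce
  from bchoice[OF this] obtain P where P: "\<forall>\<zeta>\<in>Z. P \<zeta> \<in> A' \<and> g (P \<zeta>) \<zeta> < c0" by (elim exE)
  define a where "a \<zeta> = fst (P \<zeta>)" for \<zeta>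
  define d where "d \<zeta> = snd (P \<zeta>)" for \<zeta>
  have a0: "a \<zeta> 0 = 1" if "\<zeta> \<in> Z" for \<zeta> using P that A'(1) by (auto simp: A_def a_def)
  define \<kappa> where "\<kappa> \<zeta> = (\<Sum>j<Suc k. ((\<Sum>m\<le>d \<zeta>. cmod (a \<zeta> m) * (2 * real m)) * norm (Y \<zeta> j))\<^sup>2)" for \<zeta>
  have \<kappa>0: "\<kappa> \<zeta> \<ge> 0" for \<zeta> unfolding \<kappa>_def by (intro sum_nonneg) auto
  obtain N1 :: nat where N1: "2 * (\<Sum>\<zeta>\<in>Z. \<kappa> \<zeta>) / c0 \<le> real N1" using real_arch_simple by blast
  define N where "N = Suc (N1 + (\<Sum>\<zeta>\<in>Z. d \<zeta>))"
  have N: "N > 0" "\<And>\<zeta>. \<zeta> \<in> Z \<Longrightarrow> d \<zeta> < N" "\<And>\<zeta>. \<zeta> \<in> Z \<Longrightarrow> 2 * \<kappa> \<zeta> \<le> c0 * real N"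
  proof -
    show "N > 0" by (simp add: N_def)
    fix \<zeta> assume z: "\<zeta> \<in> Z"
    show "d \<zeta> < N" using member_le_sum[OF z, of d] Z(1) by (simp add: N_def)
    have "\<kappa> \<zeta> \<le> (\<Sum>\<zeta>\<in>Z. \<kappa> \<zeta>)" using member_le_sum[OF z, of \<kappa>] Z(1) \<kappa>0 by simp
    moreover have "2 * (\<Sum>\<zeta>\<in>Z. \<kappa> \<zeta>) \<le> c0 * real N1" using N1 by (simp add: c0_def)
    moreover have "N1 \<le> N" by (simp add: N_def)
    then have "c0 * real N1 \<le> c0 * real N" by (simp add: c0_def)
    ultimately show "2 * \<kappa> \<zeta> \<le> c0 * real N" by linarith
  qed
  define \<Omega> where "\<Omega> = {z::complex. z ^ N = 1}"
  have \<Omega>: "finite \<Omega>" "card \<Omega> = N" "\<And>z. z \<in> \<Omega> \<Longrightarrow> cmod z = 1"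
    using N(1) norm_root_unity by (auto simp: \<Omega>_def card_roots_unity_eq finite_roots_unity)
  define p where "p \<zeta> z = (\<Sum>m\<le>d \<zeta>. a \<zeta> m * z ^ m)" for \<zeta> z
  \<comment> \<open>All polynomial values on the rotated grid in one product. It equals 1 at 0, as
    the constant terms are 1, so some rotation \<open>c\<close> makes it at least 1 in
    modulus.\<close>
  define F where "F c = (\<Prod>(\<zeta>, z)\<in>Z \<times> \<Omega>. p \<zeta> (c * z))" for c
  have "F holomorphic_on UNIV"
    unfolding F_def p_def case_prod_beta by (intro holomorphic_intros)
  from exists_unit_norm_ge[OF this] obtain c where c: "cmod c = 1" "cmod (F 0) \<le> cmod (F c)" by blast
  have "p \<zeta> 0 = 1" if "\<zeta> \<in> Z" for \<zeta>
    using a0[OF that] by (simp add: p_def zero_power2 power_0_left if_distrib cong: if_cong)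
  then have "F 0 = 1" unfolding F_def by (intro prod.neutral) auto
  then have Fc: "1 \<le> cmod (F c)" using c(2) by simp
  define f where "f \<zeta> z = (\<Sum>j<Suc k. (norm (wave N z (Y \<zeta> j)))\<^sup>2) / real N" for \<zeta> z
  define t where "t = (\<lambda>(\<zeta>, z). (cmod (p \<zeta> (c * z)))\<^sup>2 * (f \<zeta> (c * z) + \<epsilon>))"
  have f0: "f \<zeta> z \<ge> 0" for \<zeta> z unfolding f_def by (intro divide_nonneg_nonneg sum_nonneg) auto
  have t0: "t i \<ge> 0" for i unfolding t_def using f0 \<epsilon>(1) by (auto simp: case_prod_beta intro!: mult_nonneg_nonneg add_nonneg_nonneg)
  \<comment> \<open>4 c0 = 2 c0 + c0 + c0: the image under the polynomial with its factor 2, the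
    boundary error \<open>\<kappa>\<close>, and the contribution of \<epsilon>.\<close>
  have row: "(\<Sum>z\<in>\<Omega>. t (\<zeta>, z)) \<le> real N * (4 * c0)" if z: "\<zeta> \<in> Z" for \<zeta>
  proof -
    have "(\<Sum>z\<in>\<Omega>. (cmod (p \<zeta> (c * z)))\<^sup>2 * f \<zeta> (c * z))
      = (\<Sum>j<Suc k. \<Sum>z\<in>\<Omega>. (cmod (p \<zeta> (c * z)))\<^sup>2 * (norm (wave N (c * z) (Y \<zeta> j)))\<^sup>2) / real N"
      unfolding f_def sum_divide_distrib sum_distrib_left by (subst sum.swap) simp
    also have "\<dots> \<le> (\<Sum>j<Suc k. 2 * (real N * (real N * (norm (upol (a \<zeta>) (d \<zeta>) (Y \<zeta> j)))\<^sup>2))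
        + 2 * real N * ((\<Sum>m\<le>d \<zeta>. cmod (a \<zeta> m) * (2 * real m)) * norm (Y \<zeta> j))\<^sup>2) / real N"
      unfolding p_def \<Omega>_def by (intro divide_right_mono sum_mono sum_poly_wave_sq[OF c(1) N(1)]) simp
    also have "\<dots> = (2 * (real N * (real N * g (P \<zeta>) \<zeta>)) + 2 * real N * \<kappa> \<zeta>) / real N"
      by (simp only: sum.distrib sum_distrib_left[symmetric] g_def a_def d_def \<kappa>_def)
    also have "\<dots> = 2 * (real N * g (P \<zeta>) \<zeta>) + 2 * \<kappa> \<zeta>" using N(1) by (simp add: add_divide_distrib)
    also have "\<dots> \<le> 2 * (real N * c0) + c0 * real N"
      using P z N(3)[OF z] N(1) by (intro add_mono mult_left_mono) (auto intro: less_imp_le)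
    finally have 1: "(\<Sum>z\<in>\<Omega>. (cmod (p \<zeta> (c * z)))\<^sup>2 * f \<zeta> (c * z)) \<le> 3 * (real N * c0)" by (simp add: mult.commute)
    have "(\<Sum>z\<in>\<Omega>. (cmod (p \<zeta> (c * z)))\<^sup>2) = real N * sq (P \<zeta>)"
      unfolding p_def \<Omega>_def sum_poly_sq[OF c(1) N(2)[OF z]] by (simp add: sq_def a_def d_def)
    moreover have "real N * sq (P \<zeta>) \<le> real N * B"
      using B(2)[of "P \<zeta>"] P z by (intro mult_left_mono) auto
    ultimately have "(\<Sum>z\<in>\<Omega>. (cmod (p \<zeta> (c * z)))\<^sup>2) * \<epsilon> \<le> (real N * B) * \<epsilon>"
      using \<epsilon>(1) by (intro mult_right_mono) auto
    also have "\<dots> = real N * c0" using \<epsilon>(3) by (simp add: mult_ac)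
    finally have 2: "(\<Sum>z\<in>\<Omega>. (cmod (p \<zeta> (c * z)))\<^sup>2 * \<epsilon>) \<le> real N * c0"
      by (simp only: sum_distrib_right)
    show ?thesis using 1 2 by (simp add: t_def distrib_left sum.distrib)
  qed
  have "(\<Sum>i\<in>Z \<times> \<Omega>. t i) = (\<Sum>\<zeta>\<in>Z. \<Sum>z\<in>\<Omega>. t (\<zeta>, z))" by (simp add: sum.cartesian_product)
  also have "\<dots> \<le> (\<Sum>\<zeta>\<in>Z. real N * (4 * c0))" by (intro sum_mono row)
  also have "\<dots> = real (card (Z \<times> \<Omega>)) * (4 * c0)" using Z \<Omega> by (simp add: card_cartesian_product)
  finally have "(\<Prod>i\<in>Z \<times> \<Omega>. t i) \<le> (4 * c0) ^ card (Z \<times> \<Omega>)"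
    using Z \<Omega> t0 by (intro prod_le_of_sum_le) (auto simp: c0_def)
  also have "card (Z \<times> \<Omega>) = L * N" using Z \<Omega> by (simp add: card_cartesian_product)
  finally have upper: "(\<Prod>i\<in>Z \<times> \<Omega>. t i) \<le> (1/25) ^ (L * N)" by (simp add: c0_def)
  \<comment> \<open>At a fixed grid point the densities are R, ||u||^2 and ||w||^2 with sum 1, and
    the product over \<zeta> is the one estimated by
    \<open>prod_norm_combination_ge\<close>.\<close>
  have col: "(1/12) ^ L \<le> (\<Prod>\<zeta>\<in>Z. f \<zeta> (c * z) + \<epsilon>)" if z: "z \<in> \<Omega>" for z
  proof -
    have cz: "cmod (c * z) = 1" using c(1) \<Omega>(3)[OF z] by (simp add: norm_mult)
    define s where "s = complex_of_real (1 / sqrt (real N))"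
    define u where "u = s *\<^sub>C wave N (c * z) (X k)"
    define w where "w = s *\<^sub>C wave N (c * z) (X (Suc k))"
    define R where "R = (\<Sum>j<k. (norm (wave N (c * z) (X j)))\<^sup>2) / real N"
    have s: "(cmod s)\<^sup>2 = 1 / real N" using N(1) by (simp add: s_def norm_divide power_divide)
    have ns: "(norm (s *\<^sub>C y))\<^sup>2 = (norm y)\<^sup>2 / real N" for y :: 'a
      by (simp add: norm_scaleC power_mult_distrib s)
    have "R + (norm u)\<^sup>2 + (norm w)\<^sup>2 = (\<Sum>j<Suc (Suc k). (norm (wave N (c * z) (X j)))\<^sup>2) / real N"
      unfolding R_def u_def w_def ns by (simp add: add_divide_distrib)
    also have "\<dots> = 1" using sum_wave_wandering[OF X cz, of N] N(1) by simp
    finally have sum1: "R + (norm u)\<^sup>2 + (norm w)\<^sup>2 = 1" .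
    have R0: "R \<ge> 0" unfolding R_def by (intro divide_nonneg_nonneg sum_nonneg) auto
    have "f \<zeta> (c * z) = R + (norm (u + \<zeta> *\<^sub>C w))\<^sup>2" for \<zeta>
    proof -
      have "u + \<zeta> *\<^sub>C w = s *\<^sub>C wave N (c * z) (X k + \<zeta> *\<^sub>C X (Suc k))"
        by (simp add: u_def w_def wave_add wave_scaleC scaleC_add_right scaleC_scaleC mult.commute)
      then have "(norm (u + \<zeta> *\<^sub>C w))\<^sup>2 = (norm (wave N (c * z) (X k + \<zeta> *\<^sub>C X (Suc k))))\<^sup>2 / real N"
        by (simp only: ns)
      then show ?thesis by (simp add: f_def R_def Y_def add_divide_distrib)
    qed
    then show ?thesis
      using prod_norm_combination_ge[OF \<epsilon>(1,2) L R0 sum1] by (simp add: Z_def)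
  qed
  \<comment> \<open>The columns bound the double product from below. Inserting the polynomial
    factors, whose total modulus is at least 1, leads to the product that the rows bound from
    above.\<close>
  have "(1/12) ^ (L * N) = (\<Prod>z\<in>\<Omega>. (1/12 :: real) ^ L)" using \<Omega> by (simp add: power_mult)
  also have "\<dots> \<le> (\<Prod>z\<in>\<Omega>. \<Prod>\<zeta>\<in>Z. f \<zeta> (c * z) + \<epsilon>)" by (rule prod_mono) (use col in auto)
  also have "\<dots> = (\<Prod>(\<zeta>, z)\<in>Z \<times> \<Omega>. f \<zeta> (c * z) + \<epsilon>)"
    by (subst prod.swap) (simp add: prod.cartesian_product)
  also have "\<dots> \<le> (cmod (F c))\<^sup>2 * (\<Prod>(\<zeta>, z)\<in>Z \<times> \<Omega>. f \<zeta> (c * z) + \<epsilon>)"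
  proof -
    have "0 \<le> (\<Prod>(\<zeta>, z)\<in>Z \<times> \<Omega>. f \<zeta> (c * z) + \<epsilon>)"
      using f0 \<epsilon>(1) by (intro prod_nonneg) (auto intro!: add_nonneg_nonneg)
    then show ?thesis using mult_right_mono[OF one_le_power[OF Fc, of 2]] by simp
  qed
  also have "\<dots> = (\<Prod>i\<in>Z \<times> \<Omega>. t i)"
    unfolding F_def t_def case_prod_beta by (simp add: prod.distrib prod_power_distrib flip: prod_norm)
  also have "\<dots> \<le> (1/25) ^ (L * N)" by (rule upper)
  finally have "(1/12 :: real) ^ (L * N) \<le> (1/25) ^ (L * N)" .
  moreover have "(1/25 :: real) ^ (L * N) < (1/12) ^ (L * N)"
    using L(1) N(1) by (intro power_strict_mono) auto
  ultimately show False by linarith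
qed

end

section \<open>The dichotomy\<close>

context row_isometry
begin

text \<open>Merging two entries destroys exact orthonormality and leaves only the bound 1/100. That
  is nondegeneracy, so \<open>wold\<close> restores a wandering tuple, one entry shorter, before the
  next merge.\<close>

lemma single_generator_wandering:
  assumes n: "letters n = {1}" and X: "wander k X"
  shows "\<exists>Z. wander 1 Z"
  using X
proof (induction k arbitrary: X rule: less_induct)
  case (less k)
  interpret U: complex_isometry "S 1"
    by unfold_locales (use n bounded_linear_S[of 1] in
      \<open>auto simp: S_scaleC cinner_S bounded_linear.linear linear_add\<close>)
  have opw_rep: "opw (replicate m 1) x = U.Up m x" for m x
    by (induction m) auto
  have rep: "replicate m 1 \<in> \<W>" for m by (induction m) (auto simp: n)
  have words: "w = replicate (length w) 1" if "w \<in> \<W>" for w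
    using that by (induction w) (auto simp: n)
  consider "k = 0" | "k = 1" | k' where "k = Suc (Suc k')"
    by (metis One_nat_def not0_implies_Suc)
  then show ?case
  proof cases
    case 1
    then show ?thesis using less.prems unfolding wander_def by (auto dest!: bspec[of _ _ "[]"])
  next
    case 2
    then show ?thesis using less.prems by blast
  next
    case 3
    have "(\<Sum>j<Suc (Suc k'). cinner (U.Up m (X j)) (U.Up l (X j))) = (if m = l then 1 else 0)" for m l
    proof -
      have "(\<Sum>j<k. cinner (opw (replicate m 1) (X j)) (opw (replicate l 1) (X j)))
          = (if replicate m (1 :: nat) = replicate l 1 then 1 else 0)"
        using less.prems rep unfolding wander_def by blast
      moreover have "replicate m (1 :: nat) = replicate l 1 \<longleftrightarrow> m = l" by (metis length_replicate)
      ultimately show ?thesis by (simp only: opw_rep 3)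
    qed
    from U.merge_wandering_pair[where k = k' and X = X, OF this] obtain \<zeta> where
      \<zeta>: "\<forall>a d. a 0 = 1 \<longrightarrow> 1/100 \<le> (\<Sum>j<Suc k'. (norm (U.upol a d
        (if j < k' then X j else X k' + \<zeta> *\<^sub>C X (Suc k'))))\<^sup>2)" by (elim exE)
    define Y where "Y j = (if j < k' then X j else X k' + \<zeta> *\<^sub>C X (Suc k'))" for j
    have "1/100 \<le> (\<Sum>j<Suc k'. (norm (Y j + pol a W (Y j)))\<^sup>2)"
      if W: "finite W" "W \<subseteq> \<W> - {[]}" for a W
    proof -
      define d where "d = Max (insert 0 (length ` W))"
      define M where "M = length ` W"
      have M: "finite M" "M \<subseteq> {..d}" "0 \<notin> M" using W by (auto simp: M_def d_def)
      have WM: "W = (\<lambda>m. replicate m 1) ` M"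
        unfolding M_def image_image using W words by (force simp: image_iff)
      \<comment> \<open>The value 1 at 0 represents the summand \<open>Y j\<close>, since
        \<open>W\<close> contains no empty word.\<close>
      define b where "b m = (if m = 0 then 1 else if m \<in> M then a (replicate m 1) else 0)" for m
      have "Y j + pol a W (Y j) = U.upol b d (Y j)" for j
      proof -
        have "pol a W (Y j) = (\<Sum>m\<in>M. a (replicate m 1) *\<^sub>C U.Up m (Y j))"
          unfolding pol_def WM by (subst sum.reindex) (auto simp: inj_on_def opw_rep[unfolded One_nat_def] dest: arg_cong[of _ _ length])
        also have "\<dots> = (\<Sum>m\<in>M. b m *\<^sub>C U.Up m (Y j))"
          by (rule sum.cong) (use M(3) in \<open>auto simp: b_def\<close>)
        finally have "Y j + pol a W (Y j) = (\<Sum>m\<in>insert 0 M. b m *\<^sub>C U.Up m (Y j))"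
          using M by (simp add: b_def)
        also have "\<dots> = U.upol b d (Y j)"
          unfolding U.upol_def by (rule sum.mono_neutral_left) (use M in \<open>auto simp: b_def\<close>)
        finally show ?thesis .
      qed
      then show ?thesis using \<zeta>[rule_format, of b d] by (simp add: b_def Y_def)
    qed
    then have "nondeg (Suc k') Y" unfolding nondeg_def by (intro exI[of _ "1/100"]) auto
    from wold[OF this] obtain Z where "wander (Suc k') Z" by blast
    with less.IH[of "Suc k'"] 3 show ?thesis by blast
  qed
qed

lemma several_generators_wandering:
  assumes ab: "a \<in> letters n" "b \<in> letters n" "a \<noteq> b" and X: "wander k X"
  shows "\<exists>Z. wander 1 Z"
proof (rule ccontr)
  assume none: "\<not> ?thesis"
  have deg: "\<not> nondeg 1 (\<lambda>_. x)" for x using wold none by blast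
  \<comment> \<open>Recurrence is the degeneracy of all one-entry tuples, up to squaring the
    norm.\<close>
  have "recurrent"
    unfolding recurrent_def
  proof (intro allI impI)
    fix x :: 'a and e :: real assume "e > 0"
    then have "e\<^sup>2 > 0" by simp
    then obtain a W where W: "finite W" "W \<subseteq> \<W> - {[]}" "(norm (x + pol a W x))\<^sup>2 < e\<^sup>2"
      using deg[of x] unfolding nondeg_def by (auto simp: not_le dest!: spec[of _ "e\<^sup>2"])
    then have "norm (x + pol a W x) < e" using \<open>e > 0\<close> by (meson less_imp_le power2_less_imp_less)
    with W show "\<exists>a W. finite W \<and> W \<subseteq> \<W> - {[]} \<and> norm (x + pol a W x) < e"
      by (intro exI[of _ a] exI[of _ W]) simp
  qed
  moreover have "\<exists>j<k. X j \<noteq> 0"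
  proof (rule ccontr)
    assume "\<not> (\<exists>j<k. X j \<noteq> 0)"
    then have "(\<Sum>j<k. cinner (opw [] (X j)) (opw [] (X j))) = 0" by (intro sum.neutral) auto
    then show False using X unfolding wander_def by (auto dest!: bspec[of _ _ "[]"])
  qed
  then obtain j where "ac (X j)" "X j \<noteq> 0" using wander_ac[OF X] by blast
  ultimately have "\<exists>x y. \<forall>w\<in>\<W>. cinner (opw w x) y = (if w = [] then 1 else 0)"
    by (intro exact_factorization[OF _ _ _ ab])
  then show False using nondeg_of_factorization deg by blast
qed

end

theorem corollary4p13:
  fixes n :: enat and S :: "nat \<Rightarrow> 'a::chilbert_space \<Rightarrow> 'a"
  assumes "1 \<le> n"
    and "\<And>i. i \<in> letters n \<Longrightarrow> S i \<in> bounded_operators"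
    and "\<And>i. i \<in> letters n \<Longrightarrow> cadjoint (S i) \<circ> S i = id"
    and "\<And>i j. i \<in> letters n \<Longrightarrow> j \<in> letters n \<Longrightarrow> i \<noteq> j \<Longrightarrow> cadjoint (S i) \<circ> S j = (\<lambda>x. 0)"
  shows "von_neumann_algebra (free_semigroup_algebra n S) \<or> (\<exists>x. wandering_vector n S x)"
proof -
  interpret row_isometry n S
  proof
    fix i j x y assume ij: "i \<in> letters n" "j \<in> letters n"
    have "cinner (S i x) (S j y) = cinner x ((cadjoint (S i) \<circ> S j) y)"
      using assms(2)[OF ij(1)] by (simp add: cinner_cadjoint)
    also have "cadjoint (S i) \<circ> S j = (if i = j then id else (\<lambda>x. 0))"
    proof (cases "i = j")
      case True
      then show ?thesis using assms(3)[OF ij(1)] by metis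
    next
      case False
      then show ?thesis using assms(4)[OF ij] by metis
    qed
    finally show "cinner (S i x) (S j y) = (if i = j then cinner x y else 0)" by simp
  qed (rule assms(2))
  show ?thesis
  proof (cases "von_neumann_algebra (free_semigroup_algebra n S)")
    case False
    then obtain k X where "nondeg k X" using not_von_neumann_nondeg by blast
    then obtain X where X: "wander k X" using wold by blast
    have "\<exists>Z. wander 1 Z"
    proof (cases "n = 1")
      case True
      then have "letters n = {1}" by (auto simp: letters_def one_enat_def)
      then show ?thesis using single_generator_wandering X by blast
    next
      case False
      then have "2 \<le> n" using assms(1)
        by (cases n) (auto simp: one_enat_def numeral_eq_enat)
      then have "1 \<in> letters n" "2 \<in> letters n"
        using assms(1) by (auto simp: letters_def one_enat_def numeral_eq_enat)
      then show ?thesis using several_generators_wandering[of 1 2] X by simp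
    qed
    then show ?thesis using wander_1 by blast
  qed simp
qed

end
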